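(* (The Cuntz-Krieger uniqueness theorem.) Let $\Lambda$ be an aperiodic finitely aligned $k$-graph and let $R$ be a commutative ring with $1$. Suppose that $A$ is an $R$-algebra and $\pi:\operatorname{KP}_R(\Lambda)\to A$ is an $R$-algebra homomorphism such that $\pi(rs_v)\neq0$ for all $r\in R\setminus\{0\}$ and $v\in\Lambda^0$. Then $\pi$ is injective.
   Context: $\mathbb{N}$ contains $0$; for $m,n\in\mathbb{N}^k$ ($k\ge 1$), $m\le n$ and $m\vee n$ (maximum) are taken coordinatewise. A $k$-graph $\Lambda$ is a countable small category with a functor $d:\Lambda\to\mathbb{N}^k$ ($\mathbb{N}^k$ viewed as a category with one object) satisfying the factorisation property: if $d(\lambda)=m+n$ there are unique $\mu,\nu\in\Lambda$ with $\lambda=\mu\nu$, $d(\mu)=m$, $d(\nu)=n$; write $\lambda(0,m)=\mu$, $\lambda(m,m+n)=\nu$. $\Lambda^0$ denotes the objects (vertices), identified with the identity morphisms, i.e. the morphisms of degree $0$. $r(\lambda), s(\lambda)$ are the range (codomain) and source (domain); $\lambda\mu$ is defined when $s(\lambda)=r(\mu)$. $v\Lambda=\{\lambda\in\Lambda: r(\lambda)=v\}$; $\Lambda v=\{\lambda\in\Lambda:s(\lambda)=v\}$. For $\lambda,\mu\in\Lambda$, $\operatorname{MCE}(\lambda,\mu)$ is the set of $\tau\in\Lambda$ with $d(\tau)=d(\lambda)\vee d(\mu)$, $\tau(0,d(\lambda))=\lambda$, $\tau(0,d(\mu))=\mu$, and $\Lambda^{\min}(\lambda,\mu)=\{(\rho,\tau)\in\Lambda\times\Lambda:\lambda\rho=\mu\tau\in\operatorname{MCE}(\lambda,\mu)\}$.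 $\Lambda$ is finitely aligned if every $\Lambda^{\min}(\lambda,\mu)$ is finite (possibly empty). A set $E\subseteq v\Lambda$ is exhaustive if for every $\lambda\in v\Lambda$ there is $\mu\in E$ with $\Lambda^{\min}(\lambda,\mu)\ne\emptyset$. $\operatorname{FE}(\Lambda)$ is the collection of all finite exhaustive sets $E\subseteq v\Lambda\setminus\{v\}$, $v\in\Lambda^0$; for such $E$, $r(E):=v$. Ghost paths: for each $\lambda\in\Lambda$ there is a formal symbol $\lambda^*$, with $v^*:=v$ for $v\in\Lambda^0$; $G(\Lambda^{\ne0})$ is the set of $\lambda^*$ with $\lambda\notin\Lambda^0$. $R$-algebras are associative and not assumed unital. A Kumjian-Pask $\Lambda$-family $\{S_\lambda,S_{\mu^*}:\lambda,\mu\in\Lambda\}$ in an $R$-algebra $A$ is a map $S:\Lambda\cup G(\Lambda^{\neq0})\to A$ such that: (KP1) $\{S_v:v\in\Lambda^0\}$ are mutually orthogonal idempotents; (KP2) if $s(\lambda)=r(\mu)$ then $S_\lambda S_\mu=S_{\lambda\mu}$ and $S_{\mu^*}S_{\lambda^*}=S_{(\lambda\mu)^*}$; (KP3) $S_{\lambda^*}S_\mu=\sum_{(\rho,\tau)\in\Lambda^{\min}(\lambda,\mu)}S_\rho S_{\tau^*}$ for all $\lambda,\mu\in\Lambda$ (empty sum is $0$); (KP4) $\prod_{\lambda\in E}(S_{r(E)}-S_\lambda S_{\lambda^*})=0$ for all $E\in\operatorname{FE}(\Lambda)$ (the factors commute as a consequence of (KP1)-(KP3)). $\operatorname{KP}_R(\Lambda)$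 is the universal $R$-algebra generated by a Kumjian-Pask $\Lambda$-family $\{s_\lambda,s_{\mu^*}\}$: every Kumjian-Pask $\Lambda$-family $S$ in an $R$-algebra $A$ induces a unique $R$-algebra homomorphism $\operatorname{KP}_R(\Lambda)\to A$ with $s_\lambda\mapsto S_\lambda$, $s_{\mu^*}\mapsto S_{\mu^*}$. Boundary paths: for $m\in(\mathbb{N}\cup\{\infty\})^k$, $\Omega_{k,m}=\{(p,q)\in\mathbb{N}^k\times\mathbb{N}^k:p\le q\le m\}$ is the $k$-graph with objects $\{p\in\mathbb{N}^k:p\le m\}$, $r(p,q)=p$, $s(p,q)=q$, $d(p,q)=q-p$. A boundary path of $\Lambda$ is a degree-preserving functor $x:\Omega_{k,m}\to\Lambda$ such that for every $n\in\mathbb{N}^k$ with $n\le m$ and every $E\in\operatorname{FE}(\Lambda)$ with $r(E)=x(n,n)$ there is $\lambda\in E$ with $n+d(\lambda)\le m$ and $x(n,n+d(\lambda))=\lambda$. Put $d(x)=m$, $r(x)=x(0,0)$. For $\lambda\in\Lambda$ with $s(\lambda)=r(x)$, $\lambda x$ is the boundary path of degree $d(\lambda)+d(x)$ with $(\lambda x)(0,d(\lambda))=\lambda$ and $(\lambda x)(d(\lambda)+p,d(\lambda)+q)=x(p,q)$. A boundary path $x$ is aperiodic if for all $\lambda,\mu\in\Lambda r(x)$, $\lambda\ne\mu$ implies $\lambda x\neq\mu x$. $\Lambda$ is aperiodic if for each $v\in\Lambda^0$ there is an aperiodic boundary path $x$ with $r(x)=v$. *)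

theory Defs
  imports
    "HOL-Library.Poly_Mapping"
    "HOL-Library.Function_Algebras"
    "HOL-Library.Extended_Nat"
    "HOL-Library.Countable_Set"
    "HOL-Library.FuncSet"
begin

section \<open>Higher-rank graphs\<close>

text \<open>
  A small category is given by its set of morphisms; an object is identified with its identity
  morphism, so range and source take values in the morphisms. Degrees live in
  \<^typ>\<open>'k \<Rightarrow> nat\<close> for a (nonempty) finite index type \<^typ>\<open>'k\<close>, so that \<open>k = CARD('k) \<ge> 1\<close>;
  \<open>+\<close>, \<open>-\<close>, \<open>\<le>\<close> and \<^const>\<open>sup\<close> on degrees are the coordinatewise operations of the library.
\<close>

record ('e, 'k) kgraph_data =
  mor :: "'e set"
  rng :: "'e \<Rightarrow> 'e"
  src :: "'e \<Rightarrow> 'e"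
  cmp :: "'e \<Rightarrow> 'e \<Rightarrow> 'e"
  deg :: "'e \<Rightarrow> 'k \<Rightarrow> nat"

locale kgraph =
  fixes \<Lambda> :: "('e, 'k::finite) kgraph_data"
  assumes countable_mor: "countable (mor \<Lambda>)"
    and rng_mor: "\<alpha> \<in> mor \<Lambda> \<Longrightarrow> rng \<Lambda> \<alpha> \<in> mor \<Lambda>"
    and src_mor: "\<alpha> \<in> mor \<Lambda> \<Longrightarrow> src \<Lambda> \<alpha> \<in> mor \<Lambda>"
    and rng_rng: "\<alpha> \<in> mor \<Lambda> \<Longrightarrow> rng \<Lambda> (rng \<Lambda> \<alpha>) = rng \<Lambda> \<alpha>"
    and src_rng: "\<alpha> \<in> mor \<Lambda> \<Longrightarrow> src \<Lambda> (rng \<Lambda> \<alpha>) = rng \<Lambda> \<alpha>"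
    and rng_src: "\<alpha> \<in> mor \<Lambda> \<Longrightarrow> rng \<Lambda> (src \<Lambda> \<alpha>) = src \<Lambda> \<alpha>"
    and src_src: "\<alpha> \<in> mor \<Lambda> \<Longrightarrow> src \<Lambda> (src \<Lambda> \<alpha>) = src \<Lambda> \<alpha>"
    and cmp_mor: "\<lbrakk>\<alpha> \<in> mor \<Lambda>; \<mu> \<in> mor \<Lambda>; src \<Lambda> \<alpha> = rng \<Lambda> \<mu>\<rbrakk> \<Longrightarrow> cmp \<Lambda> \<alpha> \<mu> \<in> mor \<Lambda>"
    and rng_cmp: "\<lbrakk>\<alpha> \<in> mor \<Lambda>; \<mu> \<in> mor \<Lambda>; src \<Lambda> \<alpha> = rng \<Lambda> \<mu>\<rbrakk> \<Longrightarrow> rng \<Lambda> (cmp \<Lambda> \<alpha> \<mu>) = rng \<Lambda> \<alpha>"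
    and src_cmp: "\<lbrakk>\<alpha> \<in> mor \<Lambda>; \<mu> \<in> mor \<Lambda>; src \<Lambda> \<alpha> = rng \<Lambda> \<mu>\<rbrakk> \<Longrightarrow> src \<Lambda> (cmp \<Lambda> \<alpha> \<mu>) = src \<Lambda> \<mu>"
    and cmp_assoc: "\<lbrakk>\<alpha> \<in> mor \<Lambda>; \<mu> \<in> mor \<Lambda>; \<nu> \<in> mor \<Lambda>; src \<Lambda> \<alpha> = rng \<Lambda> \<mu>; src \<Lambda> \<mu> = rng \<Lambda> \<nu>\<rbrakk>
      \<Longrightarrow> cmp \<Lambda> (cmp \<Lambda> \<alpha> \<mu>) \<nu> = cmp \<Lambda> \<alpha> (cmp \<Lambda> \<mu> \<nu>)"
    and cmp_rng_left: "\<alpha> \<in> mor \<Lambda> \<Longrightarrow> cmp \<Lambda> (rng \<Lambda> \<alpha>) \<alpha> = \<alpha>"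
    and cmp_src_right: "\<alpha> \<in> mor \<Lambda> \<Longrightarrow> cmp \<Lambda> \<alpha> (src \<Lambda> \<alpha>) = \<alpha>"
    and deg_rng: "\<alpha> \<in> mor \<Lambda> \<Longrightarrow> deg \<Lambda> (rng \<Lambda> \<alpha>) = 0"
    and deg_src: "\<alpha> \<in> mor \<Lambda> \<Longrightarrow> deg \<Lambda> (src \<Lambda> \<alpha>) = 0"
    and deg_cmp: "\<lbrakk>\<alpha> \<in> mor \<Lambda>; \<mu> \<in> mor \<Lambda>; src \<Lambda> \<alpha> = rng \<Lambda> \<mu>\<rbrakk>
      \<Longrightarrow> deg \<Lambda> (cmp \<Lambda> \<alpha> \<mu>) = deg \<Lambda> \<alpha> + deg \<Lambda> \<mu>"
    and factorisation: "\<lbrakk>\<alpha> \<in> mor \<Lambda>; deg \<Lambda> \<alpha> = m + n\<rbrakk>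
      \<Longrightarrow> \<exists>!p. case p of (\<mu>, \<nu>) \<Rightarrow> \<mu> \<in> mor \<Lambda> \<and> \<nu> \<in> mor \<Lambda> \<and> src \<Lambda> \<mu> = rng \<Lambda> \<nu> \<and>
            \<alpha> = cmp \<Lambda> \<mu> \<nu> \<and> deg \<Lambda> \<mu> = m \<and> deg \<Lambda> \<nu> = n"

definition verts :: "('e, 'k) kgraph_data \<Rightarrow> 'e set" where
  "verts \<Lambda> = {v \<in> mor \<Lambda>. rng \<Lambda> v = v}"

text \<open>
  For \<open>\<alpha> = \<mu>\<nu>\<close> with \<open>deg \<mu> = m\<close>, \<open>initial \<Lambda> \<alpha> m\<close> is \<open>\<mu> = \<alpha>(0,m)\<close> and \<open>final \<Lambda> \<alpha> m\<close> is
  \<open>\<nu> = \<alpha>(m, deg \<alpha>)\<close>; only used for \<open>m \<le> deg \<alpha>\<close>.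
\<close>

definition initial :: "('e, 'k) kgraph_data \<Rightarrow> 'e \<Rightarrow> ('k \<Rightarrow> nat) \<Rightarrow> 'e" where
  "initial \<Lambda> \<alpha> m = (THE \<mu>. \<mu> \<in> mor \<Lambda> \<and> deg \<Lambda> \<mu> = m \<and>
     (\<exists>\<nu> \<in> mor \<Lambda>. src \<Lambda> \<mu> = rng \<Lambda> \<nu> \<and> \<alpha> = cmp \<Lambda> \<mu> \<nu>))"

definition final :: "('e, 'k) kgraph_data \<Rightarrow> 'e \<Rightarrow> ('k \<Rightarrow> nat) \<Rightarrow> 'e" where
  "final \<Lambda> \<alpha> m = (THE \<nu>. \<nu> \<in> mor \<Lambda> \<and>
     (\<exists>\<mu> \<in> mor \<Lambda>. deg \<Lambda> \<mu> = m \<and> src \<Lambda> \<mu> = rng \<Lambda> \<nu> \<and> \<alpha> = cmp \<Lambda> \<mu> \<nu>))"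

definition MCE :: "('e, 'k) kgraph_data \<Rightarrow> 'e \<Rightarrow> 'e \<Rightarrow> 'e set" where
  "MCE \<Lambda> \<alpha> \<mu> = {\<tau> \<in> mor \<Lambda>. deg \<Lambda> \<tau> = sup (deg \<Lambda> \<alpha>) (deg \<Lambda> \<mu>) \<and>
     initial \<Lambda> \<tau> (deg \<Lambda> \<alpha>) = \<alpha> \<and> initial \<Lambda> \<tau> (deg \<Lambda> \<mu>) = \<mu>}"

definition Lmin :: "('e, 'k) kgraph_data \<Rightarrow> 'e \<Rightarrow> 'e \<Rightarrow> ('e \<times> 'e) set" where
  "Lmin \<Lambda> \<alpha> \<mu> = {(\<rho>, \<tau>). \<rho> \<in> mor \<Lambda> \<and> \<tau> \<in> mor \<Lambda> \<and> src \<Lambda> \<alpha> = rng \<Lambda> \<rho> \<and> src \<Lambda> \<mu> = rng \<Lambda> \<tau> \<and>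
     cmp \<Lambda> \<alpha> \<rho> = cmp \<Lambda> \<mu> \<tau> \<and> cmp \<Lambda> \<alpha> \<rho> \<in> MCE \<Lambda> \<alpha> \<mu>}"

definition finitely_aligned :: "('e, 'k) kgraph_data \<Rightarrow> bool" where
  "finitely_aligned \<Lambda> \<longleftrightarrow> (\<forall>\<alpha> \<in> mor \<Lambda>. \<forall>\<mu> \<in> mor \<Lambda>. finite (Lmin \<Lambda> \<alpha> \<mu>))"

definition exhaustive :: "('e, 'k) kgraph_data \<Rightarrow> 'e \<Rightarrow> 'e set \<Rightarrow> bool" where
  "exhaustive \<Lambda> v E \<longleftrightarrow> E \<subseteq> {\<alpha> \<in> mor \<Lambda>. rng \<Lambda> \<alpha> = v} \<and>
     (\<forall>\<alpha> \<in> mor \<Lambda>. rng \<Lambda> \<alpha> = v \<longrightarrow> (\<exists>\<mu> \<in> E. Lmin \<Lambda> \<alpha> \<mu> \<noteq> {}))"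

text \<open>\<open>E \<in> FE \<Lambda> v\<close> says that \<open>E \<in> FE(\<Lambda>)\<close> and \<open>r(E) = v\<close>.\<close>

definition FE :: "('e, 'k) kgraph_data \<Rightarrow> 'e \<Rightarrow> 'e set set" where
  "FE \<Lambda> v = {E. v \<in> verts \<Lambda> \<and> finite E \<and> v \<notin> E \<and> exhaustive \<Lambda> v E}"


section \<open>Boundary paths and aperiodicity\<close>

definition fin_le :: "('k \<Rightarrow> nat) \<Rightarrow> ('k \<Rightarrow> enat) \<Rightarrow> bool" where
  "fin_le n m \<longleftrightarrow> (\<forall>i. enat (n i) \<le> m i)"

definition Omega :: "('k \<Rightarrow> enat) \<Rightarrow> (('k \<Rightarrow> nat) \<times> ('k \<Rightarrow> nat), 'k) kgraph_data" where
  "Omega m = \<lparr> mor = {(p, q). p \<le> q \<and> fin_le q m},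
     rng = (\<lambda>(p, q). (p, p)), src = (\<lambda>(p, q). (q, q)),
     cmp = (\<lambda>(p, q) (p', q'). (p, q')), deg = (\<lambda>(p, q). q - p) \<rparr>"

definition degree_functor :: "('d, 'k) kgraph_data \<Rightarrow> ('e, 'k) kgraph_data \<Rightarrow> ('d \<Rightarrow> 'e) \<Rightarrow> bool" where
  "degree_functor \<Gamma> \<Lambda> F \<longleftrightarrow>
     (\<forall>\<alpha> \<in> mor \<Gamma>. F \<alpha> \<in> mor \<Lambda> \<and> F (rng \<Gamma> \<alpha>) = rng \<Lambda> (F \<alpha>) \<and> F (src \<Gamma> \<alpha>) = src \<Lambda> (F \<alpha>) \<and>
        deg \<Lambda> (F \<alpha>) = deg \<Gamma> \<alpha>) \<and>
     (\<forall>\<alpha> \<in> mor \<Gamma>. \<forall>\<beta> \<in> mor \<Gamma>. src \<Gamma> \<alpha> = rng \<Gamma> \<beta> \<longrightarrow> F (cmp \<Gamma> \<alpha> \<beta>) = cmp \<Lambda> (F \<alpha>) (F \<beta>))"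

text \<open>
  A path is its degree together with a function on the morphisms of \<open>\<Omega>\<^bsub>k,m\<^esub>\<close>. The function is
  required to be \<^const>\<open>extensional\<close>, so that equality of paths is equality in HOL.
\<close>

type_synonym ('e, 'k) path = "('k \<Rightarrow> enat) \<times> (('k \<Rightarrow> nat) \<times> ('k \<Rightarrow> nat) \<Rightarrow> 'e)"

definition graph_paths :: "('e, 'k) kgraph_data \<Rightarrow> ('e, 'k) path set" where
  "graph_paths \<Lambda> = {(m, x). degree_functor (Omega m) \<Lambda> x \<and> x \<in> extensional (mor (Omega m))}"

definition boundary_paths :: "('e, 'k) kgraph_data \<Rightarrow> ('e, 'k) path set" where
  "boundary_paths \<Lambda> = {(m, x) \<in> graph_paths \<Lambda>.
     \<forall>n. fin_le n m \<longrightarrow> (\<forall>E \<in> FE \<Lambda> (x (n, n)). \<exists>\<alpha> \<in> E.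
       fin_le (n + deg \<Lambda> \<alpha>) m \<and> x (n, n + deg \<Lambda> \<alpha>) = \<alpha>)}"

definition path_rng :: "('e, 'k) path \<Rightarrow> 'e" where
  "path_rng X = snd X (0, 0)"

text \<open>
  \<open>(\<alpha>x)(p,q)\<close> is the segment from \<open>p\<close> to \<open>q\<close> of the morphism \<open>\<alpha> x(0,n)\<close>, for any \<open>n \<le> d(x)\<close> with
  \<open>q \<le> d(\<alpha>) + n\<close>; the truncated difference \<open>q - d(\<alpha>)\<close> is the least such \<open>n\<close>. See
  \<open>path_cons_graph_paths\<close>, \<open>path_cons_initial\<close>, \<open>path_cons_shift\<close> and \<open>path_cons_unique\<close> below.
\<close>

definition path_cons :: "('e, 'k) kgraph_data \<Rightarrow> 'e \<Rightarrow> ('e, 'k) path \<Rightarrow> ('e, 'k) path" where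
  "path_cons \<Lambda> \<alpha> X = (let m = (\<lambda>i. enat (deg \<Lambda> \<alpha> i) + fst X i) in
     (m, restrict (\<lambda>(p, q). final \<Lambda> (initial \<Lambda> (cmp \<Lambda> \<alpha> (snd X (0, q - deg \<Lambda> \<alpha>))) q) p)
           (mor (Omega m))))"

definition aperiodic_path :: "('e, 'k) kgraph_data \<Rightarrow> ('e, 'k) path \<Rightarrow> bool" where
  "aperiodic_path \<Lambda> X \<longleftrightarrow> (\<forall>\<alpha> \<in> mor \<Lambda>. \<forall>\<mu> \<in> mor \<Lambda>.
     src \<Lambda> \<alpha> = path_rng X \<longrightarrow> src \<Lambda> \<mu> = path_rng X \<longrightarrow> \<alpha> \<noteq> \<mu> \<longrightarrow>
     path_cons \<Lambda> \<alpha> X \<noteq> path_cons \<Lambda> \<mu> X)"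

definition aperiodic :: "('e, 'k) kgraph_data \<Rightarrow> bool" where
  "aperiodic \<Lambda> \<longleftrightarrow>
     (\<forall>v \<in> verts \<Lambda>. \<exists>X \<in> boundary_paths \<Lambda>. path_rng X = v \<and> aperiodic_path \<Lambda> X)"


section \<open>Algebras and Kumjian-Pask families\<close>

text \<open>
  The sort \<^typ>\<open>'r::{comm_ring,comm_monoid_mult}\<close> is a commutative ring with \<open>1\<close>; unlike
  \<^class>\<open>comm_ring_1\<close> it admits the zero ring (\<open>0 = 1\<close>). The class \<^class>\<open>ring\<close> is associative but
  not unital.
\<close>

locale r_algebra =
  fixes scale :: "'r::{comm_ring,comm_monoid_mult} \<Rightarrow> 'a::ring \<Rightarrow> 'a"
  assumes scale_add_right: "scale r (a + b) = scale r a + scale r b"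
    and scale_add_left: "scale (r + t) a = scale r a + scale t a"
    and scale_scale: "scale r (scale t a) = scale (r * t) a"
    and scale_one: "scale 1 a = a"
    and scale_mult_left: "scale r a * b = scale r (a * b)"
    and scale_mult_right: "a * scale r b = scale r (a * b)"

text \<open>
  \<open>Path \<alpha>\<close> is the symbol \<open>\<alpha>\<close> and \<open>Ghost \<alpha>\<close> the symbol \<open>\<alpha>\<^sup>*\<close> for \<open>\<alpha>\<close> not a vertex; \<open>star\<close> implements
  the convention \<open>v\<^sup>* = v\<close>. Only the symbols in \<open>symbols \<Lambda>\<close> are meaningful.
\<close>

datatype 'e symbol = Path 'e | Ghost 'e

definition symbols :: "('e, 'k) kgraph_data \<Rightarrow> 'e symbol set" where
  "symbols \<Lambda> = Path ` mor \<Lambda> \<union> Ghost ` (mor \<Lambda> - verts \<Lambda>)"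

definition star :: "('e, 'k) kgraph_data \<Rightarrow> 'e \<Rightarrow> 'e symbol" where
  "star \<Lambda> \<alpha> = (if \<alpha> \<in> verts \<Lambda> then Path \<alpha> else Ghost \<alpha>)"

text \<open>Product of a nonempty list, in a ring without unit.\<close>

fun list_product :: "'a::ring list \<Rightarrow> 'a" where
  "list_product [] = 0"
| "list_product [a] = a"
| "list_product (a # b # as) = a * list_product (b # as)"

text \<open>
  The Kumjian-Pask relations modulo \<open>J\<close>: equations hold up to an element of \<open>J\<close>. In the product
  over \<open>E\<close>, which is never empty, all enumerations are allowed; by the other relations the factors
  commute modulo an ideal \<open>J\<close>.
\<close>

definition kp_family_mod :: "('e, 'k) kgraph_data \<Rightarrow> 'a::ring set \<Rightarrow> ('e symbol \<Rightarrow> 'a) \<Rightarrow> bool" where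
  "kp_family_mod \<Lambda> J S \<longleftrightarrow>
     (\<forall>v \<in> verts \<Lambda>. S (Path v) * S (Path v) - S (Path v) \<in> J) \<and>
     (\<forall>v \<in> verts \<Lambda>. \<forall>w \<in> verts \<Lambda>. v \<noteq> w \<longrightarrow> S (Path v) * S (Path w) \<in> J) \<and>
     (\<forall>\<alpha> \<in> mor \<Lambda>. \<forall>\<mu> \<in> mor \<Lambda>. src \<Lambda> \<alpha> = rng \<Lambda> \<mu> \<longrightarrow>
        S (Path \<alpha>) * S (Path \<mu>) - S (Path (cmp \<Lambda> \<alpha> \<mu>)) \<in> J \<and>
        S (star \<Lambda> \<mu>) * S (star \<Lambda> \<alpha>) - S (star \<Lambda> (cmp \<Lambda> \<alpha> \<mu>)) \<in> J) \<and>
     (\<forall>\<alpha> \<in> mor \<Lambda>. \<forall>\<mu> \<in> mor \<Lambda>.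
        S (star \<Lambda> \<alpha>) * S (Path \<mu>) - (\<Sum>(\<rho>, \<tau>) \<in> Lmin \<Lambda> \<alpha> \<mu>. S (Path \<rho>) * S (star \<Lambda> \<tau>)) \<in> J) \<and>
     (\<forall>v \<in> verts \<Lambda>. \<forall>E \<in> FE \<Lambda> v. \<forall>es. distinct es \<and> set es = E \<longrightarrow>
        list_product (map (\<lambda>\<alpha>. S (Path v) - S (Path \<alpha>) * S (star \<Lambda> \<alpha>)) es) \<in> J)"

abbreviation kp_family :: "('e, 'k) kgraph_data \<Rightarrow> ('e symbol \<Rightarrow> 'a::ring) \<Rightarrow> bool" where
  "kp_family \<Lambda> S \<equiv> kp_family_mod \<Lambda> {0} S"


section \<open>The Kumjian-Pask algebra\<close>

text \<open>
  The algebra is the free (non-unital) \<open>R\<close>-algebra on the symbols modulo the ideal generated by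
  the Kumjian-Pask relations; \<open>kp_family_mod_kp_ideal\<close>, \<open>kp_universal\<close> and \<open>kp_universal_unique\<close>
  below give its universal property. The free algebra
  consists of the elements of the monoid algebra of the free monoid that are supported on
  nonempty words in \<open>symbols \<Lambda>\<close>.
\<close>

datatype 'x word = Word (letters: "'x list")

instantiation word :: (type) monoid_add
begin
definition "0 = Word []"
definition "u + v = Word (letters u @ letters v)"
instance by standard (auto simp: zero_word_def plus_word_def)
end

type_synonym ('e, 'r) pre_kp = "'e symbol word \<Rightarrow>\<^sub>0 'r"

definition free_algebra :: "('e, 'k) kgraph_data \<Rightarrow> ('e, 'r::{comm_ring,comm_monoid_mult}) pre_kp set" where
  "free_algebra \<Lambda> = {p. \<forall>w \<in> Poly_Mapping.keys p. letters w \<noteq> [] \<and> set (letters w) \<subseteq> symbols \<Lambda>}"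

definition gen :: "'e symbol \<Rightarrow> ('e, 'r::{comm_ring,comm_monoid_mult}) pre_kp" where
  "gen g = Poly_Mapping.single (Word [g]) 1"

definition free_scale :: "'r::{comm_ring,comm_monoid_mult} \<Rightarrow> ('e, 'r) pre_kp \<Rightarrow> ('e, 'r) pre_kp" where
  "free_scale r p = Poly_Mapping.map ((*) r) p"

definition free_ideal :: "('e, 'k) kgraph_data \<Rightarrow> ('e, 'r::{comm_ring,comm_monoid_mult}) pre_kp set \<Rightarrow> bool" where
  "free_ideal \<Lambda> J \<longleftrightarrow> J \<subseteq> free_algebra \<Lambda> \<and> 0 \<in> J \<and> (\<forall>a \<in> J. \<forall>b \<in> J. a + b \<in> J) \<and>
     (\<forall>r. \<forall>a \<in> J. free_scale r a \<in> J) \<and>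
     (\<forall>a \<in> J. \<forall>p \<in> free_algebra \<Lambda>. p * a \<in> J \<and> a * p \<in> J)"

definition kp_ideal :: "('e, 'k) kgraph_data \<Rightarrow> ('e, 'r::{comm_ring,comm_monoid_mult}) pre_kp set" where
  "kp_ideal \<Lambda> = \<Inter>{J. free_ideal \<Lambda> J \<and> kp_family_mod \<Lambda> J gen}"

definition kp_class :: "('e, 'k) kgraph_data \<Rightarrow> ('e, 'r::{comm_ring,comm_monoid_mult}) pre_kp
    \<Rightarrow> ('e, 'r) pre_kp set" where
  "kp_class \<Lambda> p = {q \<in> free_algebra \<Lambda>. q - p \<in> kp_ideal \<Lambda>}"

definition KP :: "('e, 'k) kgraph_data \<Rightarrow> ('e, 'r::{comm_ring,comm_monoid_mult}) pre_kp set set" where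
  "KP \<Lambda> = kp_class \<Lambda> ` free_algebra \<Lambda>"

definition kp_add :: "('e, 'k) kgraph_data \<Rightarrow> ('e, 'r::{comm_ring,comm_monoid_mult}) pre_kp set
    \<Rightarrow> ('e, 'r) pre_kp set \<Rightarrow> ('e, 'r) pre_kp set" where
  "kp_add \<Lambda> X Y = (\<Union>p \<in> X. \<Union>q \<in> Y. kp_class \<Lambda> (p + q))"

definition kp_mult :: "('e, 'k) kgraph_data \<Rightarrow> ('e, 'r::{comm_ring,comm_monoid_mult}) pre_kp set
    \<Rightarrow> ('e, 'r) pre_kp set \<Rightarrow> ('e, 'r) pre_kp set" where
  "kp_mult \<Lambda> X Y = (\<Union>p \<in> X. \<Union>q \<in> Y. kp_class \<Lambda> (p * q))"

definition kp_scale :: "('e, 'k) kgraph_data \<Rightarrow> 'r::{comm_ring,comm_monoid_mult}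
    \<Rightarrow> ('e, 'r) pre_kp set \<Rightarrow> ('e, 'r) pre_kp set" where
  "kp_scale \<Lambda> r X = (\<Union>p \<in> X. kp_class \<Lambda> (free_scale r p))"

definition kp_gen :: "('e, 'k) kgraph_data \<Rightarrow> 'e symbol
    \<Rightarrow> ('e, 'r::{comm_ring,comm_monoid_mult}) pre_kp set" where
  "kp_gen \<Lambda> g = kp_class \<Lambda> (gen g)"

definition kp_hom :: "('e, 'k) kgraph_data \<Rightarrow> ('r::{comm_ring,comm_monoid_mult} \<Rightarrow> 'a::ring \<Rightarrow> 'a)
    \<Rightarrow> (('e, 'r) pre_kp set \<Rightarrow> 'a) \<Rightarrow> bool" where
  "kp_hom \<Lambda> scale \<pi> \<longleftrightarrow>
     (\<forall>X \<in> KP \<Lambda>. \<forall>Y \<in> KP \<Lambda>. \<pi> (kp_add \<Lambda> X Y) = \<pi> X + \<pi> Y \<and> \<pi> (kp_mult \<Lambda> X Y) = \<pi> X * \<pi> Y) \<and>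
     (\<forall>r. \<forall>X \<in> KP \<Lambda>. \<pi> (kp_scale \<Lambda> r X) = scale r (\<pi> X))"


section \<open>Basic facts on paths\<close>

lemma enat_bound_mono:
  assumes "p \<le> q" "fin_le q m" shows "fin_le p m"
  using assms by (metis enat_ord_simps(1) fin_le_def le_funD order_trans)

lemma fin_le_add:
  assumes "fin_le n m" shows "fin_le (d + n) (\<lambda>i. enat (d i) + m i)"
  using assms
  by (simp add: fin_le_def plus_enat_simps(1)[symmetric] add_left_mono del: plus_enat_simps(1))

lemma fin_le_diff:
  assumes "fin_le q (\<lambda>i. enat (d i) + m i)" shows "fin_le (q - d) m"
  unfolding fin_le_def
proof
  fix i show "enat ((q - d) i) \<le> m i"
    using assms[unfolded fin_le_def, rule_format, of i] by (cases "m i") auto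
qed

context kgraph
begin

lemma factor_unique:
  assumes "\<mu> \<in> mor \<Lambda>" "\<nu> \<in> mor \<Lambda>" "src \<Lambda> \<mu> = rng \<Lambda> \<nu>"
    and "\<mu>' \<in> mor \<Lambda>" "\<nu>' \<in> mor \<Lambda>" "src \<Lambda> \<mu>' = rng \<Lambda> \<nu>'"
    and "cmp \<Lambda> \<mu> \<nu> = cmp \<Lambda> \<mu>' \<nu>'" "deg \<Lambda> \<mu> = deg \<Lambda> \<mu>'"
  shows "\<mu> = \<mu>' \<and> \<nu> = \<nu>'"
proof -
  have d: "deg \<Lambda> (cmp \<Lambda> \<mu> \<nu>) = deg \<Lambda> \<mu> + deg \<Lambda> \<nu>"
    by (rule deg_cmp) fact+
  have "deg \<Lambda> \<mu>' + deg \<Lambda> \<nu>' = deg \<Lambda> \<mu> + deg \<Lambda> \<nu>"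
    using d assms deg_cmp by metis
  hence "deg \<Lambda> \<nu>' = deg \<Lambda> \<nu>" using assms(8) by (simp add: fun_eq_iff)
  with factorisation[OF cmp_mor[OF assms(1-3)] d] assms
  have "(\<mu>, \<nu>) = (\<mu>', \<nu>')" by (elim ex1E) (metis (mono_tags, lifting) case_prod_conv)
  thus ?thesis by simp
qed

lemma verts_iff_deg: "verts \<Lambda> = {v \<in> mor \<Lambda>. deg \<Lambda> v = 0}"
proof (intro set_eqI iffI; clarsimp simp: verts_def)
  show "deg \<Lambda> v = 0" if "v \<in> mor \<Lambda>" "rng \<Lambda> v = v" for v
    using deg_rng[OF that(1)] that(2) by simp
  show "rng \<Lambda> v = v" if v: "v \<in> mor \<Lambda>" "deg \<Lambda> v = 0" for v
    using factor_unique[of "rng \<Lambda> v" v v "src \<Lambda> v"] v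
    by (simp add: rng_mor src_mor src_rng rng_src cmp_rng_left cmp_src_right deg_rng)
qed

lemma initial_cmp_deg:
  assumes "\<mu> \<in> mor \<Lambda>" "\<nu> \<in> mor \<Lambda>" "src \<Lambda> \<mu> = rng \<Lambda> \<nu>"
  shows "initial \<Lambda> (cmp \<Lambda> \<mu> \<nu>) (deg \<Lambda> \<mu>) = \<mu>"
  unfolding initial_def
proof (rule the_equality)
  fix \<mu>' assume *: "\<mu>' \<in> mor \<Lambda> \<and> deg \<Lambda> \<mu>' = deg \<Lambda> \<mu> \<and>
     (\<exists>\<nu>'\<in>mor \<Lambda>. src \<Lambda> \<mu>' = rng \<Lambda> \<nu>' \<and> cmp \<Lambda> \<mu> \<nu> = cmp \<Lambda> \<mu>' \<nu>')"
  then obtain \<nu>' where o: "\<nu>' \<in> mor \<Lambda>" "src \<Lambda> \<mu>' = rng \<Lambda> \<nu>'" "cmp \<Lambda> \<mu> \<nu> = cmp \<Lambda> \<mu>' \<nu>'" by blast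
  have d: "\<mu>' \<in> mor \<Lambda>" "deg \<Lambda> \<mu> = deg \<Lambda> \<mu>'" using * by auto
  from factor_unique[OF assms d(1) o d(2)] show "\<mu>' = \<mu>" by blast
qed (use assms in blast)

lemma final_cmp_deg:
  assumes "\<mu> \<in> mor \<Lambda>" "\<nu> \<in> mor \<Lambda>" "src \<Lambda> \<mu> = rng \<Lambda> \<nu>"
  shows "final \<Lambda> (cmp \<Lambda> \<mu> \<nu>) (deg \<Lambda> \<mu>) = \<nu>"
  unfolding final_def
proof (rule the_equality)
  fix \<nu>' assume *: "\<nu>' \<in> mor \<Lambda> \<and>
     (\<exists>\<mu>'\<in>mor \<Lambda>. deg \<Lambda> \<mu>' = deg \<Lambda> \<mu> \<and> src \<Lambda> \<mu>' = rng \<Lambda> \<nu>' \<and> cmp \<Lambda> \<mu> \<nu> = cmp \<Lambda> \<mu>' \<nu>')"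
  then obtain \<mu>' where o: "\<mu>' \<in> mor \<Lambda>" "deg \<Lambda> \<mu>' = deg \<Lambda> \<mu>" "src \<Lambda> \<mu>' = rng \<Lambda> \<nu>'"
    "cmp \<Lambda> \<mu> \<nu> = cmp \<Lambda> \<mu>' \<nu>'" by blast
  have "\<nu>' \<in> mor \<Lambda>" using * by blast
  from factor_unique[OF assms o(1) this o(3,4) o(2)[symmetric]] show "\<nu>' = \<nu>" by blast
qed (use assms in blast)

lemma split_at:
  assumes "\<alpha> \<in> mor \<Lambda>" "m \<le> deg \<Lambda> \<alpha>"
  shows "initial \<Lambda> \<alpha> m \<in> mor \<Lambda>" "final \<Lambda> \<alpha> m \<in> mor \<Lambda>"
    "src \<Lambda> (initial \<Lambda> \<alpha> m) = rng \<Lambda> (final \<Lambda> \<alpha> m)"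
    "cmp \<Lambda> (initial \<Lambda> \<alpha> m) (final \<Lambda> \<alpha> m) = \<alpha>"
    "deg \<Lambda> (initial \<Lambda> \<alpha> m) = m" "deg \<Lambda> (final \<Lambda> \<alpha> m) = deg \<Lambda> \<alpha> - m"
proof -
  have "deg \<Lambda> \<alpha> = m + (deg \<Lambda> \<alpha> - m)"
    using assms(2) by (auto simp: le_fun_def fun_eq_iff)
  from ex1_implies_ex[OF factorisation[OF assms(1) this]] obtain \<mu> \<nu> where
    *: "\<mu> \<in> mor \<Lambda>" "\<nu> \<in> mor \<Lambda>" "src \<Lambda> \<mu> = rng \<Lambda> \<nu>" "\<alpha> = cmp \<Lambda> \<mu> \<nu>" "deg \<Lambda> \<mu> = m"
    "deg \<Lambda> \<nu> = deg \<Lambda> \<alpha> - m" by auto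
  have "initial \<Lambda> \<alpha> m = \<mu>" "final \<Lambda> \<alpha> m = \<nu>"
    using initial_cmp_deg[OF *(1-3)] final_cmp_deg[OF *(1-3)] * by auto
  with * show "initial \<Lambda> \<alpha> m \<in> mor \<Lambda>" "final \<Lambda> \<alpha> m \<in> mor \<Lambda>"
    "src \<Lambda> (initial \<Lambda> \<alpha> m) = rng \<Lambda> (final \<Lambda> \<alpha> m)"
    "cmp \<Lambda> (initial \<Lambda> \<alpha> m) (final \<Lambda> \<alpha> m) = \<alpha>"
    "deg \<Lambda> (initial \<Lambda> \<alpha> m) = m" "deg \<Lambda> (final \<Lambda> \<alpha> m) = deg \<Lambda> \<alpha> - m" by auto
qed

lemma initial_cmp:
  assumes "\<mu> \<in> mor \<Lambda>" "\<nu> \<in> mor \<Lambda>" "src \<Lambda> \<mu> = rng \<Lambda> \<nu>" "m \<le> deg \<Lambda> \<mu>"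
  shows "initial \<Lambda> (cmp \<Lambda> \<mu> \<nu>) m = initial \<Lambda> \<mu> m"
proof -
  note s = split_at[OF assms(1,4)]
  have "src \<Lambda> (final \<Lambda> \<mu> m) = rng \<Lambda> \<nu>" using s assms(3) by (metis src_cmp)
  moreover from this have "cmp \<Lambda> \<mu> \<nu> = cmp \<Lambda> (initial \<Lambda> \<mu> m) (cmp \<Lambda> (final \<Lambda> \<mu> m) \<nu>)"
    using cmp_assoc s assms by metis
  ultimately show ?thesis
    using initial_cmp_deg[of "initial \<Lambda> \<mu> m" "cmp \<Lambda> (final \<Lambda> \<mu> m) \<nu>"] s assms
    by (simp add: cmp_mor rng_cmp)
qed

lemma initial_deg: "\<alpha> \<in> mor \<Lambda> \<Longrightarrow> initial \<Lambda> \<alpha> (deg \<Lambda> \<alpha>) = \<alpha>"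
  using initial_cmp_deg[of \<alpha> "src \<Lambda> \<alpha>"] by (simp add: src_mor rng_src cmp_src_right)

lemma final_zero: "\<alpha> \<in> mor \<Lambda> \<Longrightarrow> final \<Lambda> \<alpha> 0 = \<alpha>"
  using final_cmp_deg[of "rng \<Lambda> \<alpha>" \<alpha>] by (simp add: rng_mor src_rng cmp_rng_left deg_rng)

end

lemma kgraph_Omega: "kgraph (Omega m :: (_, 'k::finite) kgraph_data)"
proof
  show "countable (mor (Omega m))" by simp
  fix \<alpha> :: "('k \<Rightarrow> nat) \<times> ('k \<Rightarrow> nat)" and a b
  assume a: "\<alpha> \<in> mor (Omega m)" "deg (Omega m) \<alpha> = a + b"
  obtain p q where \<alpha>: "\<alpha> = (p, q)" by (cases \<alpha>)
  have le: "\<And>i. p i \<le> q i" and qm: "fin_le q m" using a by (auto simp: \<alpha> Omega_def le_fun_def)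
  have q: "q i = p i + a i + b i" for i
    using a(2) le[of i] by (simp add: \<alpha> Omega_def fun_eq_iff) (metis add.assoc le_add_diff_inverse)
  show "\<exists>!P. case P of (\<mu>, \<nu>) \<Rightarrow> \<mu> \<in> mor (Omega m) \<and> \<nu> \<in> mor (Omega m) \<and>
      src (Omega m) \<mu> = rng (Omega m) \<nu> \<and> \<alpha> = cmp (Omega m) \<mu> \<nu> \<and>
      deg (Omega m) \<mu> = a \<and> deg (Omega m) \<nu> = b"
  proof (rule ex1I[of _ "((p, p + a), (p + a, q))"])
    have "fin_le (p + a) m"
      by (rule enat_bound_mono[OF _ qm]) (simp add: le_fun_def q)
    thus "case ((p, p + a), (p + a, q)) of (\<mu>, \<nu>) \<Rightarrow> \<mu> \<in> mor (Omega m) \<and> \<nu> \<in> mor (Omega m) \<and>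
      src (Omega m) \<mu> = rng (Omega m) \<nu> \<and> \<alpha> = cmp (Omega m) \<mu> \<nu> \<and>
      deg (Omega m) \<mu> = a \<and> deg (Omega m) \<nu> = b"
      using qm by (auto simp: Omega_def \<alpha> le_fun_def q fun_eq_iff)
  next
    fix P assume "case P of (\<mu>, \<nu>) \<Rightarrow> \<mu> \<in> mor (Omega m) \<and> \<nu> \<in> mor (Omega m) \<and>
      src (Omega m) \<mu> = rng (Omega m) \<nu> \<and> \<alpha> = cmp (Omega m) \<mu> \<nu> \<and>
      deg (Omega m) \<mu> = a \<and> deg (Omega m) \<nu> = b"
    thus "P = ((p, p + a), (p + a, q))"
      by (auto simp: Omega_def \<alpha> le_fun_def fun_eq_iff split: prod.splits)
        (metis le_add_diff_inverse)
  qed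
next
  have [simp]: "p - p = 0" for p :: "'k \<Rightarrow> nat" by (simp add: fun_eq_iff)
  fix \<alpha> \<beta> :: "('k \<Rightarrow> nat) \<times> ('k \<Rightarrow> nat)"
  assume \<alpha>: "\<alpha> \<in> mor (Omega m)"
  thus "rng (Omega m) \<alpha> \<in> mor (Omega m)" "src (Omega m) \<alpha> \<in> mor (Omega m)"
    "deg (Omega m) (rng (Omega m) \<alpha>) = 0" "deg (Omega m) (src (Omega m) \<alpha>) = 0"
    by (auto simp: Omega_def intro: enat_bound_mono)
  assume \<beta>: "\<beta> \<in> mor (Omega m)" "src (Omega m) \<alpha> = rng (Omega m) \<beta>"
  with \<alpha> show "cmp (Omega m) \<alpha> \<beta> \<in> mor (Omega m)"
    by (auto simp: Omega_def intro: order_trans)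
  have "t - p = (q - p) + (t - q)" if "p \<le> q" "q \<le> t" for p q t :: "'k \<Rightarrow> nat"
    using that by (auto simp: fun_eq_iff le_fun_def)
  with \<alpha> \<beta> show "deg (Omega m) (cmp (Omega m) \<alpha> \<beta>) = deg (Omega m) \<alpha> + deg (Omega m) \<beta>"
    by (auto simp: Omega_def)
qed (auto simp: Omega_def)

context kgraph
begin

context
  fixes m x
  assumes X: "(m, x) \<in> graph_paths \<Lambda>"
begin

lemma graph_path_facts:
  assumes "p \<le> q" "fin_le q m"
  shows "x (p, q) \<in> mor \<Lambda>" "rng \<Lambda> (x (p, q)) = x (p, p)" "src \<Lambda> (x (p, q)) = x (q, q)"
    "deg \<Lambda> (x (p, q)) = q - p"
proof -
  have a: "(p, q) \<in> mor (Omega m)" using assms by (simp add: Omega_def)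
  have "degree_functor (Omega m) \<Lambda> x" using X by (simp add: graph_paths_def)
  note * = this[unfolded degree_functor_def, THEN conjunct1, rule_format, OF a]
  show "x (p, q) \<in> mor \<Lambda>" using * by blast
  have o: "rng (Omega m) (p, q) = (p, p)" "src (Omega m) (p, q) = (q, q)"
    "deg (Omega m) (p, q) = q - p" by (simp_all add: Omega_def)
  show "rng \<Lambda> (x (p, q)) = x (p, p)" "src \<Lambda> (x (p, q)) = x (q, q)"
    "deg \<Lambda> (x (p, q)) = q - p" using * unfolding o by simp_all
qed

lemma graph_path_cmp:
  assumes "p \<le> q" "q \<le> t" "fin_le t m"
  shows "cmp \<Lambda> (x (p, q)) (x (q, t)) = x (p, t)"
proof -
  have "fin_le q m" using assms(2,3) by (rule enat_bound_mono)
  hence pq: "(p, q) \<in> mor (Omega m)" using assms by (simp add: Omega_def)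
  have qt: "(q, t) \<in> mor (Omega m)" using assms by (simp add: Omega_def)
  have "degree_functor (Omega m) \<Lambda> x" using X by (simp add: graph_paths_def)
  hence "src (Omega m) (p, q) = rng (Omega m) (q, t) \<longrightarrow>
      x (cmp (Omega m) (p, q) (q, t)) = cmp \<Lambda> (x (p, q)) (x (q, t))"
    unfolding degree_functor_def using pq qt by blast
  thus ?thesis by (simp add: Omega_def)
qed

end

context
  fixes \<alpha> m x
  assumes \<alpha>: "\<alpha> \<in> mor \<Lambda>" and X: "(m, x) \<in> graph_paths \<Lambda>" and src_\<alpha>: "src \<Lambda> \<alpha> = x (0, 0)"
begin

lemmas path_facts = graph_path_facts[OF X]
lemmas path_cmp = graph_path_cmp[OF X]

lemma cons_aux:
  assumes "fin_le n m"
  shows "cmp \<Lambda> \<alpha> (x (0, n)) \<in> mor \<Lambda>" "deg \<Lambda> (cmp \<Lambda> \<alpha> (x (0, n))) = deg \<Lambda> \<alpha> + n"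
    "rng \<Lambda> (cmp \<Lambda> \<alpha> (x (0, n))) = rng \<Lambda> \<alpha>"
proof -
  have 0: "0 \<le> n" by (simp add: le_fun_def)
  note f = path_facts[OF 0 assms]
  have s: "src \<Lambda> \<alpha> = rng \<Lambda> (x (0, n))" using f src_\<alpha> by simp
  show "cmp \<Lambda> \<alpha> (x (0, n)) \<in> mor \<Lambda>" "rng \<Lambda> (cmp \<Lambda> \<alpha> (x (0, n))) = rng \<Lambda> \<alpha>"
    using \<alpha> f(1) s by (rule cmp_mor rng_cmp)+
  show "deg \<Lambda> (cmp \<Lambda> \<alpha> (x (0, n))) = deg \<Lambda> \<alpha> + n"
    using deg_cmp[OF \<alpha> f(1) s] f(4) by simp
qed

definition "start q = initial \<Lambda> (cmp \<Lambda> \<alpha> (x (0, q - deg \<Lambda> \<alpha>))) q"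

lemma start_facts:
  assumes q: "fin_le q (\<lambda>i. enat (deg \<Lambda> \<alpha> i) + m i)"
  shows "start q \<in> mor \<Lambda>" "deg \<Lambda> (start q) = q"
proof -
  note c = cons_aux[OF fin_le_diff[OF q]]
  have "q \<le> deg \<Lambda> (cmp \<Lambda> \<alpha> (x (0, q - deg \<Lambda> \<alpha>)))" unfolding c(2) by (auto simp: le_fun_def)
  from split_at(1,5)[OF c(1) this] show "start q \<in> mor \<Lambda>" "deg \<Lambda> (start q) = q"
    by (simp_all only: start_def)
qed

lemma start_extend:
  assumes q: "fin_le q (\<lambda>i. enat (deg \<Lambda> \<alpha> i) + m i)" and pq: "p \<le> q"
  shows "initial \<Lambda> (start q) p = start p"
proof -
  let ?d = "deg \<Lambda> \<alpha>"
  have bq: "fin_le (q - ?d) m" by (rule fin_le_diff[OF q])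
  have le: "p - ?d \<le> q - ?d" using pq by (auto simp: le_fun_def diff_le_mono)
  have bp: "fin_le (p - ?d) m" using le bq by (rule enat_bound_mono)
  note sp = split_at[OF cons_aux(1)[OF bq], of q]
  have qd: "q \<le> deg \<Lambda> (cmp \<Lambda> \<alpha> (x (0, q - ?d)))" unfolding cons_aux(2)[OF bq] by (auto simp: le_fun_def)
  note sp = sp[OF qd]
  have 1: "initial \<Lambda> (cmp \<Lambda> \<alpha> (x (0, q - ?d))) p = initial \<Lambda> (start q) p"
    using initial_cmp[OF sp(1,2,3), of p] sp(4,5) pq by (simp add: start_def)
  have 0: "0 \<le> p - ?d" "0 \<le> q - ?d" by (auto simp: le_fun_def)
  have e: "cmp \<Lambda> (cmp \<Lambda> \<alpha> (x (0, p - ?d))) (x (p - ?d, q - ?d)) = cmp \<Lambda> \<alpha> (x (0, q - ?d))"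
    using \<alpha> src_\<alpha> path_facts[OF 0(1) bp] path_facts[OF le bq] path_cmp[OF 0(1) le bq]
    by (simp add: cmp_assoc)
  have "initial \<Lambda> (cmp \<Lambda> (cmp \<Lambda> \<alpha> (x (0, p - ?d))) (x (p - ?d, q - ?d))) p = start p"
    unfolding start_def
    using \<alpha> src_\<alpha> path_facts[OF 0(1) bp] path_facts[OF le bq]
    by (intro initial_cmp) (auto simp: cons_aux[OF bp] src_cmp le_fun_def)
  with e 1 show ?thesis by simp
qed

lemma path_cons_apply:
  assumes q: "fin_le q (\<lambda>i. enat (deg \<Lambda> \<alpha> i) + m i)" and pq: "p \<le> q"
  shows "snd (path_cons \<Lambda> \<alpha> (m, x)) (p, q) = final \<Lambda> (start q) p"
  using assms by (simp add: path_cons_def Let_def Omega_def start_def)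

lemma path_cons_split:
  assumes q: "fin_le q (\<lambda>i. enat (deg \<Lambda> \<alpha> i) + m i)" and pq: "p \<le> q"
  defines "y \<equiv> snd (path_cons \<Lambda> \<alpha> (m, x)) (p, q)"
  shows "y \<in> mor \<Lambda>" "deg \<Lambda> y = q - p" "src \<Lambda> (start p) = rng \<Lambda> y" "start q = cmp \<Lambda> (start p) y"
    "src \<Lambda> y = src \<Lambda> (start q)"
proof -
  have p: "fin_le p (\<lambda>i. enat (deg \<Lambda> \<alpha> i) + m i)"
    using pq q by (rule enat_bound_mono)
  note s = split_at[OF start_facts(1)[OF q], of p, unfolded start_facts(2)[OF q], OF pq]
  show *: "y \<in> mor \<Lambda>" "deg \<Lambda> y = q - p" "src \<Lambda> (start p) = rng \<Lambda> y" "start q = cmp \<Lambda> (start p) y"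
    using s start_extend[OF q pq] path_cons_apply[OF q pq] by (simp_all add: y_def)
  show "src \<Lambda> y = src \<Lambda> (start q)"
    using * start_facts(1)[OF p] by (simp add: src_cmp)
qed

lemma path_cons_eqI:
  assumes q: "fin_le q (\<lambda>i. enat (deg \<Lambda> \<alpha> i) + m i)" and pq: "p \<le> q"
    and "z \<in> mor \<Lambda>" "src \<Lambda> (start p) = rng \<Lambda> z" "start q = cmp \<Lambda> (start p) z"
  shows "snd (path_cons \<Lambda> \<alpha> (m, x)) (p, q) = z"
proof -
  have p: "fin_le p (\<lambda>i. enat (deg \<Lambda> \<alpha> i) + m i)"
    using pq q by (rule enat_bound_mono)
  show ?thesis
    using final_cmp_deg[OF start_facts(1)[OF p] assms(3,4)] start_facts(2)[OF p] assms(5)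
      path_cons_apply[OF q pq] by simp
qed

lemma fst_path_cons: "fst (path_cons \<Lambda> \<alpha> (m, x)) = (\<lambda>i. enat (deg \<Lambda> \<alpha> i) + m i)"
  by (simp add: path_cons_def Let_def)

lemma path_cons_graph_paths: "path_cons \<Lambda> \<alpha> (m, x) \<in> graph_paths \<Lambda>"
proof -
  let ?M = "\<lambda>i. enat (deg \<Lambda> \<alpha> i) + m i" and ?y = "snd (path_cons \<Lambda> \<alpha> (m, x))"
  have id: "?y (q, q) = src \<Lambda> (start q)" if q: "fin_le q ?M" for q
    using start_facts(1)[OF q] by (intro path_cons_eqI q) (auto simp: src_mor rng_src cmp_src_right)
  have "degree_functor (Omega ?M) \<Lambda> ?y"
    unfolding degree_functor_def
  proof (intro conjI ballI impI)
    fix a assume a: "a \<in> mor (Omega ?M)"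
    obtain p q where pq: "a = (p, q)" by (cases a)
    have le: "p \<le> q" and q: "fin_le q ?M" using a by (auto simp: Omega_def pq)
    have p: "fin_le p ?M" using le q by (rule enat_bound_mono)
    note s = path_cons_split[OF q le]
    show "?y a \<in> mor \<Lambda>" "deg \<Lambda> (?y a) = deg (Omega ?M) a"
      using s by (auto simp: pq Omega_def)
    show "?y (rng (Omega ?M) a) = rng \<Lambda> (?y a)" "?y (src (Omega ?M) a) = src \<Lambda> (?y a)"
      using s id[OF p] id[OF q] by (auto simp: pq Omega_def)
    fix b assume b: "b \<in> mor (Omega ?M)" "src (Omega ?M) a = rng (Omega ?M) b"
    then obtain t where t: "b = (q, t)" "q \<le> t" "fin_le t ?M"
      by (cases b) (auto simp: Omega_def pq)
    note s' = path_cons_split[OF t(3,2)]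
    have "?y (p, t) = cmp \<Lambda> (?y (p, q)) (?y (q, t))"
      using s s' le t start_facts(1)[OF p]
      by (intro path_cons_eqI) (auto simp: cmp_mor rng_cmp cmp_assoc intro: order_trans)
    thus "?y (cmp (Omega ?M) a b) = cmp \<Lambda> (?y a) (?y b)"
      by (simp add: pq t Omega_def)
  qed
  moreover have "?y \<in> extensional (mor (Omega ?M))" by (simp add: path_cons_def Let_def)
  ultimately show ?thesis
    using fst_path_cons by (auto simp: graph_paths_def split: prod.splits)
qed

lemma start_shift:
  assumes "fin_le n m" shows "start (deg \<Lambda> \<alpha> + n) = cmp \<Lambda> \<alpha> (x (0, n))"
  using initial_deg[OF cons_aux(1)[OF assms]] cons_aux(2)[OF assms] by (simp add: start_def)

lemma path_cons_initial: "snd (path_cons \<Lambda> \<alpha> (m, x)) (0, deg \<Lambda> \<alpha>) = \<alpha>"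
proof -
  have "fin_le 0 m" by (simp add: fin_le_def zero_enat_def[symmetric])
  moreover from this have "fin_le (deg \<Lambda> \<alpha>) (\<lambda>i. enat (deg \<Lambda> \<alpha> i) + m i)"
    using fin_le_add[of 0 m "deg \<Lambda> \<alpha>"] by simp
  moreover from start_shift[OF calculation(1)] have "start (deg \<Lambda> \<alpha>) = \<alpha>"
    using \<alpha> src_\<alpha> cmp_src_right by fastforce
  ultimately show ?thesis
    using path_cons_apply[of "deg \<Lambda> \<alpha>" 0] final_zero[OF \<alpha>] by (simp add: le_fun_def)
qed

lemma path_cons_shift:
  assumes "p \<le> q" "fin_le q m"
  shows "snd (path_cons \<Lambda> \<alpha> (m, x)) (deg \<Lambda> \<alpha> + p, deg \<Lambda> \<alpha> + q) = x (p, q)"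
proof (rule path_cons_eqI)
  have p: "fin_le p m" using assms by (rule enat_bound_mono)
  have 0: "0 \<le> p" "0 \<le> q" by (auto simp: le_fun_def)
  note f = path_facts[OF 0(1) p] path_facts[OF assms] path_cmp[OF 0(1) assms]
  show "fin_le (deg \<Lambda> \<alpha> + q) (\<lambda>i. enat (deg \<Lambda> \<alpha> i) + m i)"
    using assms(2) by (rule fin_le_add)
  show "src \<Lambda> (start (deg \<Lambda> \<alpha> + p)) = rng \<Lambda> (x (p, q))"
    using f \<alpha> src_\<alpha> by (simp add: start_shift[OF p] src_cmp)
  show "start (deg \<Lambda> \<alpha> + q) = cmp \<Lambda> (start (deg \<Lambda> \<alpha> + p)) (x (p, q))"
    using f \<alpha> src_\<alpha> by (simp add: start_shift[OF p] start_shift[OF assms(2)] cmp_assoc)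
qed (use assms path_facts[OF assms] in \<open>auto simp: le_fun_def\<close>)

end

lemma path_cons_unique:
  assumes \<alpha>: "\<alpha> \<in> mor \<Lambda>" and X: "(m, x) \<in> graph_paths \<Lambda>" and s: "src \<Lambda> \<alpha> = x (0, 0)"
    and Y: "((\<lambda>i. enat (deg \<Lambda> \<alpha> i) + m i), y) \<in> graph_paths \<Lambda>"
    and y1: "y (0, deg \<Lambda> \<alpha>) = \<alpha>"
    and y2: "\<And>p q. p \<le> q \<Longrightarrow> fin_le q m \<Longrightarrow> y (deg \<Lambda> \<alpha> + p, deg \<Lambda> \<alpha> + q) = x (p, q)"
  shows "((\<lambda>i. enat (deg \<Lambda> \<alpha> i) + m i), y) = path_cons \<Lambda> \<alpha> (m, x)"
proof -
  let ?M = "\<lambda>i. enat (deg \<Lambda> \<alpha> i) + m i" and ?y = "snd (path_cons \<Lambda> \<alpha> (m, x))"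
  let ?d = "deg \<Lambda> \<alpha>"
  have 0: "0 \<le> p" for p :: "'b \<Rightarrow> nat" by (auto simp: le_fun_def)
  note yf = graph_path_facts[OF Y] and yc = graph_path_cmp[OF Y]
  have st: "start \<alpha> x q = y (0, q)" if q: "fin_le q ?M" for q
  proof -
    let ?n = "q - ?d"
    have n: "fin_le ?n m" by (rule fin_le_diff[OF q])
    have dn: "fin_le (?d + ?n) ?M"
      using n by (rule fin_le_add)
    have le: "?d \<le> ?d + ?n" "q \<le> ?d + ?n" by (auto simp: le_fun_def)
    have "cmp \<Lambda> \<alpha> (x (0, ?n)) = y (0, ?d + ?n)"
      using yc[OF 0 le(1) dn] y1 y2[OF 0 n] by simp
    also have "\<dots> = cmp \<Lambda> (y (0, q)) (y (q, ?d + ?n))"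
      using yc[OF 0 le(2) dn] by simp
    finally show ?thesis
      using initial_cmp_deg[of "y (0, q)" "y (q, ?d + ?n)"] yf[OF 0 q] yf[OF le(2) dn]
      by (simp add: start_def[OF \<alpha> X s])
  qed
  have "y a = ?y a" for a
  proof (cases "a \<in> mor (Omega ?M)")
    case True
    obtain p q where pq: "a = (p, q)" by (cases a)
    have le: "p \<le> q" and q: "fin_le q ?M" using True by (auto simp: Omega_def pq)
    have p: "fin_le p ?M" using le q by (rule enat_bound_mono)
    have "?y (p, q) = y (p, q)"
      using yf[OF 0 p] yf[OF le q] yc[OF 0 le q]
      by (intro path_cons_eqI[OF \<alpha> X s q le]) (auto simp: st[OF p] st[OF q])
    thus ?thesis by (simp add: pq)
  next
    case False
    thus ?thesis using Y path_cons_graph_paths[OF \<alpha> X s] fst_path_cons[OF \<alpha> X s]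
      by (cases a) (auto simp: graph_paths_def extensional_def split: prod.splits)
  qed
  thus ?thesis using fst_path_cons[OF \<alpha> X s] by (metis ext prod.collapse)
qed

end


section \<open>The universal property\<close>

lemma free_scale_eq: "free_scale r p = Poly_Mapping.single 0 r * p"
  by (simp add: free_scale_def mult_map_scale_conv_mult)

lemma lookup_free_scale: "Poly_Mapping.lookup (free_scale r p) w = r * Poly_Mapping.lookup p w"
  by (simp add: free_scale_def map.rep_eq when_def)

lemma free_scale_mult_left: "free_scale r p * q = free_scale r (p * q)"
  by (simp add: free_scale_eq mult.assoc)

lemma free_scale_add: "free_scale r (p + q) = free_scale r p + free_scale r q"
  and free_scale_diff: "free_scale r (p - q) = free_scale r p - free_scale r q"
  by (simp_all add: free_scale_eq algebra_simps)

lemma free_scale_minus: "free_scale (- 1) p = - p"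
  by (rule poly_mapping_eqI) (simp add: lookup_free_scale minus_mult_left[symmetric])

lemma sum_monomials: "(\<Sum>w \<in> Poly_Mapping.keys p. Poly_Mapping.single w (Poly_Mapping.lookup p w)) = p"
  by (rule poly_mapping_eqI)
    (auto simp: lookup_sum lookup_single when_def in_keys_iff)

lemma free_algebra_zero: "0 \<in> free_algebra \<Lambda>"
  by (simp add: free_algebra_def)

lemma free_algebra_add: "p \<in> free_algebra \<Lambda> \<Longrightarrow> q \<in> free_algebra \<Lambda> \<Longrightarrow> p + q \<in> free_algebra \<Lambda>"
  using keys_add[of p q] by (auto simp: free_algebra_def)

lemma free_algebra_scale: "p \<in> free_algebra \<Lambda> \<Longrightarrow> free_scale r p \<in> free_algebra \<Lambda>"
  by (auto simp: free_algebra_def in_keys_iff lookup_free_scale)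

lemma free_algebra_diff: "p \<in> free_algebra \<Lambda> \<Longrightarrow> q \<in> free_algebra \<Lambda> \<Longrightarrow> p - q \<in> free_algebra \<Lambda>"
  using free_algebra_add[of p \<Lambda> "free_scale (- 1) q"] free_algebra_scale[of q \<Lambda> "- 1"]
  by (simp add: free_scale_minus)

lemma free_algebra_mult:
  assumes "p \<in> free_algebra \<Lambda>" "q \<in> free_algebra \<Lambda>" shows "p * q \<in> free_algebra \<Lambda>"
  unfolding free_algebra_def
proof (intro CollectI ballI)
  fix w assume "w \<in> Poly_Mapping.keys (p * q)"
  then obtain a b where "w = a + b" "a \<in> Poly_Mapping.keys p" "b \<in> Poly_Mapping.keys q"
    using keys_mult[of p q] by blast
  thus "letters w \<noteq> [] \<and> set (letters w) \<subseteq> symbols \<Lambda>"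
    using assms by (auto simp: free_algebra_def plus_word_def)
qed

lemma free_algebra_sum: "(\<And>i. i \<in> I \<Longrightarrow> f i \<in> free_algebra \<Lambda>) \<Longrightarrow> sum f I \<in> free_algebra \<Lambda>"
  by (induction I rule: infinite_finite_induct) (auto intro: free_algebra_zero free_algebra_add)

lemma free_algebra_single:
  "letters w \<noteq> [] \<Longrightarrow> set (letters w) \<subseteq> symbols \<Lambda> \<Longrightarrow> Poly_Mapping.single w r \<in> free_algebra \<Lambda>"
  by (simp add: free_algebra_def)

lemma free_algebra_gen: "g \<in> symbols \<Lambda> \<Longrightarrow> gen g \<in> free_algebra \<Lambda>"
  by (simp add: gen_def free_algebra_single)

lemma free_algebra_list_product:
  "set as \<subseteq> free_algebra \<Lambda> \<Longrightarrow> list_product as \<in> free_algebra \<Lambda>"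
  by (induction as rule: list_product.induct) (auto intro: free_algebra_zero free_algebra_mult)

lemma Path_symbols: "\<alpha> \<in> mor \<Lambda> \<Longrightarrow> Path \<alpha> \<in> symbols \<Lambda>"
  and star_symbols: "\<alpha> \<in> mor \<Lambda> \<Longrightarrow> star \<Lambda> \<alpha> \<in> symbols \<Lambda>"
  and verts_mor: "v \<in> verts \<Lambda> \<Longrightarrow> v \<in> mor \<Lambda>"
  by (auto simp: symbols_def star_def verts_def)

lemma Lmin_mor: "(\<rho>, \<tau>) \<in> Lmin \<Lambda> \<alpha> \<mu> \<Longrightarrow> \<rho> \<in> mor \<Lambda> \<and> \<tau> \<in> mor \<Lambda>"
  by (simp add: Lmin_def)

lemma FE_mor: "E \<in> FE \<Lambda> v \<Longrightarrow> E \<subseteq> mor \<Lambda>"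
  by (auto simp: FE_def exhaustive_def)

lemma (in kgraph) kp_family_mod_free_algebra:
  "kp_family_mod \<Lambda> (free_algebra \<Lambda>) (gen :: 'e symbol \<Rightarrow> ('e, 'r::{comm_ring,comm_monoid_mult}) pre_kp)"
  unfolding kp_family_mod_def
proof (intro conjI ballI allI impI)
  note i = free_algebra_diff free_algebra_mult free_algebra_gen Path_symbols star_symbols cmp_mor
  show "gen (Path v) * gen (Path v) - gen (Path v) \<in> free_algebra \<Lambda>"
    "gen (Path v) * gen (Path w) \<in> free_algebra \<Lambda>" if "v \<in> verts \<Lambda>" "w \<in> verts \<Lambda>" for v w
    using that by (intro i verts_mor; simp)+
  show "gen (Path \<alpha>) * gen (Path \<mu>) - gen (Path (cmp \<Lambda> \<alpha> \<mu>)) \<in> free_algebra \<Lambda>"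
    "gen (star \<Lambda> \<mu>) * gen (star \<Lambda> \<alpha>) - gen (star \<Lambda> (cmp \<Lambda> \<alpha> \<mu>)) \<in> free_algebra \<Lambda>"
    if "\<alpha> \<in> mor \<Lambda>" "\<mu> \<in> mor \<Lambda>" "src \<Lambda> \<alpha> = rng \<Lambda> \<mu>" for \<alpha> \<mu>
    using that by (intro i; simp)+
  show "gen (star \<Lambda> \<alpha>) * gen (Path \<mu>) - (\<Sum>(\<rho>, \<tau>) \<in> Lmin \<Lambda> \<alpha> \<mu>. gen (Path \<rho>) * gen (star \<Lambda> \<tau>))
      \<in> free_algebra \<Lambda>" if "\<alpha> \<in> mor \<Lambda>" "\<mu> \<in> mor \<Lambda>" for \<alpha> \<mu>
    using that by (auto intro!: i free_algebra_sum dest: Lmin_mor)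
  show "list_product (map (\<lambda>\<alpha>. gen (Path v) - gen (Path \<alpha>) * gen (star \<Lambda> \<alpha>)) es) \<in> free_algebra \<Lambda>"
    if "v \<in> verts \<Lambda>" "E \<in> FE \<Lambda> v" "distinct es \<and> set es = E" for v E es
    using that FE_mor[OF that(2)] verts_mor[OF that(1)]
    by (auto intro!: i free_algebra_list_product)
qed

lemma free_ideal_free_algebra: "free_ideal \<Lambda> (free_algebra \<Lambda>)"
  by (auto simp: free_ideal_def
      intro: free_algebra_zero free_algebra_add free_algebra_scale free_algebra_mult)

lemma (in kgraph) free_ideal_kp_ideal:
  "free_ideal \<Lambda> (kp_ideal \<Lambda> :: ('e, 'r::{comm_ring,comm_monoid_mult}) pre_kp set)"
proof -
  have "kp_ideal \<Lambda> \<subseteq> (free_algebra \<Lambda> :: ('e, 'r) pre_kp set)"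
    unfolding kp_ideal_def using free_ideal_free_algebra kp_family_mod_free_algebra by blast
  thus ?thesis by (auto simp: free_ideal_def kp_ideal_def)
qed

lemma kp_family_mod_kp_ideal:
  "kp_family_mod \<Lambda> (kp_ideal \<Lambda>) (gen :: 'e symbol \<Rightarrow> ('e, 'r::{comm_ring,comm_monoid_mult}) pre_kp)"
  unfolding kp_ideal_def kp_family_mod_def by (intro conjI ballI allI impI InterI) auto

lemma kp_family_mod_Int:
  "kp_family_mod \<Lambda> J S \<Longrightarrow> kp_family_mod \<Lambda> K S \<Longrightarrow> kp_family_mod \<Lambda> (J \<inter> K) S"
  unfolding kp_family_mod_def by (intro conjI ballI allI impI IntI) auto

lemma free_ideal_diff:
  assumes "free_ideal \<Lambda> J" "a \<in> J" "b \<in> J" shows "a - b \<in> J"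
proof -
  have "a + free_scale (- 1) b \<in> J" using assms by (simp add: free_ideal_def)
  thus ?thesis by (simp add: free_scale_minus)
qed

context kgraph
begin

lemma kp_class_eq_iff:
  fixes p q :: "('e, 'r::{comm_ring,comm_monoid_mult}) pre_kp"
  assumes "p \<in> free_algebra \<Lambda>" "q \<in> free_algebra \<Lambda>"
  shows "kp_class \<Lambda> p = kp_class \<Lambda> q \<longleftrightarrow> p - q \<in> kp_ideal \<Lambda>"
proof
  assume e: "kp_class \<Lambda> p = kp_class \<Lambda> q"
  have "p \<in> kp_class \<Lambda> p" using assms free_ideal_kp_ideal by (auto simp: kp_class_def free_ideal_def)
  with e show "p - q \<in> kp_ideal \<Lambda>" by (auto simp: kp_class_def)
next
  assume d: "p - q \<in> kp_ideal \<Lambda>"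
  have "x - p \<in> kp_ideal \<Lambda> \<longleftrightarrow> x - q \<in> kp_ideal \<Lambda>" for x
  proof
    show "x - q \<in> kp_ideal \<Lambda>" if "x - p \<in> kp_ideal \<Lambda>"
    proof -
      have "(x - p) + (p - q) \<in> kp_ideal \<Lambda>"
        using that d free_ideal_kp_ideal unfolding free_ideal_def by blast
      thus ?thesis by simp
    qed
    show "x - p \<in> kp_ideal \<Lambda>" if "x - q \<in> kp_ideal \<Lambda>"
      using free_ideal_diff[OF free_ideal_kp_ideal that d] by simp
  qed
  thus "kp_class \<Lambda> p = kp_class \<Lambda> q" by (simp add: kp_class_def)
qed

lemma kp_classD:
  "p' \<in> kp_class \<Lambda> p \<Longrightarrow> p' \<in> free_algebra \<Lambda>" "p' \<in> kp_class \<Lambda> p \<Longrightarrow> p' - p \<in> kp_ideal \<Lambda>"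
  by (auto simp: kp_class_def)

lemma kp_class_self: "p \<in> free_algebra \<Lambda> \<Longrightarrow> p \<in> kp_class \<Lambda> p"
  using free_ideal_kp_ideal by (auto simp: kp_class_def free_ideal_def)

lemma kp_add_class:
  fixes p q :: "('e, 'r::{comm_ring,comm_monoid_mult}) pre_kp"
  assumes "p \<in> free_algebra \<Lambda>" "q \<in> free_algebra \<Lambda>"
  shows "kp_add \<Lambda> (kp_class \<Lambda> p) (kp_class \<Lambda> q) = kp_class \<Lambda> (p + q)"
proof -
  have "kp_class \<Lambda> (p' + q') = kp_class \<Lambda> (p + q)"
    if "p' \<in> kp_class \<Lambda> p" "q' \<in> kp_class \<Lambda> q" for p' q'
  proof -
    have "(p' - p) + (q' - q) \<in> kp_ideal \<Lambda>"
      using kp_classD(2)[OF that(1)] kp_classD(2)[OF that(2)] free_ideal_kp_ideal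
      unfolding free_ideal_def by blast
    moreover have "(p' - p) + (q' - q) = (p' + q') - (p + q)" by simp
    ultimately show ?thesis
      using kp_class_eq_iff[OF free_algebra_add[OF that[THEN kp_classD(1)]] free_algebra_add[OF assms]]
      by metis
  qed
  thus ?thesis unfolding kp_add_def using kp_class_self[OF assms(1)] kp_class_self[OF assms(2)] by blast
qed

lemma kp_mult_class:
  fixes p q :: "('e, 'r::{comm_ring,comm_monoid_mult}) pre_kp"
  assumes "p \<in> free_algebra \<Lambda>" "q \<in> free_algebra \<Lambda>"
  shows "kp_mult \<Lambda> (kp_class \<Lambda> p) (kp_class \<Lambda> q) = kp_class \<Lambda> (p * q)"
proof -
  have "kp_class \<Lambda> (p' * q') = kp_class \<Lambda> (p * q)"
    if "p' \<in> kp_class \<Lambda> p" "q' \<in> kp_class \<Lambda> q" for p' q'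
  proof -
    have "(p' - p) * q' + p * (q' - q) \<in> kp_ideal \<Lambda>"
      using kp_classD(2)[OF that(1)] kp_classD(2)[OF that(2)] kp_classD(1)[OF that(2)] assms(1)
        free_ideal_kp_ideal
      unfolding free_ideal_def by blast
    moreover have "(p' - p) * q' + p * (q' - q) = p' * q' - p * q" by (simp add: algebra_simps)
    ultimately show ?thesis
      using kp_class_eq_iff[OF free_algebra_mult[OF that[THEN kp_classD(1)]] free_algebra_mult[OF assms]]
      by metis
  qed
  thus ?thesis unfolding kp_mult_def using kp_class_self[OF assms(1)] kp_class_self[OF assms(2)] by blast
qed

lemma kp_scale_class:
  fixes p :: "('e, 'r::{comm_ring,comm_monoid_mult}) pre_kp"
  assumes "p \<in> free_algebra \<Lambda>"
  shows "kp_scale \<Lambda> r (kp_class \<Lambda> p) = kp_class \<Lambda> (free_scale r p)"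
proof -
  have "kp_class \<Lambda> (free_scale r p') = kp_class \<Lambda> (free_scale r p)" if "p' \<in> kp_class \<Lambda> p" for p'
  proof -
    have "free_scale r (p' - p) \<in> kp_ideal \<Lambda>"
      using kp_classD(2)[OF that] free_ideal_kp_ideal unfolding free_ideal_def by blast
    thus ?thesis
      using kp_class_eq_iff[OF free_algebra_scale[OF kp_classD(1)[OF that]] free_algebra_scale[OF assms]]
      by (simp add: free_scale_diff)
  qed
  thus ?thesis unfolding kp_scale_def using kp_class_self[OF assms] by blast
qed

end

lemma list_product_append:
  "as \<noteq> [] \<Longrightarrow> bs \<noteq> [] \<Longrightarrow> list_product (as @ bs) = list_product as * list_product bs"
proof (induction as rule: list_product.induct)
  case (2 a) thus ?case by (cases bs) auto
qed (auto simp: mult.assoc)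

context r_algebra
begin

lemma scale_zero_right: "scale r 0 = 0"
  using scale_add_right[of r 0 0] by simp

lemma scale_zero_left: "scale 0 a = 0"
  using scale_add_left[of 0 0 a] by simp

lemma scale_sum: "scale r (sum f I) = (\<Sum>i\<in>I. scale r (f i))"
  by (induction I rule: infinite_finite_induct) (auto simp: scale_zero_right scale_add_right)

definition lift :: "('e symbol \<Rightarrow> 'a) \<Rightarrow> ('e, 'r) pre_kp \<Rightarrow> 'a" where
  "lift S p = (\<Sum>w \<in> Poly_Mapping.keys p. scale (Poly_Mapping.lookup p w) (list_product (map S (letters w))))"

lemma lift_superset:
  assumes "finite W" "Poly_Mapping.keys p \<subseteq> W"
  shows "lift S p = (\<Sum>w \<in> W. scale (Poly_Mapping.lookup p w) (list_product (map S (letters w))))"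
  unfolding lift_def using assms
  by (intro sum.mono_neutral_left) (auto simp: in_keys_iff scale_zero_left)

lemma lift_zero: "lift S 0 = 0" by (simp add: lift_def)

lemma lift_add: "lift S (p + q) = lift S p + lift S q"
proof -
  let ?W = "Poly_Mapping.keys p \<union> Poly_Mapping.keys q"
  have "finite ?W" "Poly_Mapping.keys (p + q) \<subseteq> ?W" by (simp_all add: keys_add)
  thus ?thesis
    by (simp add: lift_superset[of ?W] lookup_add scale_add_left sum.distrib)
qed

lemma lift_sum: "lift S (sum f I) = (\<Sum>i\<in>I. lift S (f i))"
  by (induction I rule: infinite_finite_induct) (auto simp: lift_zero lift_add)

lemma lift_scale: "lift S (free_scale r p) = scale r (lift S p)"
proof -
  have "Poly_Mapping.keys (free_scale r p) \<subseteq> Poly_Mapping.keys p"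
    by (auto simp: in_keys_iff lookup_free_scale)
  thus ?thesis
    by (simp add: lift_superset[of "Poly_Mapping.keys p"] lookup_free_scale scale_sum scale_scale)
qed

lemma lift_diff: "lift S (p - q) = lift S p - lift S q"
  using lift_add[of S "p - q" q] by simp

lemma lift_single: "lift S (Poly_Mapping.single w r) = scale r (list_product (map S (letters w)))"
  using lift_superset[of "{w}" "Poly_Mapping.single w r" S] by simp

lemma lift_gen: "lift S (gen g) = S g"
  by (simp add: gen_def lift_single scale_one)

lemma lift_mult:
  assumes p: "p \<in> free_algebra \<Lambda>" and q: "q \<in> free_algebra \<Lambda>"
  shows "lift S (p * q) = lift S p * lift S q"
proof -
  let ?m = "\<lambda>w. list_product (map S (letters w))"
  have "p * q = (\<Sum>u \<in> Poly_Mapping.keys p. Poly_Mapping.single u (Poly_Mapping.lookup p u)) *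
      (\<Sum>v \<in> Poly_Mapping.keys q. Poly_Mapping.single v (Poly_Mapping.lookup q v))"
    by (simp add: sum_monomials)
  also have "\<dots> = (\<Sum>u \<in> Poly_Mapping.keys p. \<Sum>v \<in> Poly_Mapping.keys q.
      Poly_Mapping.single (u + v) (Poly_Mapping.lookup p u * Poly_Mapping.lookup q v))"
    by (simp add: sum_product mult_single)
  finally have "lift S (p * q) = (\<Sum>u \<in> Poly_Mapping.keys p. \<Sum>v \<in> Poly_Mapping.keys q.
      scale (Poly_Mapping.lookup p u * Poly_Mapping.lookup q v) (?m (u + v)))"
    by (simp add: lift_sum lift_single)
  also have "\<dots> = (\<Sum>u \<in> Poly_Mapping.keys p. \<Sum>v \<in> Poly_Mapping.keys q.
      scale (Poly_Mapping.lookup p u) (?m u) * scale (Poly_Mapping.lookup q v) (?m v))"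
  proof (intro sum.cong refl)
    fix u v assume "u \<in> Poly_Mapping.keys p" "v \<in> Poly_Mapping.keys q"
    hence "letters u \<noteq> []" "letters v \<noteq> []" using p q by (auto simp: free_algebra_def)
    hence "?m (u + v) = ?m u * ?m v" by (simp add: plus_word_def list_product_append)
    thus "scale (Poly_Mapping.lookup p u * Poly_Mapping.lookup q v) (?m (u + v)) =
        scale (Poly_Mapping.lookup p u) (?m u) * scale (Poly_Mapping.lookup q v) (?m v)"
      by (simp add: scale_mult_left scale_mult_right scale_scale mult.commute)
  qed
  also have "\<dots> = lift S p * lift S q" by (simp add: lift_def sum_product)
  finally show ?thesis .
qed

lemma lift_list_product:
  "set ps \<subseteq> free_algebra \<Lambda> \<Longrightarrow> lift S (list_product ps) = list_product (map (lift S) ps)"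
  by (induction ps rule: list_product.induct)
    (simp_all add: lift_zero lift_mult[where \<Lambda>=\<Lambda>] free_algebra_list_product)

lemma lift_kp_ideal:
  assumes "kgraph \<Lambda>" "kp_family \<Lambda> S" "p \<in> kp_ideal \<Lambda>"
  shows "lift S p = 0"
proof -
  interpret kgraph \<Lambda> by fact
  let ?J = "free_algebra \<Lambda> \<inter> {p. lift S p = 0}"
  have J: "free_ideal \<Lambda> ?J"
    by (auto simp: free_ideal_def lift_zero lift_add lift_scale lift_mult[where \<Lambda>=\<Lambda>]
        scale_zero_right free_algebra_zero
        intro: free_algebra_add free_algebra_scale free_algebra_mult)
  have lm: "lift S (gen g * gen h) = S g * S h" if "g \<in> symbols \<Lambda>" "h \<in> symbols \<Lambda>" for g h
    using that by (simp add: lift_mult[where \<Lambda>=\<Lambda>] free_algebra_gen lift_gen)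
  note S = assms(2)[unfolded kp_family_mod_def]
  have "kp_family_mod \<Lambda> {p. lift S p = 0} gen"
    unfolding kp_family_mod_def
  proof (intro conjI ballI allI impI CollectI)
    show "lift S (gen (Path v) * gen (Path v) - gen (Path v)) = 0" if "v \<in> verts \<Lambda>" for v
      using that S by (simp add: lift_diff lm lift_gen verts_mor Path_symbols)
    show "lift S (gen (Path v) * gen (Path w)) = 0"
      if "v \<in> verts \<Lambda>" "w \<in> verts \<Lambda>" "v \<noteq> w" for v w
      using that S by (simp add: lm verts_mor Path_symbols)
    show "lift S (gen (Path \<alpha>) * gen (Path \<mu>) - gen (Path (cmp \<Lambda> \<alpha> \<mu>))) = 0"
      "lift S (gen (star \<Lambda> \<mu>) * gen (star \<Lambda> \<alpha>) - gen (star \<Lambda> (cmp \<Lambda> \<alpha> \<mu>))) = 0"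
      if "\<alpha> \<in> mor \<Lambda>" "\<mu> \<in> mor \<Lambda>" "src \<Lambda> \<alpha> = rng \<Lambda> \<mu>" for \<alpha> \<mu>
      using that S by (simp_all add: lift_diff lm lift_gen Path_symbols star_symbols)
    show "lift S (gen (star \<Lambda> \<alpha>) * gen (Path \<mu>) -
        (\<Sum>(\<rho>, \<tau>) \<in> Lmin \<Lambda> \<alpha> \<mu>. gen (Path \<rho>) * gen (star \<Lambda> \<tau>))) = 0"
      if "\<alpha> \<in> mor \<Lambda>" "\<mu> \<in> mor \<Lambda>" for \<alpha> \<mu>
    proof -
      have "(\<Sum>x \<in> Lmin \<Lambda> \<alpha> \<mu>. lift S (case x of (\<rho>, \<tau>) \<Rightarrow> gen (Path \<rho>) * gen (star \<Lambda> \<tau>))) =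
        (\<Sum>(\<rho>, \<tau>) \<in> Lmin \<Lambda> \<alpha> \<mu>. S (Path \<rho>) * S (star \<Lambda> \<tau>))"
        by (intro sum.cong refl) (auto simp: lm Path_symbols star_symbols dest!: Lmin_mor)
      thus ?thesis using that S
        by (simp add: lift_diff lift_sum lm Path_symbols star_symbols)
    qed
    show "lift S (list_product (map (\<lambda>\<alpha>. gen (Path v) - gen (Path \<alpha>) * gen (star \<Lambda> \<alpha>)) es)) = 0"
      if "v \<in> verts \<Lambda>" "E \<in> FE \<Lambda> v" "distinct es \<and> set es = E" for v E es
    proof -
      have E: "\<alpha> \<in> mor \<Lambda>" if "\<alpha> \<in> set es" for \<alpha>
        using that FE_mor[OF \<open>E \<in> FE \<Lambda> v\<close>] \<open>distinct es \<and> set es = E\<close> by auto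
      have "set (map (\<lambda>\<alpha>. gen (Path v) - gen (Path \<alpha>) * gen (star \<Lambda> \<alpha>) :: ('b, 'r) pre_kp) es)
          \<subseteq> free_algebra \<Lambda>"
        using E verts_mor[OF \<open>v \<in> verts \<Lambda>\<close>]
        by (auto intro!: free_algebra_diff free_algebra_mult free_algebra_gen
            Path_symbols star_symbols)
      from lift_list_product[OF this]
      have "lift S (list_product (map (\<lambda>\<alpha>. gen (Path v) - gen (Path \<alpha>) * gen (star \<Lambda> \<alpha>)) es)) =
          list_product (map (\<lambda>\<alpha>. lift S (gen (Path v) - gen (Path \<alpha>) * gen (star \<Lambda> \<alpha>))) es)"
        by (simp add: comp_def)
      also have "map (\<lambda>\<alpha>. lift S (gen (Path v) - gen (Path \<alpha>) * gen (star \<Lambda> \<alpha>))) es =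
          map (\<lambda>\<alpha>. S (Path v) - S (Path \<alpha>) * S (star \<Lambda> \<alpha>)) es"
        using E by (simp add: lift_diff lm lift_gen Path_symbols star_symbols)
      finally show ?thesis using S that by auto
    qed
  qed
  from kp_family_mod_Int[OF kp_family_mod_free_algebra this] J assms(3) show ?thesis by (auto simp: kp_ideal_def)
qed

end

theorem kp_universal:
  fixes scale :: "'r::{comm_ring,comm_monoid_mult} \<Rightarrow> 'a::ring \<Rightarrow> 'a"
  assumes "kgraph \<Lambda>" "r_algebra scale" "kp_family \<Lambda> S"
  shows "\<exists>\<pi>. kp_hom \<Lambda> scale \<pi> \<and> (\<forall>g \<in> symbols \<Lambda>. \<pi> (kp_gen \<Lambda> g) = S g)"
proof -
  interpret kgraph \<Lambda> by fact
  interpret r_algebra scale by fact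
  define \<pi> :: "('b, 'r) pre_kp set \<Rightarrow> 'a" where "\<pi> X = lift S (SOME p. p \<in> X)" for X
  have \<pi>: "\<pi> (kp_class \<Lambda> p) = lift S p" if p: "p \<in> free_algebra \<Lambda>" for p
  proof -
    have "(SOME q. q \<in> kp_class \<Lambda> p) \<in> kp_class \<Lambda> p" using kp_class_self[OF p] by (rule someI)
    from lift_kp_ideal[OF assms(1,3) kp_classD(2)[OF this]] show ?thesis
      by (simp add: \<pi>_def lift_diff)
  qed
  have "kp_hom \<Lambda> scale \<pi>"
    by (auto simp: kp_hom_def KP_def kp_add_class kp_mult_class kp_scale_class \<pi> free_algebra_add
        free_algebra_mult free_algebra_scale lift_add lift_mult[where \<Lambda>=\<Lambda>] lift_scale)
  moreover have "\<forall>g \<in> symbols \<Lambda>. \<pi> (kp_gen \<Lambda> g) = S g"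
    by (simp add: kp_gen_def \<pi> free_algebra_gen lift_gen)
  ultimately show ?thesis by blast
qed

theorem kp_universal_unique:
  fixes scale :: "'r::{comm_ring,comm_monoid_mult} \<Rightarrow> 'a::ring \<Rightarrow> 'a"
  assumes "kgraph \<Lambda>" "r_algebra scale" "kp_hom \<Lambda> scale \<pi>" "kp_hom \<Lambda> scale \<pi>'"
    and gens: "\<And>g. g \<in> symbols \<Lambda> \<Longrightarrow> \<pi> (kp_gen \<Lambda> g) = \<pi>' (kp_gen \<Lambda> g)"
    and X: "X \<in> KP \<Lambda>"
  shows "\<pi> X = \<pi>' X"
proof -
  interpret kgraph \<Lambda> by fact
  interpret r_algebra scale by fact
  note hom = assms(3,4)[unfolded kp_hom_def KP_def]
  have add: "h (kp_class \<Lambda> (p + q)) = h (kp_class \<Lambda> p) + h (kp_class \<Lambda> q)"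
    and mult: "h (kp_class \<Lambda> (p * q)) = h (kp_class \<Lambda> p) * h (kp_class \<Lambda> q)"
    if "h \<in> {\<pi>, \<pi>'}" "p \<in> free_algebra \<Lambda>" "q \<in> free_algebra \<Lambda>" for h p q
    using that hom by (auto simp flip: kp_add_class kp_mult_class)
  have scl: "h (kp_class \<Lambda> (free_scale r p)) = scale r (h (kp_class \<Lambda> p))"
    if "h \<in> {\<pi>, \<pi>'}" "p \<in> free_algebra \<Lambda>" for h p r
    using that hom by (auto simp flip: kp_scale_class)
  have word: "\<pi> (kp_class \<Lambda> (Poly_Mapping.single (Word gs) 1)) = \<pi>' (kp_class \<Lambda> (Poly_Mapping.single (Word gs) 1))"
    if "gs \<noteq> []" "set gs \<subseteq> symbols \<Lambda>" for gs
    using that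
  proof (induction gs rule: list_nonempty_induct)
    case (single g)
    thus ?case using gens[of g] by (simp add: kp_gen_def gen_def)
  next
    case (cons g gs)
    have "Poly_Mapping.single (Word (g # gs)) (1::'r) = gen g * Poly_Mapping.single (Word gs) 1"
      by (simp add: gen_def mult_single plus_word_def)
    moreover have "(gen g :: ('b, 'r) pre_kp) \<in> free_algebra \<Lambda>" "Poly_Mapping.single (Word gs) (1::'r) \<in> free_algebra \<Lambda>"
      using cons by (simp_all add: free_algebra_gen free_algebra_single)
    ultimately show ?case using cons gens[of g] by (simp add: mult[of \<pi>] mult[of \<pi>'] kp_gen_def)
  qed
  have zero: "h (kp_class \<Lambda> 0) = 0" if "h \<in> {\<pi>, \<pi>'}" for h
    using add[OF that free_algebra_zero free_algebra_zero] by simp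
  have mono: "\<pi> (kp_class \<Lambda> (Poly_Mapping.single w r)) = \<pi>' (kp_class \<Lambda> (Poly_Mapping.single w r))"
    if "letters w \<noteq> []" "set (letters w) \<subseteq> symbols \<Lambda>" for w and r :: 'r
  proof -
    have "Poly_Mapping.single w r = free_scale r (Poly_Mapping.single w 1)"
      by (simp add: free_scale_eq mult_single)
    thus ?thesis using word[OF that] that by (simp add: scl[of \<pi>] scl[of \<pi>'] free_algebra_single)
  qed
  obtain p where p: "p \<in> free_algebra \<Lambda>" "X = kp_class \<Lambda> p" using X by (auto simp: KP_def)
  let ?s = "\<lambda>W. \<Sum>w \<in> W. Poly_Mapping.single w (Poly_Mapping.lookup p w)"
  have "\<pi> (kp_class \<Lambda> (?s W)) = \<pi>' (kp_class \<Lambda> (?s W))" if "finite W" "W \<subseteq> Poly_Mapping.keys p" for W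
    using that
  proof (induction W rule: finite_induct)
    case empty thus ?case by (simp add: zero[of \<pi>] zero[of \<pi>'])
  next
    case (insert w W)
    have m: "Poly_Mapping.single u (Poly_Mapping.lookup p u) \<in> free_algebra \<Lambda>" if "u \<in> insert w W" for u
      using that insert p by (auto simp: free_algebra_def)
    have "?s W \<in> free_algebra \<Lambda>" using m by (intro free_algebra_sum) simp
    moreover have "letters w \<noteq> []" "set (letters w) \<subseteq> symbols \<Lambda>"
      using insert p by (auto simp: free_algebra_def)
    ultimately show ?case using insert m[of w] by (simp add: add[of \<pi>] add[of \<pi>'] mono)
  qed
  from this[of "Poly_Mapping.keys p"] show ?thesis using p by (simp add: sum_monomials)
qed

end

theory Submission
  imports Defs
begin

text \<open>
  Every nonzero element \<open>p\<close> of the algebra can be compressed to a nonzero multiple of a vertex: there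
  are \<open>a\<close>, \<open>b\<close> with \<open>a p b = r s\<^sub>v\<close> and \<open>r \<noteq> 0\<close>, so \<open>\<pi> p = 0\<close> would force \<open>\<pi> (r s\<^sub>v) = 0\<close>.

  First multiply on the right by paths until no ghosts remain. Write
  \<open>p = p s\<^sub>v = \<Sum> r\<^sub>\<alpha>\<^sub>\<mu> s\<^sub>\<alpha> s\<^sub>\<mu>\<^sup>*\<close>, and let \<open>E\<close> be the set of all \<open>\<mu> \<noteq> v\<close> that occur. If \<open>p s\<^sub>\<mu> \<noteq> 0\<close> for some
  \<open>\<mu> \<in> E\<close>, pass to \<open>p s\<^sub>\<mu>\<close>, whose ghosts have smaller degree. Otherwise
  \<open>p = p \<Prod>\<^sub>\<mu>\<^sub>\<in>\<^sub>E (s\<^sub>v - s\<^sub>\<mu> s\<^sub>\<mu>\<^sup>*)\<close>. As \<open>p \<noteq> 0\<close>, some \<open>r\<^sub>\<alpha>\<^sub>v\<close> is nonzero and, by (KP4), \<open>E\<close> is not exhaustive;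
  a path \<open>\<nu>\<close> that has no common extension with any \<open>\<mu> \<in> E\<close> gives
  \<open>p s\<^sub>\<nu> = \<Sum> r\<^sub>\<alpha>\<^sub>v s\<^sub>\<alpha>\<^sub>\<nu>\<close>.

  Aperiodicity then yields a path \<open>\<tau>\<close> such that the paths \<open>\<alpha>\<nu>\<tau>\<close> pairwise have no common extension,
  and multiplying by \<open>s\<^sub>\<tau>\<close> on the right and by one \<open>s\<^sub>\<alpha>\<^sub>\<nu>\<^sub>\<tau>\<^sup>*\<close> on the left isolates a single coefficient.
\<close>

section \<open>Minimal common extensions and aperiodicity\<close>

context kgraph
begin

lemma src_verts: "\<alpha> \<in> mor \<Lambda> \<Longrightarrow> src \<Lambda> \<alpha> \<in> verts \<Lambda>"
  and rng_verts: "\<alpha> \<in> mor \<Lambda> \<Longrightarrow> rng \<Lambda> \<alpha> \<in> verts \<Lambda>"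
  by (simp_all add: verts_def src_mor rng_mor rng_src rng_rng)

lemma verts_src: "v \<in> verts \<Lambda> \<Longrightarrow> src \<Lambda> v = v"
  and verts_rng: "v \<in> verts \<Lambda> \<Longrightarrow> rng \<Lambda> v = v"
  by (auto simp: verts_def) (metis src_rng)

section \<open>Minimal common extensions\<close>

lemma LminD:
  assumes "(\<rho>, \<tau>) \<in> Lmin \<Lambda> \<alpha> \<mu>" "\<alpha> \<in> mor \<Lambda>" "\<mu> \<in> mor \<Lambda>"
  shows "\<rho> \<in> mor \<Lambda>" "\<tau> \<in> mor \<Lambda>" "rng \<Lambda> \<rho> = src \<Lambda> \<alpha>" "rng \<Lambda> \<tau> = src \<Lambda> \<mu>"
    "cmp \<Lambda> \<alpha> \<rho> = cmp \<Lambda> \<mu> \<tau>" "src \<Lambda> \<rho> = src \<Lambda> \<tau>"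
    "deg \<Lambda> \<rho> = sup (deg \<Lambda> \<alpha>) (deg \<Lambda> \<mu>) - deg \<Lambda> \<alpha>"
    "deg \<Lambda> \<tau> = sup (deg \<Lambda> \<alpha>) (deg \<Lambda> \<mu>) - deg \<Lambda> \<mu>"
proof -
  show *: "\<rho> \<in> mor \<Lambda>" "\<tau> \<in> mor \<Lambda>" "rng \<Lambda> \<rho> = src \<Lambda> \<alpha>" "rng \<Lambda> \<tau> = src \<Lambda> \<mu>"
    "cmp \<Lambda> \<alpha> \<rho> = cmp \<Lambda> \<mu> \<tau>"
    using assms(1) by (auto simp: Lmin_def)
  show "src \<Lambda> \<rho> = src \<Lambda> \<tau>" using * assms(2,3) src_cmp by metis
  have 1: "deg \<Lambda> (cmp \<Lambda> \<alpha> \<rho>) = sup (deg \<Lambda> \<alpha>) (deg \<Lambda> \<mu>)"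
    using assms(1) unfolding Lmin_def MCE_def by blast
  have 2: "deg \<Lambda> (cmp \<Lambda> \<mu> \<tau>) = sup (deg \<Lambda> \<alpha>) (deg \<Lambda> \<mu>)"
    using 1 unfolding *(5) .
  have "deg \<Lambda> \<alpha> + deg \<Lambda> \<rho> = sup (deg \<Lambda> \<alpha>) (deg \<Lambda> \<mu>)"
    "deg \<Lambda> \<mu> + deg \<Lambda> \<tau> = sup (deg \<Lambda> \<alpha>) (deg \<Lambda> \<mu>)"
    using 1 2 deg_cmp[of \<alpha> \<rho>] deg_cmp[of \<mu> \<tau>] *(1-4) assms(2,3) by simp_all
  thus "deg \<Lambda> \<rho> = sup (deg \<Lambda> \<alpha>) (deg \<Lambda> \<mu>) - deg \<Lambda> \<alpha>"
    "deg \<Lambda> \<tau> = sup (deg \<Lambda> \<alpha>) (deg \<Lambda> \<mu>) - deg \<Lambda> \<mu>"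
    by (metis add_diff_cancel_left')+
qed

lemma Lmin_swap: "(\<rho>, \<tau>) \<in> Lmin \<Lambda> \<alpha> \<mu> \<longleftrightarrow> (\<tau>, \<rho>) \<in> Lmin \<Lambda> \<mu> \<alpha>"
  by (auto simp: Lmin_def MCE_def sup_commute)

lemma Lmin_empty_commute: "Lmin \<Lambda> \<alpha> \<mu> = {} \<longleftrightarrow> Lmin \<Lambda> \<mu> \<alpha> = {}"
  using Lmin_swap by fastforce

text \<open>Cutting \<open>cmp \<Lambda> \<alpha> \<rho>\<close> at degree
  \<open>sup (deg \<Lambda> \<alpha>) (deg \<Lambda> \<mu>)\<close> yields a minimal common
  extension followed by a tail \<open>\<kappa>\<close>; unique factorisation then cancels
  \<open>\<alpha>\<close>. In particular, an empty \<open>Lmin\<close> excludes common extensions of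
  every degree.\<close>

lemma Lmin_factor:
  assumes \<alpha>: "\<alpha> \<in> mor \<Lambda>" and \<mu>: "\<mu> \<in> mor \<Lambda>"
    and \<rho>: "\<rho> \<in> mor \<Lambda>" "src \<Lambda> \<alpha> = rng \<Lambda> \<rho>" and \<tau>: "\<tau> \<in> mor \<Lambda>" "src \<Lambda> \<mu> = rng \<Lambda> \<tau>"
    and eq: "cmp \<Lambda> \<alpha> \<rho> = cmp \<Lambda> \<mu> \<tau>"
  obtains \<rho>' \<tau>' \<kappa> where "(\<rho>', \<tau>') \<in> Lmin \<Lambda> \<alpha> \<mu>" "\<kappa> \<in> mor \<Lambda>" "src \<Lambda> \<rho>' = rng \<Lambda> \<kappa>"
    "\<rho> = cmp \<Lambda> \<rho>' \<kappa>"
proof -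
  let ?\<sigma> = "cmp \<Lambda> \<alpha> \<rho>" and ?m = "sup (deg \<Lambda> \<alpha>) (deg \<Lambda> \<mu>)"
  have \<sigma>: "?\<sigma> \<in> mor \<Lambda>" using \<alpha> \<rho> by (rule cmp_mor)
  have "deg \<Lambda> ?\<sigma> = deg \<Lambda> \<alpha> + deg \<Lambda> \<rho>" using \<alpha> \<rho> by (rule deg_cmp)
  hence a: "deg \<Lambda> \<alpha> \<le> deg \<Lambda> ?\<sigma>" by (simp add: le_fun_def)
  have "deg \<Lambda> ?\<sigma> = deg \<Lambda> \<mu> + deg \<Lambda> \<tau>" unfolding eq using \<mu> \<tau> by (rule deg_cmp)
  hence b: "deg \<Lambda> \<mu> \<le> deg \<Lambda> ?\<sigma>" by (simp add: le_fun_def)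
  have m: "?m \<le> deg \<Lambda> ?\<sigma>" using a b by simp
  let ?i = "initial \<Lambda> ?\<sigma> ?m" and ?\<kappa> = "final \<Lambda> ?\<sigma> ?m"
  note s = split_at[OF \<sigma> m]
  have i: "initial \<Lambda> ?i n = initial \<Lambda> ?\<sigma> n" if "n \<le> ?m" for n
    using initial_cmp[OF s(1-3), of n] that unfolding s(4,5) by simp
  have i\<alpha>: "initial \<Lambda> ?i (deg \<Lambda> \<alpha>) = \<alpha>"
    using i[of "deg \<Lambda> \<alpha>"] initial_cmp_deg[OF \<alpha> \<rho>] by simp
  have i\<mu>: "initial \<Lambda> ?i (deg \<Lambda> \<mu>) = \<mu>"
    using i[of "deg \<Lambda> \<mu>"] initial_cmp_deg[OF \<mu> \<tau>] eq by simp
  note f = split_at[OF s(1), of "deg \<Lambda> \<alpha>", unfolded s(5) i\<alpha>, simplified]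
  note g = split_at[OF s(1), of "deg \<Lambda> \<mu>", unfolded s(5) i\<mu>, simplified]
  have 1: "(final \<Lambda> ?i (deg \<Lambda> \<alpha>), final \<Lambda> ?i (deg \<Lambda> \<mu>)) \<in> Lmin \<Lambda> \<alpha> \<mu>"
    using f g s i\<alpha> i\<mu> by (simp add: Lmin_def MCE_def)
  have 2: "src \<Lambda> (final \<Lambda> ?i (deg \<Lambda> \<alpha>)) = rng \<Lambda> ?\<kappa>"
    using f s src_cmp by metis
  have "cmp \<Lambda> \<alpha> \<rho> = cmp \<Lambda> \<alpha> (cmp \<Lambda> (final \<Lambda> ?i (deg \<Lambda> \<alpha>)) ?\<kappa>)"
    using cmp_assoc[OF \<alpha> f(2) s(2) f(3) 2] f(4) s(4) by simp
  from factor_unique[OF \<alpha> \<rho> \<alpha> _ _ this refl] have "\<rho> = cmp \<Lambda> (final \<Lambda> ?i (deg \<Lambda> \<alpha>)) ?\<kappa>"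
    using cmp_mor[OF f(2) s(2) 2] rng_cmp[OF f(2) s(2) 2] f(3) by simp
  with that 1 s(2) 2 show ?thesis by blast
qed

lemma Lmin_self:
  assumes "\<alpha> \<in> mor \<Lambda>" shows "Lmin \<Lambda> \<alpha> \<alpha> = {(src \<Lambda> \<alpha>, src \<Lambda> \<alpha>)}"
proof (intro equalityI subsetI)
  fix z assume z: "z \<in> Lmin \<Lambda> \<alpha> \<alpha>"
  obtain \<rho> \<tau> where p: "z = (\<rho>, \<tau>)" by (cases z)
  note d = LminD[OF z[unfolded p] assms assms]
  have "\<rho> \<in> verts \<Lambda>" "\<tau> \<in> verts \<Lambda>"
    using d by (auto simp: verts_iff_deg fun_eq_iff)
  thus "z \<in> {(src \<Lambda> \<alpha>, src \<Lambda> \<alpha>)}" using d verts_rng by (simp add: p)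
next
  fix z assume "z \<in> {(src \<Lambda> \<alpha>, src \<Lambda> \<alpha>)}"
  thus "z \<in> Lmin \<Lambda> \<alpha> \<alpha>"
    using assms by (simp add: Lmin_def MCE_def src_mor rng_src cmp_src_right initial_deg)
qed

text \<open>Unique factorisation applies once the left factors have equal degree, and additivity of
  the degree provides that.\<close>

lemma cmp_right_cancel:
  assumes "\<alpha> \<in> mor \<Lambda>" "\<mu> \<in> mor \<Lambda>" "\<nu> \<in> mor \<Lambda>" "src \<Lambda> \<alpha> = rng \<Lambda> \<nu>" "src \<Lambda> \<mu> = rng \<Lambda> \<nu>"
    "cmp \<Lambda> \<alpha> \<nu> = cmp \<Lambda> \<mu> \<nu>"
  shows "\<alpha> = \<mu>"
proof -
  have "deg \<Lambda> \<alpha> + deg \<Lambda> \<nu> = deg \<Lambda> \<mu> + deg \<Lambda> \<nu>"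
    using assms deg_cmp by metis
  hence "deg \<Lambda> \<alpha> = deg \<Lambda> \<mu>" by (simp add: fun_eq_iff)
  with factor_unique[OF assms(1,3,4,2,3,5,6)] show ?thesis by blast
qed

section \<open>Separation of paths by aperiodic boundary paths\<close>

text \<open>
  If \<open>\<alpha>\<tau>\<close> and \<open>\<mu>\<tau>\<close> always have a common extension, then the paths \<open>\<rho>\<close> with
  \<open>\<alpha>x(0,p)\<rho> \<in> MCE(\<alpha>x(0,p), \<mu>x(0,p))\<close> form a finite exhaustive set, so \<open>x\<close> traverses one of them
  from \<open>p\<close> on. Their degree is positive in direction \<open>i\<close>.
\<close>
lemma boundary_path_infinite_direction:
  assumes fa: "finitely_aligned \<Lambda>" and X: "(m, x) \<in> boundary_paths \<Lambda>"
    and \<alpha>: "\<alpha> \<in> mor \<Lambda>" "src \<Lambda> \<alpha> = x (0, 0)" and \<mu>: "\<mu> \<in> mor \<Lambda>" "src \<Lambda> \<mu> = x (0, 0)"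
    and H: "\<And>\<tau>. \<tau> \<in> mor \<Lambda> \<Longrightarrow> rng \<Lambda> \<tau> = x (0, 0) \<Longrightarrow> Lmin \<Lambda> (cmp \<Lambda> \<alpha> \<tau>) (cmp \<Lambda> \<mu> \<tau>) \<noteq> {}"
    and i: "deg \<Lambda> \<alpha> i < deg \<Lambda> \<mu> i"
  shows "m i = \<infinity>"
proof (rule ccontr)
  assume "m i \<noteq> \<infinity>"
  then obtain k where k: "m i = enat k" by auto
  \<comment> \<open>\<open>p\<close> exhausts \<open>x\<close> in direction \<open>i\<close>: as
    \<open>m i = enat (p i)\<close>, no path of positive degree in that direction can follow
    \<open>x (0, p)\<close> inside \<open>x\<close>. This is the final contradiction.\<close>
  define p where "p = (\<lambda>j. if j = i then k else 0)"
  have p: "fin_le p m" by (auto simp: fin_le_def p_def k zero_enat_def[symmetric])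
  have G: "(m, x) \<in> graph_paths \<Lambda>" using X by (auto simp: boundary_paths_def)
  have 0: "0 \<le> p" by (simp add: le_fun_def)
  note f = graph_path_facts[OF G 0 p]
  note fp = graph_path_facts[OF G order_refl p]
  define \<nu> where "\<nu> = x (0, p)"
  have \<nu>: "\<nu> \<in> mor \<Lambda>" "rng \<Lambda> \<nu> = x (0, 0)" "src \<Lambda> \<nu> = x (p, p)"
    using f by (auto simp: \<nu>_def)
  let ?\<alpha> = "cmp \<Lambda> \<alpha> \<nu>" and ?\<mu> = "cmp \<Lambda> \<mu> \<nu>"
  have \<alpha>\<nu>: "?\<alpha> \<in> mor \<Lambda>" "src \<Lambda> ?\<alpha> = x (p, p)" "deg \<Lambda> ?\<alpha> = deg \<Lambda> \<alpha> + deg \<Lambda> \<nu>"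
    using \<alpha> \<nu> by (simp_all add: cmp_mor src_cmp deg_cmp)
  have \<mu>\<nu>: "?\<mu> \<in> mor \<Lambda>" "src \<Lambda> ?\<mu> = x (p, p)" "deg \<Lambda> ?\<mu> = deg \<Lambda> \<mu> + deg \<Lambda> \<nu>"
    using \<mu> \<nu> by (simp_all add: cmp_mor src_cmp deg_cmp)
  define E where "E = fst ` Lmin \<Lambda> ?\<alpha> ?\<mu>"
  have E: "\<rho> \<in> mor \<Lambda>" "rng \<Lambda> \<rho> = x (p, p)" "deg \<Lambda> \<rho> i > 0" if \<rho>: "\<rho> \<in> E" for \<rho>
  proof -
    obtain \<tau> where "(\<rho>, \<tau>) \<in> Lmin \<Lambda> ?\<alpha> ?\<mu>" using \<rho> by (auto simp: E_def)
    note d = LminD[OF this \<alpha>\<nu>(1) \<mu>\<nu>(1)]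
    show "\<rho> \<in> mor \<Lambda>" "rng \<Lambda> \<rho> = x (p, p)" using d \<alpha>\<nu> by auto
    show "deg \<Lambda> \<rho> i > 0" using i by (simp add: d(7) \<alpha>\<nu>(3) \<mu>\<nu>(3) sup_fun_def sup_nat_def)
  qed
  have "exhaustive \<Lambda> (x (p, p)) E"
    unfolding exhaustive_def
  proof (intro conjI ballI impI subsetI)
    \<comment> \<open>Assumption \<open>H\<close> for \<nu>\<tau> gives a common extension of
      \<alpha>\<nu>\<tau> and \<mu>\<nu>\<tau>. Read as a common extension of \<alpha>\<nu> and
      \<mu>\<nu>, it factors through a minimal one, so \<tau>\<rho> = \<rho>'\<kappa> with
      \<open>\<rho>' \<in> E\<close>; hence \<tau> and \<rho>' have a common extension.\<close>
    fix \<tau> assume \<tau>: "\<tau> \<in> mor \<Lambda>" "rng \<Lambda> \<tau> = x (p, p)"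
    have \<nu>\<tau>: "cmp \<Lambda> \<nu> \<tau> \<in> mor \<Lambda>" "rng \<Lambda> (cmp \<Lambda> \<nu> \<tau>) = x (0, 0)"
      using \<nu> \<tau> by (simp_all add: cmp_mor rng_cmp)
    from H[OF this] obtain \<rho> \<sigma> where
      L: "(\<rho>, \<sigma>) \<in> Lmin \<Lambda> (cmp \<Lambda> \<alpha> (cmp \<Lambda> \<nu> \<tau>)) (cmp \<Lambda> \<mu> (cmp \<Lambda> \<nu> \<tau>))" by fastforce
    have e: "cmp \<Lambda> \<alpha> (cmp \<Lambda> \<nu> \<tau>) = cmp \<Lambda> ?\<alpha> \<tau>" "cmp \<Lambda> \<mu> (cmp \<Lambda> \<nu> \<tau>) = cmp \<Lambda> ?\<mu> \<tau>"
      using \<alpha> \<mu> \<nu> \<tau> by (simp_all add: cmp_assoc)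
    have a: "cmp \<Lambda> ?\<alpha> \<tau> \<in> mor \<Lambda>" "cmp \<Lambda> ?\<mu> \<tau> \<in> mor \<Lambda>"
      "src \<Lambda> (cmp \<Lambda> ?\<alpha> \<tau>) = src \<Lambda> \<tau>" "src \<Lambda> (cmp \<Lambda> ?\<mu> \<tau>) = src \<Lambda> \<tau>"
      using \<alpha>\<nu> \<mu>\<nu> \<tau> by (simp_all add: cmp_mor src_cmp)
    note d = LminD[OF L[unfolded e] a(1,2)]
    have "cmp \<Lambda> ?\<alpha> (cmp \<Lambda> \<tau> \<rho>) = cmp \<Lambda> ?\<mu> (cmp \<Lambda> \<tau> \<sigma>)"
      using d a \<alpha>\<nu> \<mu>\<nu> \<tau> by (simp add: cmp_assoc)
    moreover have m: "cmp \<Lambda> \<tau> \<rho> \<in> mor \<Lambda>" "rng \<Lambda> (cmp \<Lambda> \<tau> \<rho>) = x (p, p)"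
      "cmp \<Lambda> \<tau> \<sigma> \<in> mor \<Lambda>" "rng \<Lambda> (cmp \<Lambda> \<tau> \<sigma>) = x (p, p)"
      using d a \<tau> by (simp_all add: cmp_mor rng_cmp)
    ultimately obtain \<rho>' \<tau>' \<kappa> where k: "(\<rho>', \<tau>') \<in> Lmin \<Lambda> ?\<alpha> ?\<mu>" "\<kappa> \<in> mor \<Lambda>"
      "src \<Lambda> \<rho>' = rng \<Lambda> \<kappa>" "cmp \<Lambda> \<tau> \<rho> = cmp \<Lambda> \<rho>' \<kappa>"
      using Lmin_factor[OF \<alpha>\<nu>(1) \<mu>\<nu>(1) m(1) _ m(3)] \<alpha>\<nu>(2) \<mu>\<nu>(2) by metis
    have "\<rho>' \<in> E" unfolding E_def using k(1) by force
    moreover have "Lmin \<Lambda> \<tau> \<rho>' \<noteq> {}"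
      using Lmin_factor[OF \<tau>(1) E(1)[OF \<open>\<rho>' \<in> E\<close>] d(1) _ k(2,3,4)] d(3) a(3) by auto
    ultimately show "\<exists>\<rho>\<in>E. Lmin \<Lambda> \<tau> \<rho> \<noteq> {}" by blast
  qed (use E in auto)
  moreover have "finite E" unfolding E_def
    using fa \<alpha>\<nu>(1) \<mu>\<nu>(1) by (simp add: finitely_aligned_def)
  moreover have "x (p, p) \<notin> E"
    using E(3)[of "x (p, p)"] fp(4) by auto
  moreover have "x (p, p) \<in> verts \<Lambda>" using fp(1,2) by (simp add: verts_def)
  ultimately have "E \<in> FE \<Lambda> (x (p, p))" by (simp add: FE_def)
  with X p obtain \<rho> where \<rho>: "\<rho> \<in> E" "fin_le (p + deg \<Lambda> \<rho>) m"
    unfolding boundary_paths_def by blast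
  have "enat ((p + deg \<Lambda> \<rho>) i) \<le> enat k" using \<rho>(2) k by (metis fin_le_def)
  thus False using E(3)[OF \<rho>(1)] by (simp add: p_def)
qed

text \<open>Otherwise an aperiodic boundary path x at the common source would satisfy \<alpha>x =
  \<mu>x. The total degrees agree because x is infinite in every direction where the degrees of
  \<alpha> and \<mu> differ; the initial segments agree because they lie in a common
  extension.\<close>

lemma aperiodic_separates:
  assumes fa: "finitely_aligned \<Lambda>" and ap: "aperiodic \<Lambda>"
    and \<alpha>: "\<alpha> \<in> mor \<Lambda>" and \<mu>: "\<mu> \<in> mor \<Lambda>" and s: "src \<Lambda> \<alpha> = src \<Lambda> \<mu>" and ne: "\<alpha> \<noteq> \<mu>"
  shows "\<exists>\<tau> \<in> mor \<Lambda>. rng \<Lambda> \<tau> = src \<Lambda> \<alpha> \<and> Lmin \<Lambda> (cmp \<Lambda> \<alpha> \<tau>) (cmp \<Lambda> \<mu> \<tau>) = {}"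
proof (rule ccontr)
  assume "\<not> ?thesis"
  hence H: "Lmin \<Lambda> (cmp \<Lambda> \<alpha> \<tau>) (cmp \<Lambda> \<mu> \<tau>) \<noteq> {}" "Lmin \<Lambda> (cmp \<Lambda> \<mu> \<tau>) (cmp \<Lambda> \<alpha> \<tau>) \<noteq> {}"
    if "\<tau> \<in> mor \<Lambda>" "rng \<Lambda> \<tau> = src \<Lambda> \<alpha>" for \<tau>
    using that Lmin_empty_commute by blast+
  obtain X where X: "X \<in> boundary_paths \<Lambda>" "path_rng X = src \<Lambda> \<alpha>" "aperiodic_path \<Lambda> X"
    using ap src_verts[OF \<alpha>] by (auto simp: aperiodic_def)
  obtain m x where mx: "X = (m, x)" by (cases X)
  note B = X(1)[unfolded mx]
  have G: "(m, x) \<in> graph_paths \<Lambda>" using B by (auto simp: boundary_paths_def)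
  have s\<alpha>: "src \<Lambda> \<alpha> = x (0, 0)" and s\<mu>: "src \<Lambda> \<mu> = x (0, 0)"
    using X(2) s by (auto simp: mx path_rng_def)
  have inf: "m i = \<infinity>" if "deg \<Lambda> \<alpha> i \<noteq> deg \<Lambda> \<mu> i" for i
    using that boundary_path_infinite_direction[OF fa B \<alpha> s\<alpha> \<mu> s\<mu>, of i] H s\<alpha>
      boundary_path_infinite_direction[OF fa B \<mu> s\<mu> \<alpha> s\<alpha>, of i] by force
  let ?M = "\<lambda>i. enat (deg \<Lambda> \<alpha> i) + m i"
  have M: "(\<lambda>i. enat (deg \<Lambda> \<mu> i) + m i) = ?M"
  proof
    fix i show "enat (deg \<Lambda> \<mu> i) + m i = ?M i"
      using inf[of i] by (cases "deg \<Lambda> \<alpha> i = deg \<Lambda> \<mu> i") simp_all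
  qed
  \<comment> \<open>\<open>start \<alpha> x q\<close> is the segment (\<alpha>x)(0,q). The bound
    \<open>n\<close> makes both \<alpha>x(0,n) and \<mu>x(0,n) reach degree \<open>q\<close>; both
    begin one common extension, so their pieces of degree \<open>q\<close> coincide.\<close>
  have st: "start \<alpha> x q = start \<mu> x q" if q: "fin_le q ?M" for q
  proof -
    define n where "n = sup (q - deg \<Lambda> \<alpha>) (q - deg \<Lambda> \<mu>)"
    have "fin_le (q - deg \<Lambda> \<alpha>) m" "fin_le (q - deg \<Lambda> \<mu>) m"
      using fin_le_diff[OF q] fin_le_diff[OF q[folded M]] by simp_all
    hence n: "fin_le n m" by (auto simp: n_def fin_le_def sup_fun_def sup_nat_def max_def)
    have q\<alpha>: "q \<le> deg \<Lambda> \<alpha> + n" and q\<mu>: "q \<le> deg \<Lambda> \<mu> + n"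
      by (auto simp: n_def le_fun_def sup_fun_def sup_nat_def)
    have 0: "0 \<le> n" by (simp add: le_fun_def)
    note f = graph_path_facts[OF G 0 n]
    note ca = cons_aux[OF \<alpha> G s\<alpha> n] and cm = cons_aux[OF \<mu> G s\<mu> n]
    from H(1)[OF f(1)] f(2) s\<alpha> obtain \<rho> \<tau> where
      "(\<rho>, \<tau>) \<in> Lmin \<Lambda> (cmp \<Lambda> \<alpha> (x (0, n))) (cmp \<Lambda> \<mu> (x (0, n)))" by fastforce
    note d = LminD[OF this ca(1) cm(1)]
    have "start \<alpha> x q = initial \<Lambda> (cmp \<Lambda> \<alpha> (x (0, n))) q"
      using start_extend[OF \<alpha> G s\<alpha> fin_le_add[OF n] q\<alpha>] start_shift[OF \<alpha> G s\<alpha> n] by simp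
    also have "\<dots> = initial \<Lambda> (cmp \<Lambda> (cmp \<Lambda> \<alpha> (x (0, n))) \<rho>) q"
      using initial_cmp[OF ca(1) d(1) d(3)[symmetric]] q\<alpha> ca(2) by simp
    also have "\<dots> = initial \<Lambda> (cmp \<Lambda> \<mu> (x (0, n))) q"
      using initial_cmp[OF cm(1) d(2) d(4)[symmetric]] q\<mu> cm(2) d(5) by simp
    also have "\<dots> = start \<mu> x q"
      using start_extend[OF \<mu> G s\<mu> fin_le_add[OF n] q\<mu>] start_shift[OF \<mu> G s\<mu> n] by simp
    finally show ?thesis .
  qed
  have "path_cons \<Lambda> \<alpha> X = path_cons \<Lambda> \<mu> X"
    unfolding path_cons_def Let_def mx fst_conv snd_conv M
    using st by (auto simp: start_def[OF \<alpha> G s\<alpha>] start_def[OF \<mu> G s\<mu>] Omega_def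
        intro!: restrict_ext)
  thus False using X(2,3) \<alpha> \<mu> s ne by (auto simp: aperiodic_path_def)
qed

text \<open>A common extension of \<alpha>\<tau> and \<mu>\<tau> also extends \<alpha> and \<mu>.
  Hence pairs that are already separated stay separated when the separating path is
  lengthened.\<close>

lemma Lmin_cmp_empty:
  assumes "\<alpha> \<in> mor \<Lambda>" "\<mu> \<in> mor \<Lambda>" "\<tau> \<in> mor \<Lambda>" "src \<Lambda> \<alpha> = rng \<Lambda> \<tau>" "src \<Lambda> \<mu> = rng \<Lambda> \<tau>"
    and "Lmin \<Lambda> \<alpha> \<mu> = {}"
  shows "Lmin \<Lambda> (cmp \<Lambda> \<alpha> \<tau>) (cmp \<Lambda> \<mu> \<tau>) = {}"
proof (rule ccontr)
  assume "\<not> ?thesis"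
  then obtain \<rho> \<sigma> where L: "(\<rho>, \<sigma>) \<in> Lmin \<Lambda> (cmp \<Lambda> \<alpha> \<tau>) (cmp \<Lambda> \<mu> \<tau>)" by fastforce
  note d = LminD[OF L cmp_mor[OF assms(1,3,4)] cmp_mor[OF assms(2,3,5)]]
  have s: "rng \<Lambda> \<rho> = src \<Lambda> \<tau>" "rng \<Lambda> \<sigma> = src \<Lambda> \<tau>"
    using d assms by (simp_all add: src_cmp)
  have "cmp \<Lambda> \<alpha> (cmp \<Lambda> \<tau> \<rho>) = cmp \<Lambda> \<mu> (cmp \<Lambda> \<tau> \<sigma>)"
    using d(1,2,5) s assms by (simp add: cmp_assoc)
  from Lmin_factor[OF assms(1,2) _ _ _ _ this] show False
    using assms d(1,2) s by (auto simp: cmp_mor rng_cmp)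
qed

text \<open>The pairs are treated one after the other: the path \<tau> found so far is lengthened by
  a path \<sigma> that separates the new pair, and \<open>Lmin_cmp_empty\<close> preserves the
  earlier separations.\<close>

lemma aperiodic_separates_finite:
  assumes fa: "finitely_aligned \<Lambda>" and ap: "aperiodic \<Lambda>" and w: "w \<in> verts \<Lambda>"
    and "finite D" and "\<And>\<alpha> \<mu>. (\<alpha>, \<mu>) \<in> D \<Longrightarrow> \<alpha> \<in> mor \<Lambda> \<and> \<mu> \<in> mor \<Lambda> \<and> src \<Lambda> \<alpha> = w \<and> src \<Lambda> \<mu> = w \<and> \<alpha> \<noteq> \<mu>"
  shows "\<exists>\<tau> \<in> mor \<Lambda>. rng \<Lambda> \<tau> = w \<and> (\<forall>(\<alpha>, \<mu>) \<in> D. Lmin \<Lambda> (cmp \<Lambda> \<alpha> \<tau>) (cmp \<Lambda> \<mu> \<tau>) = {})"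
  using assms(4,5)
proof (induction D rule: finite_induct)
  case empty
  thus ?case using w by (auto simp: verts_def)
next
  case (insert z D)
  obtain \<alpha> \<mu> where z: "z = (\<alpha>, \<mu>)" by (cases z)
  have *: "\<alpha> \<in> mor \<Lambda>" "\<mu> \<in> mor \<Lambda>" "src \<Lambda> \<alpha> = w" "src \<Lambda> \<mu> = w" "\<alpha> \<noteq> \<mu>"
    using insert.prems[of \<alpha> \<mu>] z by auto
  obtain \<tau> where \<tau>: "\<tau> \<in> mor \<Lambda>" "rng \<Lambda> \<tau> = w"
    and D: "\<And>\<beta> \<nu>. (\<beta>, \<nu>) \<in> D \<Longrightarrow> Lmin \<Lambda> (cmp \<Lambda> \<beta> \<tau>) (cmp \<Lambda> \<nu> \<tau>) = {}"
    using insert by fastforce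
  \<comment> \<open>Right cancellation keeps \<alpha>\<tau> and \<mu>\<tau> distinct, so the result
    for a single pair applies to them.\<close>
  have c: "cmp \<Lambda> \<alpha> \<tau> \<in> mor \<Lambda>" "cmp \<Lambda> \<mu> \<tau> \<in> mor \<Lambda>" "src \<Lambda> (cmp \<Lambda> \<alpha> \<tau>) = src \<Lambda> \<tau>"
    "src \<Lambda> (cmp \<Lambda> \<mu> \<tau>) = src \<Lambda> \<tau>" "cmp \<Lambda> \<alpha> \<tau> \<noteq> cmp \<Lambda> \<mu> \<tau>"
    using * \<tau> cmp_right_cancel by (auto simp: cmp_mor src_cmp)
  from aperiodic_separates[OF fa ap c(1,2) _ c(5)] c(3,4) obtain \<sigma> where \<sigma>: "\<sigma> \<in> mor \<Lambda>"
    "rng \<Lambda> \<sigma> = src \<Lambda> \<tau>" "Lmin \<Lambda> (cmp \<Lambda> (cmp \<Lambda> \<alpha> \<tau>) \<sigma>) (cmp \<Lambda> (cmp \<Lambda> \<mu> \<tau>) \<sigma>) = {}"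
    by auto
  show ?case
  proof (intro bexI conjI ballI)
    show "cmp \<Lambda> \<tau> \<sigma> \<in> mor \<Lambda>" "rng \<Lambda> (cmp \<Lambda> \<tau> \<sigma>) = w"
      using \<tau> \<sigma> by (simp_all add: cmp_mor rng_cmp)
    fix y assume y: "y \<in> insert z D"
    obtain \<beta> \<nu> where \<beta>\<nu>: "y = (\<beta>, \<nu>)" by (cases y)
    have b: "\<beta> \<in> mor \<Lambda>" "\<nu> \<in> mor \<Lambda>" "src \<Lambda> \<beta> = w" "src \<Lambda> \<nu> = w"
      using insert.prems[of \<beta> \<nu>] y \<beta>\<nu> by auto
    have "Lmin \<Lambda> (cmp \<Lambda> (cmp \<Lambda> \<beta> \<tau>) \<sigma>) (cmp \<Lambda> (cmp \<Lambda> \<nu> \<tau>) \<sigma>) = {}"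
    proof (cases "y = z")
      case True
      thus ?thesis using \<sigma>(3) z \<beta>\<nu> by simp
    next
      case False
      hence "Lmin \<Lambda> (cmp \<Lambda> \<beta> \<tau>) (cmp \<Lambda> \<nu> \<tau>) = {}" using D y \<beta>\<nu> by auto
      thus ?thesis using b \<tau> \<sigma>
        by (intro Lmin_cmp_empty[of "cmp \<Lambda> \<beta> \<tau>" "cmp \<Lambda> \<nu> \<tau>" \<sigma>]) (simp_all add: cmp_mor src_cmp)
    qed
    thus "case y of (\<alpha>, \<mu>) \<Rightarrow> Lmin \<Lambda> (cmp \<Lambda> \<alpha> (cmp \<Lambda> \<tau> \<sigma>)) (cmp \<Lambda> \<mu> (cmp \<Lambda> \<tau> \<sigma>)) = {}"
      using b \<tau> \<sigma> by (simp add: \<beta>\<nu> cmp_assoc)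
  qed
qed

end


section \<open>Calculating modulo the Kumjian-Pask relations\<close>

text \<open>\<open>Poly_Mapping.single 0 r\<close> is \<open>r\<close> times the empty word. It is
  central although words do not commute, because the coefficients commute and the empty word is
  neutral; so scalars pass through products.\<close>

lemma mult_single_zero_commute:
  fixes p :: "'x word \<Rightarrow>\<^sub>0 'r::{comm_ring,comm_monoid_mult}"
  shows "p * Poly_Mapping.single 0 r = Poly_Mapping.single 0 r * p"
proof -
  have "(\<Sum>w \<in> Poly_Mapping.keys p. Poly_Mapping.single w (Poly_Mapping.lookup p w)) * Poly_Mapping.single 0 r =
    Poly_Mapping.single 0 r * (\<Sum>w \<in> Poly_Mapping.keys p. Poly_Mapping.single w (Poly_Mapping.lookup p w))"
    by (simp add: sum_distrib_left sum_distrib_right mult_single mult.commute)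
  thus ?thesis by (simp add: sum_monomials)
qed

lemma free_scale_mult_right: "p * free_scale r q = free_scale r (p * q)"
  by (metis free_scale_eq mult.assoc mult_single_zero_commute)

lemma free_scale_one: "free_scale 1 p = p"
  by (rule poly_mapping_eqI) (simp add: lookup_free_scale)

lemma free_scale_zero_left: "free_scale 0 p = 0"
  by (simp add: free_scale_eq)

lemma free_scale_zero_right: "free_scale r 0 = 0"
  by (simp add: free_scale_eq)

lemma free_scale_sum: "free_scale r (sum f A) = (\<Sum>a\<in>A. free_scale r (f a))"
  by (simp add: free_scale_eq sum_distrib_left)

lemma free_scale_scale: "free_scale r (free_scale t p) = free_scale (r * t) p"
  by (simp add: free_scale_eq mult_single flip: mult.assoc)

lemma free_scale_add_left: "free_scale (r + t) p = free_scale r p + free_scale t p"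
  by (simp add: free_scale_eq single_add distrib_right)

context kgraph
begin

section \<open>Congruence modulo the Kumjian-Pask ideal\<close>

text \<open>Both sides must lie in \<open>free_algebra \<Lambda>\<close>, because the type also
  contains elements involving the empty word or meaningless symbols, while
  \<open>kp_ideal \<Lambda>\<close> is an ideal of \<open>free_algebra \<Lambda>\<close> only. The
  relation is thus reflexive just on that set.\<close>

definition kp_cong :: "('e, 'r::{comm_ring,comm_monoid_mult}) pre_kp \<Rightarrow> ('e, 'r) pre_kp \<Rightarrow> bool"
    (infix "\<approx>" 50) where
  "p \<approx> q \<longleftrightarrow> p \<in> free_algebra \<Lambda> \<and> q \<in> free_algebra \<Lambda> \<and> p - q \<in> kp_ideal \<Lambda>"

abbreviation pth :: "'e \<Rightarrow> ('e, 'r::{comm_ring,comm_monoid_mult}) pre_kp" where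
  "pth \<alpha> \<equiv> gen (Path \<alpha>)"

abbreviation gst :: "'e \<Rightarrow> ('e, 'r::{comm_ring,comm_monoid_mult}) pre_kp" where
  "gst \<alpha> \<equiv> gen (star \<Lambda> \<alpha>)"

lemma pth_free_algebra [simp]: "\<alpha> \<in> mor \<Lambda> \<Longrightarrow> pth \<alpha> \<in> free_algebra \<Lambda>"
  and gst_free_algebra [simp]: "\<alpha> \<in> mor \<Lambda> \<Longrightarrow> gst \<alpha> \<in> free_algebra \<Lambda>"
  by (simp_all add: free_algebra_gen Path_symbols star_symbols)

lemmas kp_ideal_closed = free_ideal_kp_ideal[unfolded free_ideal_def]

lemma kp_congD: "p \<approx> q \<Longrightarrow> p \<in> free_algebra \<Lambda>" "p \<approx> q \<Longrightarrow> q \<in> free_algebra \<Lambda>"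
  by (auto simp: kp_cong_def)

lemma kp_cong_refl: "p \<in> free_algebra \<Lambda> \<Longrightarrow> p \<approx> p"
  using kp_ideal_closed by (auto simp: kp_cong_def)

lemma kp_cong_sym: "p \<approx> q \<Longrightarrow> q \<approx> p"
proof -
  assume "p \<approx> q"
  moreover from this have "free_scale (- 1) (p - q) \<in> kp_ideal \<Lambda>"
    using kp_ideal_closed by (auto simp: kp_cong_def)
  ultimately show ?thesis by (simp add: kp_cong_def free_scale_minus)
qed

lemma kp_cong_add:
  assumes "p \<approx> p'" "q \<approx> q'" shows "p + q \<approx> p' + q'"
proof -
  have "(p - p') + (q - q') \<in> kp_ideal \<Lambda>"
    using assms kp_ideal_closed by (auto simp: kp_cong_def)
  moreover have "(p - p') + (q - q') = (p + q) - (p' + q')" by simp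
  ultimately show ?thesis using assms by (auto simp: kp_cong_def free_algebra_add)
qed

lemma kp_cong_trans [trans]:
  assumes "p \<approx> q" "q \<approx> s" shows "p \<approx> s"
proof -
  have "(p - q) + (q - s) \<in> kp_ideal \<Lambda>"
    using assms kp_ideal_closed unfolding kp_cong_def by blast
  thus ?thesis using assms by (simp add: kp_cong_def)
qed

lemma kp_cong_mult:
  assumes "p \<approx> p'" "q \<approx> q'" shows "p * q \<approx> p' * q'"
proof -
  have "(p - p') * q + p' * (q - q') \<in> kp_ideal \<Lambda>"
    using assms kp_ideal_closed unfolding kp_cong_def by blast
  moreover have "(p - p') * q + p' * (q - q') = p * q - p' * q'" by (simp add: algebra_simps)
  ultimately show ?thesis using assms by (simp add: kp_cong_def free_algebra_mult)
qed

lemma kp_cong_mult_left: "q \<approx> q' \<Longrightarrow> p \<in> free_algebra \<Lambda> \<Longrightarrow> p * q \<approx> p * q'"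
  and kp_cong_mult_right: "q \<approx> q' \<Longrightarrow> p \<in> free_algebra \<Lambda> \<Longrightarrow> q * p \<approx> q' * p"
  by (blast intro: kp_cong_mult kp_cong_refl)+

lemma kp_cong_scale:
  assumes "p \<approx> p'" shows "free_scale r p \<approx> free_scale r p'"
  using assms kp_ideal_closed
  by (auto simp: kp_cong_def free_algebra_scale simp flip: free_scale_diff)

lemma kp_cong_diff: "p \<approx> p' \<Longrightarrow> q \<approx> q' \<Longrightarrow> p - q \<approx> p' - q'"
  using kp_cong_add[of p p' "free_scale (- 1) q" "free_scale (- 1) q'"] kp_cong_scale[of q q' "- 1"]
  by (simp add: free_scale_minus)

lemma kp_cong_sum: "(\<And>a. a \<in> A \<Longrightarrow> f a \<approx> g a) \<Longrightarrow> sum f A \<approx> sum g A"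
  by (induction A rule: infinite_finite_induct)
    (auto intro: kp_cong_add kp_cong_refl free_algebra_zero)

lemma kp_cong_zero_iff: "p \<approx> 0 \<longleftrightarrow> p \<in> kp_ideal \<Lambda>"
  using kp_ideal_closed by (auto simp: kp_cong_def free_algebra_zero)

text \<open>\<open>S\<close> is \<open>gen\<close> at a single coefficient type shared by all
  clauses. They turn membership in the ideal into congruences that can be chained.\<close>

lemma kp_relations:
  fixes S :: "'e symbol \<Rightarrow> ('e, 'r::{comm_ring,comm_monoid_mult}) pre_kp"
  defines "S \<equiv> gen"
  shows kp_vert_orth: "\<lbrakk>v \<in> verts \<Lambda>; w \<in> verts \<Lambda>; v \<noteq> w\<rbrakk> \<Longrightarrow> S (Path v) * S (Path w) \<approx> 0"
    and kp_path_mult: "\<lbrakk>\<alpha> \<in> mor \<Lambda>; \<mu> \<in> mor \<Lambda>; src \<Lambda> \<alpha> = rng \<Lambda> \<mu>\<rbrakk> \<Longrightarrow>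
      S (Path \<alpha>) * S (Path \<mu>) \<approx> S (Path (cmp \<Lambda> \<alpha> \<mu>))"
    and kp_ghost_mult: "\<lbrakk>\<alpha> \<in> mor \<Lambda>; \<mu> \<in> mor \<Lambda>; src \<Lambda> \<alpha> = rng \<Lambda> \<mu>\<rbrakk> \<Longrightarrow>
      S (star \<Lambda> \<mu>) * S (star \<Lambda> \<alpha>) \<approx> S (star \<Lambda> (cmp \<Lambda> \<alpha> \<mu>))"
    and kp_ghost_path: "\<lbrakk>\<alpha> \<in> mor \<Lambda>; \<mu> \<in> mor \<Lambda>\<rbrakk> \<Longrightarrow>
      S (star \<Lambda> \<alpha>) * S (Path \<mu>) \<approx> (\<Sum>(\<rho>, \<tau>) \<in> Lmin \<Lambda> \<alpha> \<mu>. S (Path \<rho>) * S (star \<Lambda> \<tau>))"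
    and kp_exhaustive: "\<lbrakk>v \<in> verts \<Lambda>; E \<in> FE \<Lambda> v; distinct es; set es = E\<rbrakk> \<Longrightarrow>
      list_product (map (\<lambda>\<alpha>. S (Path v) - S (Path \<alpha>) * S (star \<Lambda> \<alpha>)) es) \<approx> 0"
proof -
  note K = kp_family_mod_kp_ideal[of \<Lambda>, unfolded kp_family_mod_def, where 'r='r, folded S_def]
  have F: "S (Path \<alpha>) \<in> free_algebra \<Lambda>" "S (star \<Lambda> \<alpha>) \<in> free_algebra \<Lambda>" if "\<alpha> \<in> mor \<Lambda>" for \<alpha>
    using that by (simp_all add: S_def)
  show "S (Path v) * S (Path w) \<approx> 0" if "v \<in> verts \<Lambda>" "w \<in> verts \<Lambda>" "v \<noteq> w" for v w
    using that K by (auto simp: kp_cong_zero_iff)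
  show "S (Path \<alpha>) * S (Path \<mu>) \<approx> S (Path (cmp \<Lambda> \<alpha> \<mu>))"
    "S (star \<Lambda> \<mu>) * S (star \<Lambda> \<alpha>) \<approx> S (star \<Lambda> (cmp \<Lambda> \<alpha> \<mu>))"
    if "\<alpha> \<in> mor \<Lambda>" "\<mu> \<in> mor \<Lambda>" "src \<Lambda> \<alpha> = rng \<Lambda> \<mu>" for \<alpha> \<mu>
    using that K F by (auto simp: kp_cong_def cmp_mor intro!: free_algebra_mult)
  show "S (star \<Lambda> \<alpha>) * S (Path \<mu>) \<approx> (\<Sum>(\<rho>, \<tau>) \<in> Lmin \<Lambda> \<alpha> \<mu>. S (Path \<rho>) * S (star \<Lambda> \<tau>))"
    if "\<alpha> \<in> mor \<Lambda>" "\<mu> \<in> mor \<Lambda>" for \<alpha> \<mu>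
    unfolding kp_cong_def
  proof (intro conjI)
    show "S (star \<Lambda> \<alpha>) * S (Path \<mu>) \<in> free_algebra \<Lambda>"
      using that F by (intro free_algebra_mult)
    show "(\<Sum>(\<rho>, \<tau>) \<in> Lmin \<Lambda> \<alpha> \<mu>. S (Path \<rho>) * S (star \<Lambda> \<tau>)) \<in> free_algebra \<Lambda>"
      using F by (intro free_algebra_sum) (auto intro!: free_algebra_mult dest!: Lmin_mor)
  qed (use that K in blast)
  show "list_product (map (\<lambda>\<alpha>. S (Path v) - S (Path \<alpha>) * S (star \<Lambda> \<alpha>)) es) \<approx> 0"
    if "v \<in> verts \<Lambda>" "E \<in> FE \<Lambda> v" "distinct es" "set es = E" for v E es
    unfolding kp_cong_zero_iff using that K by blast
qed

lemma gst_vert: "v \<in> verts \<Lambda> \<Longrightarrow> gst v = pth v"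
  by (simp add: star_def)

lemma kp_path_rng: "\<alpha> \<in> mor \<Lambda> \<Longrightarrow> pth (rng \<Lambda> \<alpha>) * pth \<alpha> \<approx> pth \<alpha>"
  using kp_path_mult[of "rng \<Lambda> \<alpha>" \<alpha>] by (simp add: rng_mor src_rng cmp_rng_left)

lemma kp_path_src: "\<alpha> \<in> mor \<Lambda> \<Longrightarrow> pth \<alpha> * pth (src \<Lambda> \<alpha>) \<approx> pth \<alpha>"
  using kp_path_mult[of \<alpha> "src \<Lambda> \<alpha>"] by (simp add: src_mor rng_src cmp_src_right)

lemma kp_ghost_src: "\<alpha> \<in> mor \<Lambda> \<Longrightarrow> pth (src \<Lambda> \<alpha>) * gst \<alpha> \<approx> gst \<alpha>"
  using kp_ghost_mult[of \<alpha> "src \<Lambda> \<alpha>"]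
  by (simp add: src_mor rng_src cmp_src_right gst_vert[OF src_verts])

lemma kp_ghost_rng: "\<alpha> \<in> mor \<Lambda> \<Longrightarrow> gst \<alpha> * pth (rng \<Lambda> \<alpha>) \<approx> gst \<alpha>"
  using kp_ghost_mult[of "rng \<Lambda> \<alpha>" \<alpha>]
  by (simp add: rng_mor src_rng cmp_rng_left gst_vert[OF rng_verts])

text \<open>Inserting the two vertices gives
  \<open>a * b \<approx> (a * pth v) * (pth w * b)\<close>, and the middle product vanishes by
  (KP1). This handles products of two paths or two ghosts whose endpoints do not match.\<close>

lemma kp_cong_orthogonal:
  assumes "a * pth v \<approx> a" "pth w * b \<approx> b" "v \<in> verts \<Lambda>" "w \<in> verts \<Lambda>" "v \<noteq> w"
  shows "a * b \<approx> 0"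
proof -
  have F: "a \<in> free_algebra \<Lambda>" "b \<in> free_algebra \<Lambda>" using assms(1,2) by (auto simp: kp_cong_def)
  have "a * b \<approx> (a * pth v) * (pth w * b)"
    by (rule kp_cong_mult[OF assms(1,2)[THEN kp_cong_sym]])
  moreover have "(a * pth v) * (pth w * b) \<approx> 0"
    using kp_cong_mult_right[OF kp_cong_mult_left[OF kp_vert_orth[OF assms(3-5)] F(1)] F(2)]
    by (simp add: mult.assoc)
  ultimately show ?thesis by (rule kp_cong_trans)
qed

lemma kp_path_mult_zero:
  "\<lbrakk>\<alpha> \<in> mor \<Lambda>; \<mu> \<in> mor \<Lambda>; src \<Lambda> \<alpha> \<noteq> rng \<Lambda> \<mu>\<rbrakk> \<Longrightarrow> pth \<alpha> * pth \<mu> \<approx> 0"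
  by (rule kp_cong_orthogonal[OF kp_path_src kp_path_rng src_verts rng_verts])

lemma kp_ghost_mult_zero:
  "\<lbrakk>\<alpha> \<in> mor \<Lambda>; \<mu> \<in> mor \<Lambda>; src \<Lambda> \<alpha> \<noteq> rng \<Lambda> \<mu>\<rbrakk> \<Longrightarrow> gst \<mu> * gst \<alpha> \<approx> 0"
  by (rule kp_cong_orthogonal[OF kp_ghost_rng kp_ghost_src rng_verts src_verts]) auto

lemma kp_ghost_vert:
  assumes "\<alpha> \<in> mor \<Lambda>" "v \<in> verts \<Lambda>"
  shows "gst \<alpha> * pth v \<approx> (if rng \<Lambda> \<alpha> = v then gst \<alpha> else 0)"
proof (cases "rng \<Lambda> \<alpha> = v")
  case True
  thus ?thesis using kp_ghost_rng[OF assms(1)] by simp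
next
  case False
  thus ?thesis using kp_ghost_mult_zero[OF verts_mor[OF assms(2)] assms(1)] assms(2)
    by (simp add: gst_vert verts_src)
qed

lemma kp_ghost_path_disjoint:
  "\<lbrakk>\<alpha> \<in> mor \<Lambda>; \<mu> \<in> mor \<Lambda>; Lmin \<Lambda> \<alpha> \<mu> = {}\<rbrakk> \<Longrightarrow> gst \<alpha> * pth \<mu> \<approx> 0"
  using kp_ghost_path[of \<alpha> \<mu>] by simp

lemma kp_ghost_path_self:
  assumes "\<alpha> \<in> mor \<Lambda>" shows "gst \<alpha> * pth \<alpha> \<approx> pth (src \<Lambda> \<alpha>)"
proof -
  have "gst \<alpha> * pth \<alpha> \<approx> pth (src \<Lambda> \<alpha>) * pth (src \<Lambda> \<alpha>)"
    using kp_ghost_path[OF assms assms] by (simp add: Lmin_self[OF assms] gst_vert[OF src_verts[OF assms]])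
  also have "\<dots> \<approx> pth (src \<Lambda> \<alpha>)"
    using kp_path_src[OF src_mor[OF assms]] src_src[OF assms] by simp
  finally show ?thesis .
qed

section \<open>Spanning by products of a path and a ghost\<close>

definition pairs :: "('e \<times> 'e) set" where
  "pairs = {(\<alpha>, \<mu>). \<alpha> \<in> mor \<Lambda> \<and> \<mu> \<in> mor \<Lambda> \<and> src \<Lambda> \<alpha> = src \<Lambda> \<mu>}"

definition path_ghost :: "'e \<times> 'e \<Rightarrow> ('e, 'r::{comm_ring,comm_monoid_mult}) pre_kp" where
  "path_ghost z = pth (fst z) * gst (snd z)"

lemma path_ghost_free_algebra [simp]: "z \<in> pairs \<Longrightarrow> path_ghost z \<in> free_algebra \<Lambda>"
  by (auto simp: pairs_def path_ghost_def intro!: free_algebra_mult)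

text \<open>Allowing \<open>\<approx>\<close> makes this a submodule modulo the ideal rather than a
  span of words. The coefficients \<open>c\<close> need not be unique: by (KP4) the spanning
  products can be linearly dependent.\<close>

definition mspan :: "('e \<times> 'e) set \<Rightarrow> ('e, 'r::{comm_ring,comm_monoid_mult}) pre_kp set" where
  "mspan X = {p. \<exists>A c. finite A \<and> A \<subseteq> X \<and> p \<approx> (\<Sum>z\<in>A. free_scale (c z) (path_ghost z))}"

lemma mspanI:
  "finite A \<Longrightarrow> A \<subseteq> X \<Longrightarrow> p \<approx> (\<Sum>z\<in>A. free_scale (c z) (path_ghost z)) \<Longrightarrow> p \<in> mspan X"
  by (auto simp: mspan_def)

lemma mspan_cong: "p \<approx> q \<Longrightarrow> q \<in> mspan X \<Longrightarrow> p \<in> mspan X"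
  unfolding mspan_def using kp_cong_trans by blast

lemma mspan_zero: "0 \<in> mspan X"
  using kp_cong_refl[OF free_algebra_zero] by (auto simp: mspan_def intro!: exI[of _ "{}"])

lemma mspan_scale:
  assumes "p \<in> mspan X" shows "free_scale r p \<in> mspan X"
proof -
  obtain A c where A: "finite A" "A \<subseteq> X" "p \<approx> (\<Sum>z\<in>A. free_scale (c z) (path_ghost z))"
    using assms by (auto simp: mspan_def)
  have "free_scale r p \<approx> (\<Sum>z\<in>A. free_scale (r * c z) (path_ghost z))"
    using kp_cong_scale[OF A(3), of r] by (simp add: free_scale_sum free_scale_scale)
  with A(1,2) show ?thesis by (rule mspanI)
qed

lemma mspan_add:
  assumes "p \<in> mspan X" "q \<in> mspan X" shows "p + q \<in> mspan X"
proof -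
  obtain A c where A: "finite A" "A \<subseteq> X" "p \<approx> (\<Sum>z\<in>A. free_scale (c z) (path_ghost z))"
    using assms by (auto simp: mspan_def)
  obtain B d where B: "finite B" "B \<subseteq> X" "q \<approx> (\<Sum>z\<in>B. free_scale (d z) (path_ghost z))"
    using assms by (auto simp: mspan_def)
  have "(\<Sum>z\<in>A. free_scale (c z) (path_ghost z)) = (\<Sum>z\<in>A \<union> B. free_scale (if z \<in> A then c z else 0) (path_ghost z))"
    using A(1) B(1) by (intro sum.mono_neutral_cong_left) (auto simp: free_scale_zero_left)
  moreover have "(\<Sum>z\<in>B. free_scale (d z) (path_ghost z)) =
      (\<Sum>z\<in>A \<union> B. free_scale (if z \<in> B then d z else 0) (path_ghost z))"
    using A(1) B(1) by (intro sum.mono_neutral_cong_left) (auto simp: free_scale_zero_left)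
  ultimately have "p + q \<approx> (\<Sum>z\<in>A \<union> B.
      free_scale ((if z \<in> A then c z else 0) + (if z \<in> B then d z else 0)) (path_ghost z))"
    using kp_cong_add[OF A(3) B(3)] by (simp add: free_scale_add_left sum.distrib)
  thus ?thesis using A(1,2) B(1,2) by (intro mspanI[where A="A \<union> B"]) auto
qed

lemma mspan_sum: "(\<And>a. a \<in> A \<Longrightarrow> f a \<in> mspan X) \<Longrightarrow> sum f A \<in> mspan X"
  by (induction A rule: infinite_finite_induct) (auto intro: mspan_zero mspan_add)

lemma mspan_path_ghost:
  assumes "z \<in> X" "X \<subseteq> pairs" shows "path_ghost z \<in> mspan X"
proof -
  have "path_ghost z \<approx> (\<Sum>z\<in>{z}. free_scale 1 (path_ghost z))"
    using kp_cong_refl[OF path_ghost_free_algebra[OF subsetD[OF assms(2,1)]]] by (simp add: free_scale_one)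
  with assms(1) show ?thesis by (intro mspanI[where A="{z}" and c="\<lambda>_. 1"]) auto
qed

lemma kp_path_mult_path_ghost:
  assumes "\<alpha> \<in> mor \<Lambda>" "z \<in> pairs"
  shows "pth \<alpha> * path_ghost z \<approx> (if src \<Lambda> \<alpha> = rng \<Lambda> (fst z) then path_ghost (cmp \<Lambda> \<alpha> (fst z), snd z) else 0)"
proof -
  have z: "fst z \<in> mor \<Lambda>" "snd z \<in> mor \<Lambda>" using assms(2) by (auto simp: pairs_def)
  have "pth \<alpha> * path_ghost z = (pth \<alpha> * pth (fst z)) * gst (snd z)" by (simp add: path_ghost_def mult.assoc)
  also have "\<dots> \<approx> (if src \<Lambda> \<alpha> = rng \<Lambda> (fst z) then pth (cmp \<Lambda> \<alpha> (fst z)) else 0) * gst (snd z)"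
    using assms(1) z by (intro kp_cong_mult_right) (auto intro: kp_path_mult kp_path_mult_zero)
  finally show ?thesis by (simp add: path_ghost_def split: if_splits)
qed

text \<open>(KP3) rewrites the inner product of \<open>gst (snd z)\<close> and
  \<open>pth \<nu>\<close>, and each \<rho> is absorbed into the path on the left. Only \<tau>
  remains as a ghost, which is why multiplication by paths shortens ghosts.\<close>

lemma kp_path_ghost_mult_path:
  assumes "z \<in> pairs" "\<nu> \<in> mor \<Lambda>"
  shows "path_ghost z * pth \<nu> \<approx> (\<Sum>(\<rho>, \<tau>)\<in>Lmin \<Lambda> (snd z) \<nu>. path_ghost (cmp \<Lambda> (fst z) \<rho>, \<tau>))"
proof -
  have z: "fst z \<in> mor \<Lambda>" "snd z \<in> mor \<Lambda>" "src \<Lambda> (fst z) = src \<Lambda> (snd z)"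
    using assms(1) by (auto simp: pairs_def)
  have "path_ghost z * pth \<nu> = pth (fst z) * (gst (snd z) * pth \<nu>)" by (simp add: path_ghost_def mult.assoc)
  also have "\<dots> \<approx> pth (fst z) * (\<Sum>(\<rho>, \<tau>)\<in>Lmin \<Lambda> (snd z) \<nu>. pth \<rho> * gst \<tau>)"
    using z assms(2) by (intro kp_cong_mult_left kp_ghost_path) auto
  also have "\<dots> = (\<Sum>(\<rho>, \<tau>)\<in>Lmin \<Lambda> (snd z) \<nu>. (pth (fst z) * pth \<rho>) * gst \<tau>)"
    by (simp add: sum_distrib_left mult.assoc case_prod_unfold)
  also have "\<dots> \<approx> (\<Sum>(\<rho>, \<tau>)\<in>Lmin \<Lambda> (snd z) \<nu>. path_ghost (cmp \<Lambda> (fst z) \<rho>, \<tau>))"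
  proof (intro kp_cong_sum, clarify)
    fix \<rho> \<tau> assume "(\<rho>, \<tau>) \<in> Lmin \<Lambda> (snd z) \<nu>"
    note d = LminD[OF this z(2) assms(2)]
    show "pth (fst z) * pth \<rho> * gst \<tau> \<approx> path_ghost (cmp \<Lambda> (fst z) \<rho>, \<tau>)"
      unfolding path_ghost_def fst_conv snd_conv
      using d(1-3) z by (intro kp_cong_mult_right kp_path_mult) simp_all
  qed
  finally show ?thesis .
qed

lemma kp_ghost_mult_path_ghost:
  assumes "\<alpha> \<in> mor \<Lambda>" "z \<in> pairs"
  shows "gst \<alpha> * path_ghost z \<approx> (\<Sum>(\<rho>, \<tau>)\<in>Lmin \<Lambda> \<alpha> (fst z). path_ghost (\<rho>, cmp \<Lambda> (snd z) \<tau>))"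
proof -
  have z: "fst z \<in> mor \<Lambda>" "snd z \<in> mor \<Lambda>" "src \<Lambda> (fst z) = src \<Lambda> (snd z)"
    using assms(2) by (auto simp: pairs_def)
  have "gst \<alpha> * path_ghost z = (gst \<alpha> * pth (fst z)) * gst (snd z)" by (simp add: path_ghost_def mult.assoc)
  also have "\<dots> \<approx> (\<Sum>(\<rho>, \<tau>)\<in>Lmin \<Lambda> \<alpha> (fst z). pth \<rho> * gst \<tau>) * gst (snd z)"
    using z assms(1) by (intro kp_cong_mult_right kp_ghost_path) auto
  also have "\<dots> = (\<Sum>(\<rho>, \<tau>)\<in>Lmin \<Lambda> \<alpha> (fst z). pth \<rho> * (gst \<tau> * gst (snd z)))"
    by (simp add: sum_distrib_right mult.assoc case_prod_unfold)
  also have "\<dots> \<approx> (\<Sum>(\<rho>, \<tau>)\<in>Lmin \<Lambda> \<alpha> (fst z). path_ghost (\<rho>, cmp \<Lambda> (snd z) \<tau>))"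
  proof (intro kp_cong_sum, clarify)
    fix \<rho> \<tau> assume "(\<rho>, \<tau>) \<in> Lmin \<Lambda> \<alpha> (fst z)"
    note d = LminD[OF this assms(1) z(1)]
    show "pth \<rho> * (gst \<tau> * gst (snd z)) \<approx> path_ghost (\<rho>, cmp \<Lambda> (snd z) \<tau>)"
      unfolding path_ghost_def fst_conv snd_conv
      using d(1-4) z by (intro kp_cong_mult_left kp_ghost_mult) simp_all
  qed
  finally show ?thesis .
qed

text \<open>A path letter composes with the path of each term or gives zero; a ghost letter is moved
  past that path by (KP3).\<close>

lemma mspan_gen_mult:
  assumes "g \<in> symbols \<Lambda>" "p \<in> mspan pairs" shows "gen g * p \<in> mspan pairs"
proof -
  obtain A c where A: "finite A" "A \<subseteq> pairs" "p \<approx> (\<Sum>z\<in>A. free_scale (c z) (path_ghost z))"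
    using assms by (auto simp: mspan_def)
  have "gen g * p \<approx> gen g * (\<Sum>z\<in>A. free_scale (c z) (path_ghost z))"
    using A(3) assms(1) by (intro kp_cong_mult_left free_algebra_gen)
  also have "\<dots> = (\<Sum>z\<in>A. free_scale (c z) (gen g * path_ghost z))"
    by (simp add: sum_distrib_left free_scale_mult_right)
  finally have 1: "gen g * p \<approx> (\<Sum>z\<in>A. free_scale (c z) (gen g * path_ghost z))" .
  have "gen g * path_ghost z \<in> mspan pairs" if z: "z \<in> pairs" for z
  proof (cases g)
    case (Path \<alpha>)
    hence \<alpha>: "\<alpha> \<in> mor \<Lambda>" using assms(1) by (auto simp: symbols_def)
    have "src \<Lambda> \<alpha> = rng \<Lambda> (fst z) \<Longrightarrow> (cmp \<Lambda> \<alpha> (fst z), snd z) \<in> pairs"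
      using z \<alpha> by (auto simp: pairs_def cmp_mor src_cmp)
    with kp_path_mult_path_ghost[OF \<alpha> z] show ?thesis unfolding Path
      by (auto intro: mspan_cong mspan_zero mspan_path_ghost split: if_splits)
  next
    case (Ghost \<alpha>)
    hence \<alpha>: "\<alpha> \<in> mor \<Lambda>" and g: "gen g = gst \<alpha>"
      using assms(1) by (auto simp: symbols_def star_def)
    have "(\<rho>, cmp \<Lambda> (snd z) \<tau>) \<in> pairs" if "(\<rho>, \<tau>) \<in> Lmin \<Lambda> \<alpha> (fst z)" for \<rho> \<tau>
      using LminD[OF that \<alpha>] z by (auto simp: pairs_def cmp_mor src_cmp)
    with kp_ghost_mult_path_ghost[OF \<alpha> z] show ?thesis unfolding g
      by (auto intro!: mspan_cong[OF kp_ghost_mult_path_ghost[OF \<alpha> z]] mspan_sum mspan_path_ghost)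
  qed
  with A show ?thesis by (intro mspan_cong[OF 1] mspan_sum mspan_scale) auto
qed

text \<open>A single letter is congruent to its product with the vertex at its source, which has the
  form of a path times a ghost. Longer words arise by prepending letters, and arbitrary elements are
  combinations of words.\<close>

lemma free_algebra_mspan:
  assumes "p \<in> free_algebra \<Lambda>"
  shows "(p :: ('e, 'r::{comm_ring,comm_monoid_mult}) pre_kp) \<in> mspan pairs"
proof -
  have word: "Poly_Mapping.single (Word gs) (1::'r) \<in> mspan pairs"
    if "gs \<noteq> []" "set gs \<subseteq> symbols \<Lambda>" for gs
    using that
  proof (induction gs rule: list_nonempty_induct)
    case (single g)
    show ?case
    proof (cases g)
      case (Path \<alpha>)
      hence \<alpha>: "\<alpha> \<in> mor \<Lambda>" using single by (auto simp: symbols_def)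
      have "gen g \<approx> (path_ghost (\<alpha>, src \<Lambda> \<alpha>) :: ('e, 'r) pre_kp)"
        using kp_cong_sym[OF kp_path_src[OF \<alpha>]] by (simp add: path_ghost_def Path gst_vert[OF src_verts[OF \<alpha>]])
      moreover have "(\<alpha>, src \<Lambda> \<alpha>) \<in> pairs" using \<alpha> by (simp add: pairs_def src_mor src_src)
      ultimately have "(gen g :: ('e, 'r) pre_kp) \<in> mspan pairs" by (blast intro: mspan_cong mspan_path_ghost)
      thus ?thesis by (simp add: gen_def)
    next
      case (Ghost \<alpha>)
      hence \<alpha>: "\<alpha> \<in> mor \<Lambda>" and g: "(gen g :: ('e, 'r) pre_kp) = gst \<alpha>"
        using single by (auto simp: symbols_def star_def)
      have "gen g \<approx> (path_ghost (src \<Lambda> \<alpha>, \<alpha>) :: ('e, 'r) pre_kp)"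
        using kp_cong_sym[OF kp_ghost_src[OF \<alpha>]] by (simp add: path_ghost_def g)
      moreover have "(src \<Lambda> \<alpha>, \<alpha>) \<in> pairs" using \<alpha> by (simp add: pairs_def src_mor src_src)
      ultimately have "(gen g :: ('e, 'r) pre_kp) \<in> mspan pairs" by (blast intro: mspan_cong mspan_path_ghost)
      thus ?thesis by (simp add: gen_def)
    qed
  next
    case (cons g gs)
    have "Poly_Mapping.single (Word (g # gs)) (1::'r) = gen g * Poly_Mapping.single (Word gs) 1"
      by (simp add: gen_def mult_single plus_word_def)
    thus ?case using cons mspan_gen_mult[of g "Poly_Mapping.single (Word gs) 1"] by simp
  qed
  have "Poly_Mapping.single w (Poly_Mapping.lookup p w) \<in> mspan pairs"
    if "w \<in> Poly_Mapping.keys p" for w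
  proof -
    have "Poly_Mapping.single w (Poly_Mapping.lookup p w) =
        free_scale (Poly_Mapping.lookup p w) (Poly_Mapping.single (Word (letters w)) 1)"
      by (simp add: free_scale_eq mult_single)
    moreover have "Poly_Mapping.single (Word (letters w)) (1::'r) \<in> mspan pairs"
      using that assms by (intro word) (auto simp: free_algebra_def)
    ultimately show ?thesis by (simp only: mspan_scale)
  qed
  hence "(\<Sum>w \<in> Poly_Mapping.keys p. Poly_Mapping.single w (Poly_Mapping.lookup p w)) \<in> mspan pairs"
    by (rule mspan_sum)
  thus ?thesis by (simp add: sum_monomials)
qed

end


section \<open>Compression to a vertex\<close>

context kgraph
begin

section \<open>Range projections and products of gap projections\<close>

text \<open>Either product is the sum of \<open>path_ghost (\<sigma>, \<sigma>)\<close> over the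
  minimal common extensions \<sigma> = \<alpha>\<rho> = \<mu>\<tau>, an expression symmetric in
  \<alpha> and \<mu>.\<close>

lemma kp_range_projections_commute:
  assumes "\<alpha> \<in> mor \<Lambda>" "\<mu> \<in> mor \<Lambda>"
  shows "(pth \<alpha> * gst \<alpha>) * (pth \<mu> * gst \<mu>) \<approx>
    (pth \<mu> * gst \<mu>) * (pth \<alpha> * gst \<alpha> :: ('e, 'r::{comm_ring,comm_monoid_mult}) pre_kp)"
proof -
  let ?s = "\<lambda>\<alpha> \<mu>. (\<Sum>(\<rho>, \<tau>)\<in>Lmin \<Lambda> \<alpha> \<mu>. path_ghost (cmp \<Lambda> \<alpha> \<rho>, cmp \<Lambda> \<mu> \<tau>)) :: ('e, 'r) pre_kp"
  have "(pth \<alpha> * gst \<alpha>) * (pth \<mu> * gst \<mu>) \<approx> ?s \<alpha> \<mu>" if "\<alpha> \<in> mor \<Lambda>" "\<mu> \<in> mor \<Lambda>" for \<alpha> \<mu>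
  proof -
    have p: "(\<mu>, \<mu>) \<in> pairs" using that by (simp add: pairs_def)
    have "(pth \<alpha> * gst \<alpha>) * (pth \<mu> * gst \<mu>) = pth \<alpha> * (gst \<alpha> * path_ghost (\<mu>, \<mu>))"
      by (simp add: path_ghost_def mult.assoc)
    also have "\<dots> \<approx> pth \<alpha> * (\<Sum>(\<rho>, \<tau>)\<in>Lmin \<Lambda> \<alpha> \<mu>. path_ghost (\<rho>, cmp \<Lambda> \<mu> \<tau>))"
      using kp_cong_mult_left[OF kp_ghost_mult_path_ghost[OF that(1) p] pth_free_algebra[OF that(1)]]
      by simp
    also have "\<dots> = (\<Sum>(\<rho>, \<tau>)\<in>Lmin \<Lambda> \<alpha> \<mu>. pth \<alpha> * path_ghost (\<rho>, cmp \<Lambda> \<mu> \<tau>))"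
      by (simp add: sum_distrib_left case_prod_unfold)
    also have "\<dots> \<approx> ?s \<alpha> \<mu>"
    proof (intro kp_cong_sum, clarify)
      fix \<rho> \<tau> assume "(\<rho>, \<tau>) \<in> Lmin \<Lambda> \<alpha> \<mu>"
      note d = LminD[OF this that]
      have "(\<rho>, cmp \<Lambda> \<mu> \<tau>) \<in> pairs" using d that by (simp add: pairs_def cmp_mor src_cmp)
      from kp_path_mult_path_ghost[OF that(1) this] d(3)
      show "pth \<alpha> * path_ghost (\<rho>, cmp \<Lambda> \<mu> \<tau>) \<approx> path_ghost (cmp \<Lambda> \<alpha> \<rho>, cmp \<Lambda> \<mu> \<tau>)" by simp
    qed
    finally show ?thesis .
  qed
  note * = this
  have "?s \<alpha> \<mu> = ?s \<mu> \<alpha>"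
  proof (rule sum.reindex_bij_witness[where i=prod.swap and j=prod.swap], goal_cases)
    case (5 z)
    obtain \<rho> \<tau> where z: "z = (\<rho>, \<tau>)" by (cases z)
    from LminD(5)[of \<rho> \<tau> \<alpha> \<mu>] 5 assms show ?case by (simp add: z)
  qed (auto simp: Lmin_swap)
  with *[OF assms(2,1)] have "(pth \<mu> * gst \<mu>) * (pth \<alpha> * gst \<alpha>) \<approx> ?s \<alpha> \<mu>" by simp
  from kp_cong_trans[OF *[OF assms] kp_cong_sym[OF this]] show ?thesis .
qed

lemma kp_cong_absorb_list_product:
  "as \<noteq> [] \<Longrightarrow> p \<in> free_algebra \<Lambda> \<Longrightarrow> set as \<subseteq> free_algebra \<Lambda> \<Longrightarrow> (\<And>a. a \<in> set as \<Longrightarrow> p * a \<approx> p) \<Longrightarrow>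
    p * list_product as \<approx> p"
proof (induction as rule: list_product.induct)
  case (3 a b as)
  have "p * list_product (a # b # as) = (p * a) * list_product (b # as)" by (simp add: mult.assoc)
  also have "\<dots> \<approx> p * list_product (b # as)"
    using 3 by (intro kp_cong_mult_right free_algebra_list_product) auto
  also have "\<dots> \<approx> p" using 3 by auto
  finally show ?case .
qed auto

text \<open>Commutation moves \<open>e\<close> to the right until it meets the factor
  \<open>a\<close> that it annihilates.\<close>

lemma kp_cong_annihilate_list_product:
  "e \<in> free_algebra \<Lambda> \<Longrightarrow> set as \<subseteq> free_algebra \<Lambda> \<Longrightarrow> (\<And>a. a \<in> set as \<Longrightarrow> e * a \<approx> a * e) \<Longrightarrow>
    a \<in> set as \<Longrightarrow> e * a \<approx> 0 \<Longrightarrow> e * list_product as \<approx> 0"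
proof (induction as rule: list_product.induct)
  case (3 b c as)
  let ?l = "list_product (c # as)"
  have l: "?l \<in> free_algebra \<Lambda>" and b: "b \<in> free_algebra \<Lambda>"
    using 3 by (auto intro!: free_algebra_list_product)
  show ?case
  proof (cases "a = b")
    case True
    have "e * list_product (b # c # as) = (e * b) * ?l" by (simp add: mult.assoc)
    also have "\<dots> \<approx> 0 * ?l" using 3 True l by (intro kp_cong_mult_right) auto
    finally show ?thesis by simp
  next
    case False
    have "e * list_product (b # c # as) = (e * b) * ?l" by (simp add: mult.assoc)
    also have "\<dots> \<approx> (b * e) * ?l" using 3 l by (intro kp_cong_mult_right) auto
    also have "\<dots> = b * (e * ?l)" by (simp add: mult.assoc)
    also have "\<dots> \<approx> b * 0" using 3 False b by (intro kp_cong_mult_left) auto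
    finally show ?thesis by simp
  qed
qed auto

lemma kp_gap_projection_closed:
  "v \<in> verts \<Lambda> \<Longrightarrow> \<alpha> \<in> mor \<Lambda> \<Longrightarrow> pth v - pth \<alpha> * gst \<alpha> \<in> free_algebra \<Lambda>"
  by (simp add: free_algebra_diff free_algebra_mult verts_mor)

text \<open>\<open>gst \<mu>\<close> absorbs the range projection
  \<open>pth \<mu> * gst \<mu>\<close> on its right. That projection commutes with every factor and
  is orthogonal to the factor \<open>pth v - pth \<mu> * gst \<mu>\<close>.\<close>

lemma kp_ghost_annihilates_gaps:
  assumes v: "v \<in> verts \<Lambda>" and es: "\<And>\<alpha>. \<alpha> \<in> set es \<Longrightarrow> \<alpha> \<in> mor \<Lambda> \<and> rng \<Lambda> \<alpha> = v"
    and \<mu>: "\<mu> \<in> set es"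
  defines "as \<equiv> pth v # map (\<lambda>\<alpha>. pth v - pth \<alpha> * gst \<alpha>) es"
  shows "gst \<mu> * list_product as \<approx> 0"
proof -
  let ?e = "\<lambda>\<alpha>. pth \<alpha> * gst \<alpha>"
  have m: "\<mu> \<in> mor \<Lambda>" "rng \<Lambda> \<mu> = v" using es \<mu> by auto
  have F: "?e \<alpha> \<in> free_algebra \<Lambda>" if "\<alpha> \<in> mor \<Lambda>" for \<alpha>
    using that by (intro free_algebra_mult) auto
  have as: "set as \<subseteq> free_algebra \<Lambda>"
    using es v by (auto simp: as_def verts_mor intro!: kp_gap_projection_closed)
  have r: "?e \<mu> * pth v \<approx> ?e \<mu>"
    using kp_cong_mult_left[OF kp_ghost_rng[OF m(1)] pth_free_algebra[OF m(1)]] m(2)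
    by (simp add: mult.assoc)
  have l: "pth v * ?e \<mu> \<approx> ?e \<mu>"
    using kp_cong_mult_right[OF kp_path_rng[OF m(1)] gst_free_algebra[OF m(1)]] m(2)
    by (simp add: mult.assoc)
  have c: "?e \<mu> * pth v \<approx> pth v * ?e \<mu>" by (rule kp_cong_trans[OF r kp_cong_sym[OF l]])
  have g: "gst \<mu> * ?e \<mu> \<approx> gst \<mu>"
  proof -
    have "gst \<mu> * ?e \<mu> = (gst \<mu> * pth \<mu>) * gst \<mu>" by (simp add: mult.assoc)
    also have "\<dots> \<approx> pth (src \<Lambda> \<mu>) * gst \<mu>"
      using m by (intro kp_cong_mult_right kp_ghost_path_self) auto
    also have "\<dots> \<approx> gst \<mu>" using m(1) by (rule kp_ghost_src)
    finally show ?thesis .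
  qed
  have "?e \<mu> * ?e \<mu> \<approx> ?e \<mu>"
    using kp_cong_mult_left[OF g pth_free_algebra[OF m(1)]] by (simp add: mult.assoc)
  from kp_cong_diff[OF r this] have z: "?e \<mu> * (pth v - ?e \<mu>) \<approx> 0"
    by (simp add: right_diff_distrib)
  have "?e \<mu> * a \<approx> a * ?e \<mu>" if "a \<in> set as" for a
  proof -
    have "?e \<mu> * (pth v - ?e \<alpha>) \<approx> (pth v - ?e \<alpha>) * ?e \<mu>" if "\<alpha> \<in> set es" for \<alpha>
      using kp_cong_diff[OF c kp_range_projections_commute[OF m(1), of \<alpha>]] es that
      by (simp add: right_diff_distrib left_diff_distrib)
    with that c show ?thesis by (auto simp: as_def)
  qed
  moreover have "pth v - ?e \<mu> \<in> set as" using \<mu> by (simp add: as_def)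
  ultimately have e0: "?e \<mu> * list_product as \<approx> 0"
    using kp_cong_annihilate_list_product[OF F[OF m(1)] as] z by blast
  have L: "list_product as \<in> free_algebra \<Lambda>" using as by (rule free_algebra_list_product)
  have "gst \<mu> * list_product as \<approx> gst \<mu> * ?e \<mu> * list_product as"
    by (rule kp_cong_mult_right[OF kp_cong_sym[OF g] L])
  also have "\<dots> = gst \<mu> * (?e \<mu> * list_product as)" by (simp add: mult.assoc)
  also have "\<dots> \<approx> gst \<mu> * 0" using e0 gst_free_algebra[OF m(1)] by (rule kp_cong_mult_left)
  finally show ?thesis by simp
qed

section \<open>Elimination of ghosts\<close>

text \<open>The sum of the coordinates of \<open>N\<close> is the measure of the induction that
  eliminates ghosts.\<close>

definition bounded_pairs :: "'e \<Rightarrow> ('k \<Rightarrow> nat) \<Rightarrow> ('e \<times> 'e) set" where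
  "bounded_pairs v N = {(\<alpha>, \<mu>) \<in> pairs. rng \<Lambda> \<mu> = v \<and> deg \<Lambda> \<mu> \<le> N}"

lemma bounded_pairs_subset: "bounded_pairs v N \<subseteq> pairs"
  by (auto simp: bounded_pairs_def)

text \<open>A ghost \<mu> of degree at most \<open>N\<close> becomes ghosts of degree \<open>sup
  (deg \<Lambda> \<mu>) (deg \<Lambda> \<nu>) - deg \<Lambda> \<nu>\<close>. In each coordinate this
  is zero or \<open>deg \<Lambda> \<mu> - deg \<Lambda> \<nu>\<close>, hence at most the truncated
  difference \<open>N - deg \<Lambda> \<nu>\<close>.\<close>

lemma mspan_bounded_mult_path:
  assumes p: "p \<in> mspan (bounded_pairs v N)" and \<nu>: "\<nu> \<in> mor \<Lambda>"
  shows "p * pth \<nu> \<in> mspan (bounded_pairs (src \<Lambda> \<nu>) (N - deg \<Lambda> \<nu>))"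
proof -
  obtain A c where A: "finite A" "A \<subseteq> bounded_pairs v N"
    "p \<approx> (\<Sum>z\<in>A. free_scale (c z) (path_ghost z))"
    using p by (auto simp: mspan_def)
  have 1: "p * pth \<nu> \<approx> (\<Sum>z\<in>A. free_scale (c z) (path_ghost z * pth \<nu>))"
    using kp_cong_mult_right[OF A(3) pth_free_algebra[OF \<nu>]]
    by (simp add: sum_distrib_right free_scale_mult_left)
  have "path_ghost z * pth \<nu> \<in> mspan (bounded_pairs (src \<Lambda> \<nu>) (N - deg \<Lambda> \<nu>))" if "z \<in> A" for z
  proof -
    have z: "z \<in> pairs" "fst z \<in> mor \<Lambda>" "snd z \<in> mor \<Lambda>" "src \<Lambda> (fst z) = src \<Lambda> (snd z)" "deg \<Lambda> (snd z) \<le> N"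
      using A(2) that by (auto simp: bounded_pairs_def pairs_def)
    show ?thesis
    proof (rule mspan_cong[OF kp_path_ghost_mult_path[OF z(1) \<nu>]], rule mspan_sum, clarify)
      fix \<rho> \<tau> assume "(\<rho>, \<tau>) \<in> Lmin \<Lambda> (snd z) \<nu>"
      note d = LminD[OF this z(3) \<nu>]
      have "deg \<Lambda> \<tau> \<le> N - deg \<Lambda> \<nu>"
        using z(5) by (auto simp: d(8) le_fun_def sup_fun_def sup_nat_def max_def diff_le_mono)
      hence "(cmp \<Lambda> (fst z) \<rho>, \<tau>) \<in> bounded_pairs (src \<Lambda> \<nu>) (N - deg \<Lambda> \<nu>)"
        using d(1-6) z by (simp add: bounded_pairs_def pairs_def cmp_mor src_cmp)
      thus "path_ghost (cmp \<Lambda> (fst z) \<rho>, \<tau>) \<in> mspan (bounded_pairs (src \<Lambda> \<nu>) (N - deg \<Lambda> \<nu>))"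
        using bounded_pairs_subset by (rule mspan_path_ghost)
    qed
  qed
  thus ?thesis by (intro mspan_cong[OF 1] mspan_sum mspan_scale)
qed

text \<open>The case where multiplying \<open>p\<close> by any ghost path that occurs, other than
  \<open>v\<close>, gives zero. Then right multiplication by the product of the gap projections over
  \<open>E\<close> fixes \<open>p\<close>. If \<open>E\<close> were exhaustive, or all coefficients
  at the ghost \<open>v\<close> were zero, that product would annihilate \<open>p\<close>.\<close>

lemma nonzero_path_combination_base:
  fixes p :: "('e, 'r::{comm_ring,comm_monoid_mult}) pre_kp"
  assumes v: "v \<in> verts \<Lambda>" and p: "p \<notin> kp_ideal \<Lambda>"
    and A: "finite A" "A \<subseteq> bounded_pairs v N" "p \<approx> (\<Sum>z\<in>A. free_scale (c z) (path_ghost z))"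
    and z0: "\<And>\<mu>. \<mu> \<in> snd ` A - {v} \<Longrightarrow> p * pth \<mu> \<approx> 0"
  shows "\<exists>\<nu> L d. \<nu> \<in> mor \<Lambda> \<and> rng \<Lambda> \<nu> = v \<and> finite L \<and> L \<noteq> {} \<and>
    (\<forall>\<alpha> \<in> L. \<alpha> \<in> mor \<Lambda> \<and> src \<Lambda> \<alpha> = src \<Lambda> \<nu> \<and> d \<alpha> \<noteq> 0) \<and>
    p * pth \<nu> \<approx> (\<Sum>\<alpha>\<in>L. free_scale (d \<alpha>) (pth \<alpha>))"
proof -
  define E where "E = snd ` A - {v}"
  have E: "\<mu> \<in> mor \<Lambda>" "rng \<Lambda> \<mu> = v" "p * pth \<mu> \<approx> 0" if "\<mu> \<in> E" for \<mu>
    using that A(2) z0 by (auto simp: E_def bounded_pairs_def pairs_def)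
  have finE: "finite E" using A(1) by (simp add: E_def)
  then obtain es where es: "set es = E" "distinct es" using finite_distinct_list by blast
  have F: "p \<in> free_algebra \<Lambda>" using A(3) by (rule kp_congD)
  have Az: "z \<in> pairs" "fst z \<in> mor \<Lambda>" "snd z \<in> mor \<Lambda>" "src \<Lambda> (fst z) = src \<Lambda> (snd z)"
    "rng \<Lambda> (snd z) = v" if "z \<in> A" for z
    using that A(2) by (auto simp: bounded_pairs_def pairs_def)
  have v_mor: "v \<in> mor \<Lambda>" using v by (rule verts_mor)
  have right: "p * q \<approx> (\<Sum>z\<in>A. free_scale (c z) (path_ghost z * q))"
    if "q \<in> free_algebra \<Lambda>" for q
    using kp_cong_mult_right[OF A(3) that] by (simp add: sum_distrib_right free_scale_mult_left)
  have pv: "p * pth v \<approx> p"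
  proof -
    have "p * pth v \<approx> (\<Sum>z\<in>A. free_scale (c z) (path_ghost z * pth v))"
      using v_mor by (intro right) simp
    also have "\<dots> \<approx> (\<Sum>z\<in>A. free_scale (c z) (path_ghost z))"
    proof (intro kp_cong_sum kp_cong_scale)
      fix z assume "z \<in> A"
      note z = Az[OF this]
      show "path_ghost z * pth v \<approx> path_ghost z"
        using kp_cong_mult_left[OF kp_ghost_rng[OF z(3)] pth_free_algebra[OF z(2)]] z(5)
        by (simp add: path_ghost_def mult.assoc)
    qed
    also have "\<dots> \<approx> p" by (rule kp_cong_sym[OF A(3)])
    finally show ?thesis .
  qed
  \<comment> \<open>The leading \<open>pth v\<close> keeps the list nonempty when \<open>E\<close>
    is empty; the value \<open>list_product [] = 0\<close> would be wrong here.\<close>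
  define as :: "('e, 'r) pre_kp list" where "as = pth v # map (\<lambda>\<alpha>. pth v - pth \<alpha> * gst \<alpha>) es"
  have as: "set as \<subseteq> free_algebra \<Lambda>"
    using es E v v_mor by (auto simp: as_def intro!: kp_gap_projection_closed)
  have L: "list_product as \<in> free_algebra \<Lambda>" using as by (rule free_algebra_list_product)
  have "p * a \<approx> p" if "a \<in> set as" for a
  proof -
    have "p * (pth v - pth \<alpha> * gst \<alpha>) \<approx> p" if "\<alpha> \<in> E" for \<alpha>
      using kp_cong_diff[OF pv kp_cong_mult_right[OF E(3) gst_free_algebra[OF E(1)], OF that that]]
      by (simp add: right_diff_distrib mult.assoc)
    with that pv show ?thesis by (auto simp: as_def es)
  qed
  hence prod: "p * list_product as \<approx> p"
    by (intro kp_cong_absorb_list_product F as) (auto simp: as_def)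
  have "\<not> exhaustive \<Lambda> v E"
  proof
    assume ex: "exhaustive \<Lambda> v E"
    hence "E \<in> FE \<Lambda> v" using v finE by (auto simp: FE_def E_def)
    from kp_exhaustive[OF v this es(2,1)]
    have 0: "list_product (map (\<lambda>\<alpha>. pth v - pth \<alpha> * gst \<alpha>) es) \<approx> 0" .
    \<comment> \<open>Exhaustiveness at the path \<open>v\<close> itself requires a member of
      \<open>E\<close>. Hence the leading \<open>pth v\<close> can be split off as a factor, leaving
      the product of (KP4).\<close>
    have "es \<noteq> []" using ex v_mor verts_rng[OF v] es(1) by (auto simp: exhaustive_def)
    hence "list_product as = pth v * list_product (map (\<lambda>\<alpha>. pth v - pth \<alpha> * gst \<alpha>) es)"
      by (cases es) (auto simp: as_def)
    also have "\<dots> \<approx> pth v * 0" using 0 v_mor by (intro kp_cong_mult_left) simp_all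
    finally have "p * list_product as \<approx> p * 0" using F by (intro kp_cong_mult_left) simp_all
    from kp_cong_trans[OF kp_cong_sym[OF prod] this] have "p \<approx> 0" by simp
    with p show False by (simp add: kp_cong_zero_iff)
  qed
  then obtain \<nu> where \<nu>: "\<nu> \<in> mor \<Lambda>" "rng \<Lambda> \<nu> = v" and disj: "\<And>\<mu>. \<mu> \<in> E \<Longrightarrow> Lmin \<Lambda> \<mu> \<nu> = {}"
    using E Lmin_empty_commute unfolding exhaustive_def by blast
  define B where "B = {z \<in> A. snd z = v \<and> c z \<noteq> 0}"
  have B: "finite B" "B \<subseteq> A" using A(1) by (auto simp: B_def)
  have "B \<noteq> {}"
  proof
    assume empty: "B = {}"
    have "p * list_product as \<approx> (\<Sum>z\<in>A. free_scale (c z) (path_ghost z * list_product as))"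
      using L by (rule right)
    also have "\<dots> \<approx> (\<Sum>z\<in>A. 0)"
    proof (rule kp_cong_sum)
      fix z assume zA: "z \<in> A"
      note z = Az[OF this]
      show "free_scale (c z) (path_ghost z * list_product as) \<approx> 0"
      proof (cases "snd z = v")
        case True
        hence "c z = 0" using empty zA unfolding B_def by blast
        thus ?thesis by (simp add: free_scale_zero_left kp_cong_refl free_algebra_zero)
      next
        case False
        hence "snd z \<in> set es" using zA es by (auto simp: E_def)
        hence "gst (snd z) * list_product as \<approx> 0"
          unfolding as_def using es E by (intro kp_ghost_annihilates_gaps v) auto
        from kp_cong_scale[OF kp_cong_mult_left[OF this pth_free_algebra[OF z(2)]], of "c z"]
        show ?thesis by (simp add: path_ghost_def mult.assoc free_scale_zero_right)
      qed
    qed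
    finally have "p * list_product as \<approx> 0" by simp
    hence "p \<approx> 0" by (rule kp_cong_trans[OF kp_cong_sym[OF prod]])
    with p show False by (simp add: kp_cong_zero_iff)
  qed
  \<comment> \<open>Multiplication by \<nu> turns the terms of \<open>B\<close> into paths. By right
    cancellation \<open>h\<close> is injective on \<open>B\<close>, so no coefficients merge or
    cancel and \<open>d\<close> can be read off through the inverse.\<close>
  define h where "h z = cmp \<Lambda> (fst z) \<nu>" for z :: "'e \<times> 'e"
  have Bz: "fst z \<in> mor \<Lambda>" "src \<Lambda> (fst z) = v" "snd z = v" "c z \<noteq> 0" if "z \<in> B" for z
    using that Az[of z] verts_src[OF v] by (auto simp: B_def)
  have inj: "inj_on h B"
  proof (rule inj_onI)
    fix y z assume "y \<in> B" "z \<in> B" "h y = h z"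
    thus "y = z" using Bz[of y] Bz[of z] \<nu> cmp_right_cancel[of "fst y" "fst z" \<nu>]
      by (auto simp: h_def prod_eq_iff)
  qed
  define d where "d \<alpha> = c (the_inv_into B h \<alpha>)" for \<alpha>
  have d: "d (h z) = c z" if "z \<in> B" for z
    using that inj by (simp add: d_def the_inv_into_f_f)
  have "p * pth \<nu> \<approx> (\<Sum>z\<in>A. free_scale (c z) (path_ghost z * pth \<nu>))"
    using \<nu> by (intro right) simp
  also have "\<dots> \<approx> (\<Sum>z\<in>A. if z \<in> B then free_scale (c z) (pth (h z)) else 0)"
  proof (rule kp_cong_sum)
    fix z assume zA: "z \<in> A"
    note z = Az[OF this]
    \<comment> \<open>Terms outside \<open>B\<close> have coefficient zero or a ghost in
      \<open>E\<close>. In the latter case the ghost has no common extension with \<nu>, so (KP3)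
      makes the term vanish.\<close>
    consider "z \<in> B" | "c z = 0" | "snd z \<in> E" using zA by (auto simp: B_def E_def)
    thus "free_scale (c z) (path_ghost z * pth \<nu>) \<approx> (if z \<in> B then free_scale (c z) (pth (h z)) else 0)"
    proof cases
      case 1
      note b = Bz[OF 1]
      have "path_ghost z * pth \<nu> = pth (fst z) * (pth v * pth \<nu>)"
        using b(3) by (simp add: path_ghost_def mult.assoc gst_vert[OF v])
      also have "\<dots> \<approx> pth (fst z) * pth \<nu>"
        using kp_path_rng[OF \<nu>(1)] \<nu>(2) b by (intro kp_cong_mult_left) auto
      also have "\<dots> \<approx> pth (h z)"
        unfolding h_def using b \<nu> by (intro kp_path_mult) auto
      finally have "path_ghost z * pth \<nu> \<approx> pth (h z)" .
      from kp_cong_scale[OF this, of "c z"] 1 show ?thesis by simp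
    next
      case 2
      thus ?thesis by (auto simp: B_def free_scale_zero_left kp_cong_refl free_algebra_zero)
    next
      case 3
      hence "z \<notin> B" by (auto simp: B_def E_def)
      moreover have "gst (snd z) * pth \<nu> \<approx> 0"
        using disj[OF 3] z \<nu> by (intro kp_ghost_path_disjoint)
      from kp_cong_scale[OF kp_cong_mult_left[OF this pth_free_algebra[OF z(2)]], of "c z"]
      have "free_scale (c z) (path_ghost z * pth \<nu>) \<approx> 0"
        by (simp add: path_ghost_def mult.assoc free_scale_zero_right)
      ultimately show ?thesis by simp
    qed
  qed
  also have "\<dots> = (\<Sum>z\<in>B. free_scale (c z) (pth (h z)))"
    using A(1) B by (simp add: sum.If_cases Int_absorb1)
  also have "\<dots> = (\<Sum>\<alpha>\<in>h ` B. free_scale (d \<alpha>) (pth \<alpha>))"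
    using d by (simp add: sum.reindex[OF inj])
  finally have "p * pth \<nu> \<approx> (\<Sum>\<alpha>\<in>h ` B. free_scale (d \<alpha>) (pth \<alpha>))" .
  moreover have "\<alpha> \<in> mor \<Lambda> \<and> src \<Lambda> \<alpha> = src \<Lambda> \<nu> \<and> d \<alpha> \<noteq> 0" if "\<alpha> \<in> h ` B" for \<alpha>
    using that d Bz \<nu> by (auto simp: h_def cmp_mor src_cmp)
  moreover have "finite (h ` B)" "h ` B \<noteq> {}" using B \<open>B \<noteq> {}\<close> by auto
  ultimately show ?thesis using \<nu> by blast
qed

text \<open>If some occurring \<mu> other than \<open>v\<close> keeps the product with
  \<open>p\<close> nonzero, the induction hypothesis applies to that product with bound
  \<open>N - deg \<Lambda> \<mu>\<close>, and the path it yields is prefixed with \<mu>. Otherwise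
  the base case applies.\<close>

lemma nonzero_path_combination_bounded:
  "p \<in> mspan (bounded_pairs v N) \<Longrightarrow> v \<in> verts \<Lambda> \<Longrightarrow> p \<notin> kp_ideal \<Lambda> \<Longrightarrow>
    \<exists>\<nu> L d. \<nu> \<in> mor \<Lambda> \<and> rng \<Lambda> \<nu> = v \<and> finite L \<and> L \<noteq> {} \<and>
      (\<forall>\<alpha> \<in> L. \<alpha> \<in> mor \<Lambda> \<and> src \<Lambda> \<alpha> = src \<Lambda> \<nu> \<and> d \<alpha> \<noteq> 0) \<and>
      p * pth \<nu> \<approx> (\<Sum>\<alpha>\<in>L. free_scale (d \<alpha>) (pth \<alpha>))"
proof (induction "\<Sum>i\<in>UNIV. N i" arbitrary: v N p rule: less_induct)
  case less
  obtain A c where A: "finite A" "A \<subseteq> bounded_pairs v N"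
    "p \<approx> (\<Sum>z\<in>A. free_scale (c z) (path_ghost z))"
    using less.prems(1) by (auto simp: mspan_def)
  have F: "p \<in> free_algebra \<Lambda>" using A(3) by (rule kp_congD)
  show ?case
  proof (cases "\<exists>\<mu> \<in> snd ` A - {v}. p * pth \<mu> \<notin> kp_ideal \<Lambda>")
    case False
    thus ?thesis
      using nonzero_path_combination_base[OF less.prems(2,3) A] by (auto simp: kp_cong_zero_iff)
  next
    case True
    then obtain \<mu> where *: "\<mu> \<in> snd ` A - {v}" and ni: "p * pth \<mu> \<notin> kp_ideal \<Lambda>" by blast
    have "\<mu> \<in> mor \<Lambda>" "rng \<Lambda> \<mu> = v" "deg \<Lambda> \<mu> \<le> N" "\<mu> \<noteq> v"
      using A(2) * by (auto simp: bounded_pairs_def pairs_def)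
    note \<mu> = this ni
    \<comment> \<open>A vertex with range \<open>v\<close> is \<open>v\<close> itself, so \<mu> has
      positive degree in some direction; as \<open>deg \<Lambda> \<mu> \<le> N\<close>, subtracting
      it strictly lowers the measure.\<close>
    have "\<mu> \<notin> verts \<Lambda>" using \<mu> verts_rng by auto
    hence "deg \<Lambda> \<mu> \<noteq> 0" using \<mu> by (simp add: verts_iff_deg)
    then obtain i where i: "deg \<Lambda> \<mu> i \<noteq> 0" by (auto simp: fun_eq_iff)
    have "(\<Sum>i\<in>UNIV. (N - deg \<Lambda> \<mu>) i) < (\<Sum>i\<in>UNIV. N i)"
    proof (rule sum_strict_mono_ex1)
      have "deg \<Lambda> \<mu> i \<le> N i" using \<mu>(3) by (simp add: le_fun_def)
      thus "\<exists>i\<in>UNIV. (N - deg \<Lambda> \<mu>) i < N i" using i by (intro bexI[of _ i]) auto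
    qed auto
    from less.hyps[OF this mspan_bounded_mult_path[OF less.prems(1) \<mu>(1)] src_verts[OF \<mu>(1)] \<mu>(5)]
    obtain \<nu> L d where \<nu>: "\<nu> \<in> mor \<Lambda>" "rng \<Lambda> \<nu> = src \<Lambda> \<mu>" and L: "finite L" "L \<noteq> {}"
      "\<forall>\<alpha> \<in> L. \<alpha> \<in> mor \<Lambda> \<and> src \<Lambda> \<alpha> = src \<Lambda> \<nu> \<and> d \<alpha> \<noteq> 0"
      and eq: "(p * pth \<mu>) * pth \<nu> \<approx> (\<Sum>\<alpha>\<in>L. free_scale (d \<alpha>) (pth \<alpha>))" by blast
    have s: "src \<Lambda> \<mu> = rng \<Lambda> \<nu>" using \<nu>(2) by simp
    have "p * pth (cmp \<Lambda> \<mu> \<nu>) \<approx> p * (pth \<mu> * pth \<nu>)"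
      using kp_cong_sym[OF kp_path_mult[OF \<mu>(1) \<nu>(1) s]] F by (rule kp_cong_mult_left)
    also have "\<dots> = (p * pth \<mu>) * pth \<nu>" by (simp add: mult.assoc)
    also note eq
    finally have "p * pth (cmp \<Lambda> \<mu> \<nu>) \<approx> (\<Sum>\<alpha>\<in>L. free_scale (d \<alpha>) (pth \<alpha>))" .
    moreover have "cmp \<Lambda> \<mu> \<nu> \<in> mor \<Lambda>" "rng \<Lambda> (cmp \<Lambda> \<mu> \<nu>) = v" "src \<Lambda> (cmp \<Lambda> \<mu> \<nu>) = src \<Lambda> \<nu>"
      using \<mu> \<nu> s by (simp_all add: cmp_mor rng_cmp src_cmp)
    ultimately show ?thesis
      using L by (intro exI[of _ "cmp \<Lambda> \<mu> \<nu>"] exI[of _ L] exI[of _ d]) simp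
  qed
qed

section \<open>Isolating a coefficient\<close>

text \<open>The sum of the finitely many vertices at which the ghosts of \<open>p\<close> have their
  range acts on \<open>p\<close> as a right unit. Hence \<open>p\<close> is the sum of the products
  \<open>p * pth v\<close>, and one of them is nonzero.\<close>

lemma nonzero_at_vertex:
  assumes p: "p \<in> free_algebra \<Lambda>" "p \<notin> kp_ideal \<Lambda>"
  obtains v N where "v \<in> verts \<Lambda>" "p * pth v \<notin> kp_ideal \<Lambda>" "p * pth v \<in> mspan (bounded_pairs v N)"
proof -
  obtain A c where A: "finite A" "A \<subseteq> pairs" "p \<approx> (\<Sum>z\<in>A. free_scale (c z) (path_ghost z))"
    using free_algebra_mspan[OF p(1)] by (auto simp: mspan_def)
  define V where "V = (\<lambda>z. rng \<Lambda> (snd z)) ` A"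
  have Az: "z \<in> pairs" "fst z \<in> mor \<Lambda>" "snd z \<in> mor \<Lambda>" if "z \<in> A" for z
    using that A(2) by (auto simp: pairs_def)
  have V: "finite V" "v \<in> V \<Longrightarrow> v \<in> verts \<Lambda>" for v
    using A(1) Az by (auto simp: V_def intro: rng_verts)
  have right: "p * q \<approx> (\<Sum>z\<in>A. free_scale (c z) (path_ghost z * q))"
    if "q \<in> free_algebra \<Lambda>" for q
    using kp_cong_mult_right[OF A(3) that] by (simp add: sum_distrib_right free_scale_mult_left)
  have pg: "path_ghost z * pth v \<approx> (if rng \<Lambda> (snd z) = v then path_ghost z else 0)"
    if "z \<in> A" "v \<in> V" for z v
  proof -
    note z = Az[OF that(1)]
    from kp_cong_mult_left[OF kp_ghost_vert[OF z(3) V(2)[OF that(2)]] pth_free_algebra[OF z(2)]]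
    show ?thesis by (simp add: path_ghost_def mult.assoc split: if_splits)
  qed
  have "\<exists>v\<in>V. p * pth v \<notin> kp_ideal \<Lambda>"
  proof (rule ccontr)
    assume "\<not> ?thesis"
    hence 0: "p * pth v \<approx> 0" if "v \<in> V" for v using that by (simp add: kp_cong_zero_iff)
    have "p * (\<Sum>v\<in>V. pth v) \<approx> (\<Sum>z\<in>A. free_scale (c z) (path_ghost z * (\<Sum>v\<in>V. pth v)))"
      using V by (intro right free_algebra_sum) (simp add: verts_mor)
    also have "\<dots> \<approx> (\<Sum>z\<in>A. free_scale (c z) (path_ghost z))"
    proof (intro kp_cong_sum kp_cong_scale)
      fix z assume z: "z \<in> A"
      have "path_ghost z * (\<Sum>v\<in>V. pth v) = (\<Sum>v\<in>V. path_ghost z * pth v)"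
        by (simp add: sum_distrib_left)
      also have "\<dots> \<approx> (\<Sum>v\<in>V. if rng \<Lambda> (snd z) = v then path_ghost z else 0)"
        using pg[OF z] by (rule kp_cong_sum)
      also have "\<dots> = path_ghost z" using z V(1) by (auto simp: V_def)
      finally show "path_ghost z * (\<Sum>v\<in>V. pth v) \<approx> path_ghost z" .
    qed
    also have "\<dots> \<approx> p" by (rule kp_cong_sym[OF A(3)])
    finally have "p \<approx> (\<Sum>v\<in>V. p * pth v)" by (simp add: sum_distrib_left kp_cong_sym)
    also have "\<dots> \<approx> (\<Sum>v\<in>V. 0)" using 0 by (rule kp_cong_sum)
    finally show False using p(2) by (simp add: kp_cong_zero_iff)
  qed
  then obtain v where v: "v \<in> V" "p * pth v \<notin> kp_ideal \<Lambda>" by blast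
  \<comment> \<open>Adding up the degrees of all ghosts is a crude common upper bound for
    them.\<close>
  define N where "N i = (\<Sum>z\<in>A. deg \<Lambda> (snd z) i)" for i
  have N: "deg \<Lambda> (snd z) \<le> N" if "z \<in> A" for z
    unfolding le_fun_def N_def using that A(1) by (auto intro: member_le_sum)
  have "path_ghost z * pth v \<in> mspan (bounded_pairs v N)" if z: "z \<in> A" for z
  proof (rule mspan_cong[OF pg[OF z v(1)]])
    have "z \<in> bounded_pairs v N" if "rng \<Lambda> (snd z) = v"
      using that N[OF z] Az[OF z] by (auto simp: bounded_pairs_def)
    thus "(if rng \<Lambda> (snd z) = v then path_ghost z else 0) \<in> mspan (bounded_pairs v N)"
      by (simp add: mspan_zero mspan_path_ghost bounded_pairs_subset)
  qed
  hence "p * pth v \<in> mspan (bounded_pairs v N)"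
    using V(2)[OF v(1)]
    by (intro mspan_cong[OF right] mspan_sum mspan_scale) (simp_all add: verts_mor)
  with that v V(2) show ?thesis by blast
qed

lemma nonzero_multiple_vertex:
  assumes fa: "finitely_aligned \<Lambda>" and ap: "aperiodic \<Lambda>"
    and p: "p \<in> free_algebra \<Lambda>" "p \<notin> kp_ideal \<Lambda>"
  obtains a b r v where "a \<in> free_algebra \<Lambda>" "b \<in> free_algebra \<Lambda>" "r \<noteq> 0" "v \<in> verts \<Lambda>"
    "a * p * b \<approx> free_scale r (pth v)"
proof -
  obtain v N where v: "v \<in> verts \<Lambda>" "p * pth v \<notin> kp_ideal \<Lambda>" "p * pth v \<in> mspan (bounded_pairs v N)"
    using nonzero_at_vertex[OF p] .
  from nonzero_path_combination_bounded[OF v(3,1,2)] obtain \<nu> L d where \<nu>: "\<nu> \<in> mor \<Lambda>" and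
    L: "finite L" "L \<noteq> {}" "\<And>\<alpha>. \<alpha> \<in> L \<Longrightarrow> \<alpha> \<in> mor \<Lambda> \<and> src \<Lambda> \<alpha> = src \<Lambda> \<nu> \<and> d \<alpha> \<noteq> 0"
    and eq: "p * pth v * pth \<nu> \<approx> (\<Sum>\<alpha>\<in>L. free_scale (d \<alpha>) (pth \<alpha>))" by blast
  \<comment> \<open>All pairs of distinct paths in \<open>L\<close> are to be separated by one
    \<tau>.\<close>
  define D where "D = {(\<alpha>, \<mu>) \<in> L \<times> L. \<alpha> \<noteq> \<mu>}"
  have D: "finite D" by (rule finite_subset[of _ "L \<times> L"]) (use L in \<open>auto simp: D_def\<close>)
  have DL: "\<alpha> \<in> mor \<Lambda> \<and> \<mu> \<in> mor \<Lambda> \<and> src \<Lambda> \<alpha> = src \<Lambda> \<nu> \<and> src \<Lambda> \<mu> = src \<Lambda> \<nu> \<and> \<alpha> \<noteq> \<mu>"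
    if "(\<alpha>, \<mu>) \<in> D" for \<alpha> \<mu>
    using that L(3) by (auto simp: D_def)
  obtain \<tau> where \<tau>: "\<tau> \<in> mor \<Lambda>" "rng \<Lambda> \<tau> = src \<Lambda> \<nu>"
    and disj: "\<And>\<alpha> \<mu>. (\<alpha>, \<mu>) \<in> D \<Longrightarrow> Lmin \<Lambda> (cmp \<Lambda> \<alpha> \<tau>) (cmp \<Lambda> \<mu> \<tau>) = {}"
    using aperiodic_separates_finite[OF fa ap src_verts[OF \<nu>] D DL] by blast
  obtain \<alpha> where \<alpha>: "\<alpha> \<in> L" using L(2) by blast
  let ?a = "gst (cmp \<Lambda> \<alpha> \<tau>)" and ?b = "pth v * pth \<nu> * pth \<tau>"
  have c: "cmp \<Lambda> \<mu> \<tau> \<in> mor \<Lambda>" "src \<Lambda> (cmp \<Lambda> \<mu> \<tau>) = src \<Lambda> \<tau>" if "\<mu> \<in> L" for \<mu>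
    using L(3)[OF that] \<tau> by (simp_all add: cmp_mor src_cmp)
  have a: "?a \<in> free_algebra \<Lambda>" using c[OF \<alpha>] by simp
  have b: "?b \<in> free_algebra \<Lambda>"
    using v(1) \<nu> \<tau> by (intro free_algebra_mult) (simp_all add: verts_mor)
  have "?a * p * ?b = ?a * ((p * pth v * pth \<nu>) * pth \<tau>)" by (simp add: mult.assoc)
  also have "\<dots> \<approx> ?a * ((\<Sum>\<mu>\<in>L. free_scale (d \<mu>) (pth \<mu>)) * pth \<tau>)"
    using eq a \<tau> by (intro kp_cong_mult_left kp_cong_mult_right) simp_all
  also have "\<dots> = (\<Sum>\<mu>\<in>L. free_scale (d \<mu>) (?a * (pth \<mu> * pth \<tau>)))"
    by (simp add: sum_distrib_left sum_distrib_right free_scale_mult_left free_scale_mult_right)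
  \<comment> \<open>The ghost of \<alpha>\<tau> annihilates \<mu>\<tau> for every other \<mu>, by
    separation, and reduces \<alpha>\<tau> to its source.\<close>
  also have "\<dots> \<approx> (\<Sum>\<mu>\<in>L. free_scale (d \<mu>) (if \<alpha> = \<mu> then pth (src \<Lambda> \<tau>) else 0))"
  proof (intro kp_cong_sum kp_cong_scale)
    fix \<mu> assume \<mu>: "\<mu> \<in> L"
    have "?a * (pth \<mu> * pth \<tau>) \<approx> ?a * pth (cmp \<Lambda> \<mu> \<tau>)"
      using L(3)[OF \<mu>] \<tau> a by (intro kp_cong_mult_left kp_path_mult) simp_all
    also have "\<dots> \<approx> (if \<alpha> = \<mu> then pth (src \<Lambda> \<tau>) else 0)"
    proof (cases "\<alpha> = \<mu>")
      case True
      thus ?thesis using kp_ghost_path_self[OF c(1)[OF \<mu>]] c(2)[OF \<mu>] by simp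
    next
      case False
      hence "(\<alpha>, \<mu>) \<in> D" using \<alpha> \<mu> by (simp add: D_def)
      from kp_ghost_path_disjoint[OF c(1)[OF \<alpha>] c(1)[OF \<mu>] disj[OF this]] False
      show ?thesis by simp
    qed
    finally show "?a * (pth \<mu> * pth \<tau>) \<approx> (if \<alpha> = \<mu> then pth (src \<Lambda> \<tau>) else 0)" .
  qed
  also have "\<dots> = (\<Sum>\<mu>\<in>L. if \<alpha> = \<mu> then free_scale (d \<mu>) (pth (src \<Lambda> \<tau>)) else 0)"
    by (intro sum.cong) (auto simp: free_scale_zero_right)
  also have "\<dots> = free_scale (d \<alpha>) (pth (src \<Lambda> \<tau>))" using L(1) \<alpha> by simp
  finally show ?thesis using that a b L(3)[OF \<alpha>] src_verts[OF \<tau>(1)] by blast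
qed

end

theorem theorem8p1:
  fixes \<Lambda> :: "('e, 'k::finite) kgraph_data"
    and scale :: "'r::{comm_ring,comm_monoid_mult} \<Rightarrow> 'a::ring \<Rightarrow> 'a"
    and \<pi> :: "('e, 'r) pre_kp set \<Rightarrow> 'a"
  assumes "kgraph \<Lambda>"
    and "finitely_aligned \<Lambda>"
    and "aperiodic \<Lambda>"
    and "r_algebra scale"
    and "kp_hom \<Lambda> scale \<pi>"
    and "\<And>r v. \<lbrakk>r \<noteq> 0; v \<in> verts \<Lambda>\<rbrakk> \<Longrightarrow> \<pi> (kp_scale \<Lambda> r (kp_gen \<Lambda> (Path v))) \<noteq> 0"
  shows "inj_on \<pi> (KP \<Lambda>)"
proof (rule inj_onI)
  interpret kgraph \<Lambda> by fact
  note hom = assms(5)[unfolded kp_hom_def KP_def]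
  have add: "\<pi> (kp_class \<Lambda> (p + q)) = \<pi> (kp_class \<Lambda> p) + \<pi> (kp_class \<Lambda> q)"
    and mult: "\<pi> (kp_class \<Lambda> (p * q)) = \<pi> (kp_class \<Lambda> p) * \<pi> (kp_class \<Lambda> q)"
    if "p \<in> free_algebra \<Lambda>" "q \<in> free_algebra \<Lambda>" for p q
    using that hom by (auto simp flip: kp_add_class kp_mult_class)
  fix X Y assume X: "X \<in> KP \<Lambda>" and Y: "Y \<in> KP \<Lambda>" and eq: "\<pi> X = \<pi> Y"
  obtain p q where p: "p \<in> free_algebra \<Lambda>" "X = kp_class \<Lambda> p"
    and q: "q \<in> free_algebra \<Lambda>" "Y = kp_class \<Lambda> q"
    using X Y by (auto simp: KP_def)
  have d: "p - q \<in> free_algebra \<Lambda>" using p(1) q(1) by (rule free_algebra_diff)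
  \<comment> \<open>Additivity is applied to (p - q) + q = p.\<close>
  have 0: "\<pi> (kp_class \<Lambda> (p - q)) = 0" using add[OF d q(1)] eq p q by simp
  \<comment> \<open>Otherwise compression turns p - q into a nonzero multiple of a vertex. By
    multiplicativity \<open>\<pi>\<close> sends this multiple to 0, against the hypothesis on
    vertices.\<close>
  have "p - q \<in> kp_ideal \<Lambda>"
  proof (rule ccontr)
    assume "p - q \<notin> kp_ideal \<Lambda>"
    from nonzero_multiple_vertex[OF assms(2,3) d this] obtain a b r v where
      ab: "a \<in> free_algebra \<Lambda>" "b \<in> free_algebra \<Lambda>" and r: "r \<noteq> 0" "v \<in> verts \<Lambda>"
      and c: "a * (p - q) * b \<approx> free_scale r (pth v)" .
    have "\<pi> (kp_class \<Lambda> (a * (p - q) * b)) = 0"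
      using ab d 0 by (simp add: mult free_algebra_mult)
    moreover have "kp_class \<Lambda> (a * (p - q) * b) = kp_scale \<Lambda> r (kp_gen \<Lambda> (Path v))"
      using c r(2) by (simp add: kp_cong_def kp_class_eq_iff kp_gen_def kp_scale_class verts_mor)
    ultimately show False using assms(6)[OF r] by simp
  qed
  thus "X = Y" using p q by (simp add: kp_class_eq_iff)
qed

end
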